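(* Let $\mathbb{T}$ be a geometric theory of presheaf type and let $\mathbb{Q}$ be a quotient extension of $\mathbb{T}$ consisting of finitely many axioms of the form $\phi\vdash_{[]}\psi$ with empty context (where $\phi,\psi$ are closed geometric formulas over the signature of $\mathbb{T}$). Then $\mathbb{Q}$ is a rigid-topology quotient of $\mathbb{T}$.
   Context: A geometric theory $\mathbb{T}$ is of presheaf type if its classifying (Grothendieck) topos is equivalent to a presheaf topos; in this case it is classified by $[\mathbb{T}\text{-mod}(\mathrm{Set})_c,\mathrm{Set}]$, where $\mathbb{T}\text{-mod}(\mathrm{Set})_c$ is the full subcategory of compact (= finitely presentable) objects of the category of $\mathbb{T}$-models in $\mathrm{Set}$, with universal model the tautological one, interpreting a sort $A$ as the functor sending a compact model $N$ to its interpretation $[\![A]\!]_N$. A quotient extension $\mathbb{Q}$ of $\mathbb{T}$ is a set of additional geometric axioms over the signature of $\mathbb{T}$; by the duality between quotient theories and subtoposes it corresponds to a subtopos of the classifying topos and hence to a Grothendieck topology $J_{\mathbb{Q}}$ on $(\mathbb{T}\text{-mod}(\mathrm{Set})_c)^{\mathrm{op}}$ (so $\mathrm{Sh}((\mathbb{T}\text{-mod}(\mathrm{Set})_c)^{\mathrm{op}},J_{\mathbb{Q}})$ is the largest subtopos in which the axioms of $\mathbb{Q}$ hold for the restricted universal model). A Grothendieck topology is rigid if every object is covered by (a sieve generated by arrows from) irreducible objects, where an object is irreducible if its only covering sieve is the maximal one. $\mathbb{Q}$ is a rigid-topology quotient of $\mathbb{T}$ if $J_{\mathbb{Q}}$ is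 rigid. *)

theory Defs
  imports "HOL-Library.Equipollence"
begin

section \<open>Universes\<close>

text \<open>
  A type \<open>'u\<close> plays the role of a universe: a set, of elements of any type, is small when
  its cardinality is strictly below that of \<open>'u\<close>, and the small subsets of \<open>'u\<close> form the
  category of sets.  The cardinality of \<open>'u\<close> has to be regular and a strong limit.  The
  uncountable such cardinals (the inaccessible ones) give the usual Grothendieck universes.
  The countable case (hereditarily finite sets) is not excluded: it makes everything below
  only more general, and it shows that the condition is satisfiable.
\<close>

definition universe :: "'u itself \<Rightarrow> bool" where
  "universe U \<longleftrightarrow>
     infinite (UNIV :: 'u set) \<and>
     (\<forall>A :: 'u set. A \<prec> (UNIV :: 'u set) \<longrightarrow> Pow A \<prec> (UNIV :: 'u set)) \<and>
     (\<forall>(A :: 'u set) (B :: 'u \<Rightarrow> 'u set). A \<prec> (UNIV :: 'u set) \<longrightarrow>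
        (\<forall>a\<in>A. B a \<prec> (UNIV :: 'u set)) \<longrightarrow> (\<Union>a\<in>A. B a) \<prec> (UNIV :: 'u set))"

abbreviation small :: "'u set \<Rightarrow> bool" where
  "small A \<equiv> A \<prec> (UNIV :: 'u set)"

lemma small_nat_iff: "small (A :: nat set) \<longleftrightarrow> finite A"
proof
  show "small A \<Longrightarrow> finite A"
    using to_nat_on_infinite[of A] by (auto simp: lesspoll_def eqpoll_def)
qed (simp add: finite_lesspoll_infinite)

lemma universe_nat: "universe TYPE(nat)"
  unfolding universe_def small_nat_iff
  by (auto intro: finite_lesspoll_infinite)


section \<open>Categories\<close>

record ('o, 'a) cat =
  Obj :: "'o set"
  Arr :: "'a set"
  Dom :: "'a \<Rightarrow> 'o"
  Cod :: "'a \<Rightarrow> 'o"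
  Ident :: "'o \<Rightarrow> 'a"
  Comp :: "'a \<Rightarrow> 'a \<Rightarrow> 'a"  \<comment> \<open>\<open>Comp C g f\<close> is \<open>g\<close> after \<open>f\<close>\<close>

definition hom :: "('o, 'a) cat \<Rightarrow> 'o \<Rightarrow> 'o \<Rightarrow> 'a set" where
  "hom C c d = {f \<in> Arr C. Dom C f = c \<and> Cod C f = d}"

definition category :: "('o, 'a) cat \<Rightarrow> bool" where
  "category C \<longleftrightarrow>
     (\<forall>f\<in>Arr C. Dom C f \<in> Obj C \<and> Cod C f \<in> Obj C) \<and>
     (\<forall>c\<in>Obj C. Ident C c \<in> hom C c c) \<and>
     (\<forall>f\<in>Arr C. \<forall>g\<in>Arr C. Dom C g = Cod C f \<longrightarrow> Comp C g f \<in> hom C (Dom C f) (Cod C g)) \<and>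
     (\<forall>f\<in>Arr C. Comp C f (Ident C (Dom C f)) = f \<and> Comp C (Ident C (Cod C f)) f = f) \<and>
     (\<forall>f\<in>Arr C. \<forall>g\<in>Arr C. \<forall>h\<in>Arr C. Dom C g = Cod C f \<longrightarrow> Dom C h = Cod C g \<longrightarrow>
        Comp C h (Comp C g f) = Comp C (Comp C h g) f)"

definition small_category :: "('u, 'u) cat \<Rightarrow> bool" where
  "small_category C \<longleftrightarrow> category C \<and> small (Obj C) \<and> small (Arr C)"

definition op :: "('o, 'a) cat \<Rightarrow> ('o, 'a) cat" where
  "op C = \<lparr>Obj = Obj C, Arr = Arr C, Dom = Cod C, Cod = Dom C, Ident = Ident C,
           Comp = (\<lambda>g f. Comp C f g)\<rparr>"

definition full_subcategory :: "('o, 'a) cat \<Rightarrow> 'o set \<Rightarrow> ('o, 'a) cat" where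
  "full_subcategory C X =
     C\<lparr>Obj := Obj C \<inter> X, Arr := {f \<in> Arr C. Dom C f \<in> X \<and> Cod C f \<in> X}\<rparr>"

definition isomorphic :: "('o, 'a) cat \<Rightarrow> 'o \<Rightarrow> 'o \<Rightarrow> bool" where
  "isomorphic C c d \<longleftrightarrow>
     (\<exists>f\<in>hom C c d. \<exists>g\<in>hom C d c. Comp C g f = Ident C c \<and> Comp C f g = Ident C d)"

record ('o, 'a, 'p, 'b) func =
  FO :: "'o \<Rightarrow> 'p"
  FA :: "'a \<Rightarrow> 'b"

definition is_functor ::
    "('o, 'a) cat \<Rightarrow> ('p, 'b) cat \<Rightarrow> ('o, 'a, 'p, 'b) func \<Rightarrow> bool" where
  "is_functor C D F \<longleftrightarrow>
     (\<forall>c\<in>Obj C. FO F c \<in> Obj D) \<and>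
     (\<forall>f\<in>Arr C. FA F f \<in> hom D (FO F (Dom C f)) (FO F (Cod C f))) \<and>
     (\<forall>c\<in>Obj C. FA F (Ident C c) = Ident D (FO F c)) \<and>
     (\<forall>f\<in>Arr C. \<forall>g\<in>Arr C. Dom C g = Cod C f \<longrightarrow>
        FA F (Comp C g f) = Comp D (FA F g) (FA F f))"

definition func_comp ::
    "('p, 'b, 'q, 'c) func \<Rightarrow> ('o, 'a, 'p, 'b) func \<Rightarrow> ('o, 'a, 'q, 'c) func" where
  "func_comp G F = \<lparr>FO = FO G \<circ> FO F, FA = FA G \<circ> FA F\<rparr>"

text \<open>Natural transformations are extensional families, so that equality is the intended one.\<close>

definition nat_transfs ::
    "('o, 'a) cat \<Rightarrow> ('p, 'b) cat \<Rightarrow> ('o, 'a, 'p, 'b) func \<Rightarrow> ('o, 'a, 'p, 'b) func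
     \<Rightarrow> ('o \<Rightarrow> 'b) set" where
  "nat_transfs C D F G =
     {\<alpha> \<in> (\<Pi>\<^sub>E c\<in>Obj C. hom D (FO F c) (FO G c)).
        \<forall>f\<in>Arr C. Comp D (\<alpha> (Cod C f)) (FA F f) = Comp D (FA G f) (\<alpha> (Dom C f))}"

definition is_cone ::
    "('i, 'j) cat \<Rightarrow> ('o, 'a) cat \<Rightarrow> ('i, 'j, 'o, 'a) func \<Rightarrow> 'o \<Rightarrow> ('i \<Rightarrow> 'a) \<Rightarrow> bool" where
  "is_cone I C D L l \<longleftrightarrow>
     L \<in> Obj C \<and> (\<forall>i\<in>Obj I. l i \<in> hom C L (FO D i)) \<and>
     (\<forall>u\<in>Arr I. Comp C (FA D u) (l (Dom I u)) = l (Cod I u))"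

definition is_limit ::
    "('i, 'j) cat \<Rightarrow> ('o, 'a) cat \<Rightarrow> ('i, 'j, 'o, 'a) func \<Rightarrow> 'o \<Rightarrow> ('i \<Rightarrow> 'a) \<Rightarrow> bool" where
  "is_limit I C D L l \<longleftrightarrow>
     is_cone I C D L l \<and>
     (\<forall>L' l'. is_cone I C D L' l' \<longrightarrow>
        (\<exists>!h. h \<in> hom C L' L \<and> (\<forall>i\<in>Obj I. Comp C (l i) h = l' i)))"

definition is_colimit ::
    "('i, 'j) cat \<Rightarrow> ('o, 'a) cat \<Rightarrow> ('i, 'j, 'o, 'a) func \<Rightarrow> 'o \<Rightarrow> ('i \<Rightarrow> 'a) \<Rightarrow> bool" where
  "is_colimit I C D L l \<longleftrightarrow> is_limit (op I) (op C) D L l"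

definition preserves_finite_limits ::
    "('o, 'a) cat \<Rightarrow> ('p, 'b) cat \<Rightarrow> ('o, 'a, 'p, 'b) func \<Rightarrow> bool" where
  "preserves_finite_limits C E F \<longleftrightarrow>
     (\<forall>(I :: (nat, nat) cat) D L l.
        category I \<longrightarrow> finite (Obj I) \<longrightarrow> finite (Arr I) \<longrightarrow> is_functor I C D \<longrightarrow>
        is_limit I C D L l \<longrightarrow> is_limit I E (func_comp F D) (FO F L) (\<lambda>i. FA F (l i)))"

text \<open>\<open>F\<close> is left adjoint to \<open>G\<close>.\<close>

definition adjunction ::
    "('o, 'a) cat \<Rightarrow> ('p, 'b) cat \<Rightarrow> ('o, 'a, 'p, 'b) func \<Rightarrow> ('p, 'b, 'o, 'a) func \<Rightarrow> bool" where
  "adjunction C E F G \<longleftrightarrow>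
     is_functor C E F \<and> is_functor E C G \<and>
     (\<exists>\<Phi>. (\<forall>c\<in>Obj C. \<forall>e\<in>Obj E. bij_betw (\<Phi> c e) (hom E (FO F c) e) (hom C c (FO G e))) \<and>
          (\<forall>k\<in>Arr C. \<forall>m\<in>Arr E. \<forall>h\<in>hom E (FO F (Cod C k)) (Dom E m).
             \<Phi> (Dom C k) (Cod E m) (Comp E m (Comp E h (FA F k))) =
             Comp C (FA G m) (Comp C (\<Phi> (Cod C k) (Dom E m) h) k)))"

definition filtered :: "('i, 'j) cat \<Rightarrow> bool" where
  "filtered I \<longleftrightarrow>
     Obj I \<noteq> {} \<and>
     (\<forall>i\<in>Obj I. \<forall>j\<in>Obj I. \<exists>k\<in>Obj I. hom I i k \<noteq> {} \<and> hom I j k \<noteq> {}) \<and>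
     (\<forall>i\<in>Obj I. \<forall>j\<in>Obj I. \<forall>u\<in>hom I i j. \<forall>v\<in>hom I i j.
        \<exists>w\<in>Arr I. Dom I w = j \<and> Comp I w u = Comp I w v)"

text \<open>
  The cocone \<open>l\<close> from the diagram of sets \<open>(S, t)\<close> to the set \<open>L\<close> is a colimit: \<open>L\<close> is the
  disjoint union of the \<open>S i\<close> modulo the equivalence relation generated by \<open>x \<sim> t u x\<close>.
\<close>

definition is_set_colimit ::
    "('i, 'j) cat \<Rightarrow> ('i \<Rightarrow> 'x set) \<Rightarrow> ('j \<Rightarrow> 'x \<Rightarrow> 'x) \<Rightarrow> 'y set \<Rightarrow> ('i \<Rightarrow> 'x \<Rightarrow> 'y) \<Rightarrow> bool" where
  "is_set_colimit I S t L l \<longleftrightarrow>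
     (let r = {((Dom I u, x), (Cod I u, t u x)) | u x. u \<in> Arr I \<and> x \<in> S (Dom I u)}
      in (\<Union>i\<in>Obj I. l i ` S i) = L \<and>
         (\<forall>i\<in>Obj I. \<forall>j\<in>Obj I. \<forall>x\<in>S i. \<forall>y\<in>S j.
            l i x = l j y \<longleftrightarrow> ((i, x), (j, y)) \<in> (r \<union> r\<inverse>)\<^sup>*))"

text \<open>
  Compact (finitely presentable) objects: \<open>hom C c _\<close> preserves small filtered colimits.
  The smallness of the index categories refers to the universe \<open>'u\<close>.
\<close>

definition compact_object :: "'u itself \<Rightarrow> ('o, 'a) cat \<Rightarrow> 'o \<Rightarrow> bool" where
  "compact_object U C c \<longleftrightarrow>
     c \<in> Obj C \<and>
     (\<forall>(I :: ('u, 'u) cat) D L l.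
        small_category I \<longrightarrow> filtered I \<longrightarrow> is_functor I C D \<longrightarrow> is_colimit I C D L l \<longrightarrow>
        is_set_colimit I (\<lambda>i. hom C c (FO D i)) (\<lambda>u. Comp C (FA D u))
          (hom C c L) (\<lambda>i. Comp C (l i)))"


section \<open>Grothendieck topologies and sheaves\<close>

definition max_sieve :: "('o, 'a) cat \<Rightarrow> 'o \<Rightarrow> 'a set" where
  "max_sieve C c = {f \<in> Arr C. Cod C f = c}"

definition is_sieve :: "('o, 'a) cat \<Rightarrow> 'o \<Rightarrow> 'a set \<Rightarrow> bool" where
  "is_sieve C c S \<longleftrightarrow>
     S \<subseteq> max_sieve C c \<and> (\<forall>f\<in>S. \<forall>g\<in>Arr C. Cod C g = Dom C f \<longrightarrow> Comp C f g \<in> S)"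

definition generated_sieve :: "('o, 'a) cat \<Rightarrow> 'a set \<Rightarrow> 'a set" where
  "generated_sieve C X = {Comp C f g | f g. f \<in> X \<and> g \<in> Arr C \<and> Cod C g = Dom C f}"

definition pullback_sieve :: "('o, 'a) cat \<Rightarrow> 'a \<Rightarrow> 'a set \<Rightarrow> 'a set" where
  "pullback_sieve C f S = {g \<in> max_sieve C (Dom C f). Comp C f g \<in> S}"

definition grothendieck_topology :: "('o, 'a) cat \<Rightarrow> ('o \<Rightarrow> 'a set set) \<Rightarrow> bool" where
  "grothendieck_topology C J \<longleftrightarrow>
     (\<forall>c\<in>Obj C. \<forall>S\<in>J c. is_sieve C c S) \<and>
     (\<forall>c\<in>Obj C. max_sieve C c \<in> J c) \<and>
     (\<forall>f\<in>Arr C. \<forall>S\<in>J (Cod C f). pullback_sieve C f S \<in> J (Dom C f)) \<and>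
     (\<forall>c\<in>Obj C. \<forall>S\<in>J c. \<forall>R. is_sieve C c R \<longrightarrow>
        (\<forall>f\<in>S. pullback_sieve C f R \<in> J (Dom C f)) \<longrightarrow> R \<in> J c)"

definition trivial_topology :: "('o, 'a) cat \<Rightarrow> 'o \<Rightarrow> 'a set set" where
  "trivial_topology C c = {max_sieve C c}"

definition irreducible_object :: "('o, 'a) cat \<Rightarrow> ('o \<Rightarrow> 'a set set) \<Rightarrow> 'o \<Rightarrow> bool" where
  "irreducible_object C J c \<longleftrightarrow> c \<in> Obj C \<and> (\<forall>S\<in>J c. S = max_sieve C c)"

definition rigid_topology :: "('o, 'a) cat \<Rightarrow> ('o \<Rightarrow> 'a set set) \<Rightarrow> bool" where
  "rigid_topology C J \<longleftrightarrow>
     (\<forall>c\<in>Obj C. \<exists>X. X \<subseteq> {f \<in> Arr C. Cod C f = c \<and> irreducible_object C J (Dom C f)} \<and>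
        generated_sieve C X \<in> J c)"

record ('o, 'a, 'x) presheaf =
  sec :: "'o \<Rightarrow> 'x set"
  res :: "'a \<Rightarrow> 'x \<Rightarrow> 'x"

definition is_presheaf :: "('o, 'a) cat \<Rightarrow> ('o, 'a, 'x) presheaf \<Rightarrow> bool" where
  "is_presheaf C P \<longleftrightarrow>
     (\<forall>f\<in>Arr C. res P f \<in> sec P (Cod C f) \<rightarrow> sec P (Dom C f)) \<and>
     (\<forall>c\<in>Obj C. \<forall>x\<in>sec P c. res P (Ident C c) x = x) \<and>
     (\<forall>f\<in>Arr C. \<forall>g\<in>Arr C. Dom C f = Cod C g \<longrightarrow>
        (\<forall>x\<in>sec P (Cod C f). res P (Comp C f g) x = res P g (res P f x)))"

definition is_sheaf ::
    "('o, 'a) cat \<Rightarrow> ('o \<Rightarrow> 'a set set) \<Rightarrow> ('o, 'a, 'x) presheaf \<Rightarrow> bool" where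
  "is_sheaf C J P \<longleftrightarrow>
     is_presheaf C P \<and>
     (\<forall>c\<in>Obj C. \<forall>S\<in>J c. \<forall>x.
        (\<forall>f\<in>S. x f \<in> sec P (Dom C f)) \<longrightarrow>
        (\<forall>f\<in>S. \<forall>g\<in>Arr C. Cod C g = Dom C f \<longrightarrow> x (Comp C f g) = res P g (x f)) \<longrightarrow>
        (\<exists>!s. s \<in> sec P c \<and> (\<forall>f\<in>S. res P f s = x f)))"

definition presheaf_maps ::
    "('o, 'a) cat \<Rightarrow> ('o, 'a, 'x) presheaf \<Rightarrow> ('o, 'a, 'y) presheaf \<Rightarrow> ('o \<Rightarrow> 'x \<Rightarrow> 'y) set" where
  "presheaf_maps C P Q =
     {\<eta> \<in> (\<Pi>\<^sub>E c\<in>Obj C. sec P c \<rightarrow>\<^sub>E sec Q c).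
        \<forall>f\<in>Arr C. \<forall>x\<in>sec P (Cod C f). \<eta> (Dom C f) (res P f x) = res Q f (\<eta> (Cod C f) x)}"

text \<open>Arrows between sheaves are triples (domain, components, codomain).\<close>

type_synonym ('o, 'a, 'x) sheaf_arr =
  "('o, 'a, 'x) presheaf \<times> ('o \<Rightarrow> 'x \<Rightarrow> 'x) \<times> ('o, 'a, 'x) presheaf"

abbreviation component :: "('o, 'a, 'x) sheaf_arr \<Rightarrow> 'o \<Rightarrow> 'x \<Rightarrow> 'x" where
  "component \<eta> \<equiv> fst (snd \<eta>)"

text \<open>The topos of sheaves of small sets.\<close>

definition Sh ::
    "('o, 'a) cat \<Rightarrow> ('o \<Rightarrow> 'a set set) \<Rightarrow> (('o, 'a, 'u) presheaf, ('o, 'a, 'u) sheaf_arr) cat" where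
  "Sh C J =
     \<lparr>Obj = {P. is_sheaf C J P \<and> (\<forall>c\<in>Obj C. small (sec P c))},
      Arr = {(P, \<eta>, Q). is_sheaf C J P \<and> (\<forall>c\<in>Obj C. small (sec P c)) \<and>
                        is_sheaf C J Q \<and> (\<forall>c\<in>Obj C. small (sec Q c)) \<and>
                        \<eta> \<in> presheaf_maps C P Q},
      Dom = (\<lambda>(P, \<eta>, Q). P),
      Cod = (\<lambda>(P, \<eta>, Q). Q),
      Ident = (\<lambda>P. (P, \<lambda>c\<in>Obj C. \<lambda>x\<in>sec P c. x, P)),
      Comp = (\<lambda>(Q', \<theta>, R) (P, \<eta>, Q). (P, \<lambda>c\<in>Obj C. compose (sec P c) (\<theta> c) (\<eta> c), R))\<rparr>"

abbreviation Psh ::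
    "('o, 'a) cat \<Rightarrow> (('o, 'a, 'u) presheaf, ('o, 'a, 'u) sheaf_arr) cat" where
  "Psh C \<equiv> Sh C (trivial_topology C)"

text \<open>
  Geometric morphisms from \<open>E\<close> to \<open>F\<close>, given by their inverse image functors (the direct
  image is determined up to isomorphism).
\<close>

definition inverse_image_functors ::
    "('o, 'a) cat \<Rightarrow> ('p, 'b) cat \<Rightarrow> ('p, 'b, 'o, 'a) func set" where
  "inverse_image_functors E F =
     {f. is_functor F E f \<and> preserves_finite_limits F E f \<and> (\<exists>g. adjunction F E f g)}"


section \<open>Geometric theories\<close>

record 'u signature =
  sorts :: "'u set"
  funs :: "'u set"
  rels :: "'u set"
  fdom :: "'u \<Rightarrow> 'u list"
  fcod :: "'u \<Rightarrow> 'u"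
  rdom :: "'u \<Rightarrow> 'u list"

definition wf_signature :: "'u signature \<Rightarrow> bool" where
  "wf_signature \<Sigma> \<longleftrightarrow>
     small (sorts \<Sigma>) \<and> small (funs \<Sigma>) \<and> small (rels \<Sigma>) \<and>
     (\<forall>f\<in>funs \<Sigma>. set (fdom \<Sigma> f) \<subseteq> sorts \<Sigma> \<and> fcod \<Sigma> f \<in> sorts \<Sigma>) \<and>
     (\<forall>r\<in>rels \<Sigma>. set (rdom \<Sigma> r) \<subseteq> sorts \<Sigma>)"

text \<open>
  A context is the list of the sorts of its variables, and \<open>Var i\<close> is its \<open>i\<close>-th variable.
  \<open>Exi A \<phi>\<close> binds variable 0 (of sort \<open>A\<close>) in \<open>\<phi>\<close> and shifts the others.  Disjunctions are
  indexed by small sets; those over the empty set and over two elements are falsum and the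
  binary disjunction.
\<close>

datatype 'u trm = Var nat | App 'u "'u trm list"

datatype 'u form =
    Tru
  | Eql "'u trm" "'u trm"
  | Rel 'u "'u trm list"
  | Conj "'u form" "'u form"
  | Disj "'u set" "'u \<Rightarrow> 'u form"
  | Exi 'u "'u form"

datatype 'u sequent = Sequent (ctx: "'u list") (ante: "'u form") (succ: "'u form")

inductive has_sort :: "'u signature \<Rightarrow> 'u list \<Rightarrow> 'u trm \<Rightarrow> 'u \<Rightarrow> bool" for \<Sigma> \<Gamma> where
  "i < length \<Gamma> \<Longrightarrow> has_sort \<Sigma> \<Gamma> (Var i) (\<Gamma> ! i)"
| "f \<in> funs \<Sigma> \<Longrightarrow> list_all2 (has_sort \<Sigma> \<Gamma>) ts (fdom \<Sigma> f) \<Longrightarrow>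
     has_sort \<Sigma> \<Gamma> (App f ts) (fcod \<Sigma> f)"
monos list_all2_mono

primrec wf_form :: "'u signature \<Rightarrow> 'u form \<Rightarrow> 'u list \<Rightarrow> bool" where
  "wf_form \<Sigma> Tru \<Gamma> \<longleftrightarrow> True"
| "wf_form \<Sigma> (Eql t u) \<Gamma> \<longleftrightarrow> (\<exists>A. has_sort \<Sigma> \<Gamma> t A \<and> has_sort \<Sigma> \<Gamma> u A)"
| "wf_form \<Sigma> (Rel r ts) \<Gamma> \<longleftrightarrow> r \<in> rels \<Sigma> \<and> list_all2 (has_sort \<Sigma> \<Gamma>) ts (rdom \<Sigma> r)"
| "wf_form \<Sigma> (Conj \<phi> \<psi>) \<Gamma> \<longleftrightarrow> wf_form \<Sigma> \<phi> \<Gamma> \<and> wf_form \<Sigma> \<psi> \<Gamma>"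
| "wf_form \<Sigma> (Disj I \<phi>) \<Gamma> \<longleftrightarrow> small I \<and> (\<forall>i\<in>I. wf_form \<Sigma> (\<phi> i) \<Gamma>)"
| "wf_form \<Sigma> (Exi A \<phi>) \<Gamma> \<longleftrightarrow> A \<in> sorts \<Sigma> \<and> wf_form \<Sigma> \<phi> (A # \<Gamma>)"

definition wf_sequent :: "'u signature \<Rightarrow> 'u sequent \<Rightarrow> bool" where
  "wf_sequent \<Sigma> \<sigma> \<longleftrightarrow>
     set (ctx \<sigma>) \<subseteq> sorts \<Sigma> \<and>
     wf_form \<Sigma> (ante \<sigma>) (ctx \<sigma>) \<and> wf_form \<Sigma> (succ \<sigma>) (ctx \<sigma>)"

record 'u gtheory =
  sig :: "'u signature"
  axs :: "'u sequent set"

definition geometric_theory :: "'u gtheory \<Rightarrow> bool" where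
  "geometric_theory T \<longleftrightarrow>
     wf_signature (sig T) \<and> axs T \<prec> (UNIV :: 'u set) \<and> (\<forall>\<sigma>\<in>axs T. wf_sequent (sig T) \<sigma>)"

text \<open>A quotient extension is given by its set of additional axioms.\<close>

definition quotient_extension :: "'u gtheory \<Rightarrow> 'u sequent set \<Rightarrow> bool" where
  "quotient_extension T Q \<longleftrightarrow> Q \<prec> (UNIV :: 'u set) \<and> (\<forall>\<sigma>\<in>Q. wf_sequent (sig T) \<sigma>)"


section \<open>Models in sets\<close>

record 'u struct =
  carr :: "'u \<Rightarrow> 'u set"
  fint :: "'u \<Rightarrow> 'u list \<Rightarrow> 'u"
  rint :: "'u \<Rightarrow> 'u list set"

definition tuples :: "'u struct \<Rightarrow> 'u list \<Rightarrow> 'u list set" where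
  "tuples M \<Gamma> = {xs. list_all2 (\<lambda>x A. x \<in> carr M A) xs \<Gamma>}"

definition is_struct :: "'u signature \<Rightarrow> 'u struct \<Rightarrow> bool" where
  "is_struct \<Sigma> M \<longleftrightarrow>
     (\<forall>A\<in>sorts \<Sigma>. small (carr M A)) \<and>
     (\<forall>f\<in>funs \<Sigma>. fint M f \<in> tuples M (fdom \<Sigma> f) \<rightarrow> carr M (fcod \<Sigma> f)) \<and>
     (\<forall>r\<in>rels \<Sigma>. rint M r \<subseteq> tuples M (rdom \<Sigma> r))"

primrec eval :: "'u struct \<Rightarrow> 'u list \<Rightarrow> 'u trm \<Rightarrow> 'u" where
  "eval M xs (Var i) = xs ! i"
| "eval M xs (App f ts) = fint M f (map (eval M xs) ts)"

primrec sat :: "'u struct \<Rightarrow> 'u form \<Rightarrow> 'u list \<Rightarrow> bool" where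
  "sat M Tru xs \<longleftrightarrow> True"
| "sat M (Eql t u) xs \<longleftrightarrow> eval M xs t = eval M xs u"
| "sat M (Rel r ts) xs \<longleftrightarrow> map (eval M xs) ts \<in> rint M r"
| "sat M (Conj \<phi> \<psi>) xs \<longleftrightarrow> sat M \<phi> xs \<and> sat M \<psi> xs"
| "sat M (Disj I \<phi>) xs \<longleftrightarrow> (\<exists>i\<in>I. sat M (\<phi> i) xs)"
| "sat M (Exi A \<phi>) xs \<longleftrightarrow> (\<exists>x\<in>carr M A. sat M \<phi> (x # xs))"

definition is_model :: "'u gtheory \<Rightarrow> 'u struct \<Rightarrow> bool" where
  "is_model T M \<longleftrightarrow>
     is_struct (sig T) M \<and>
     (\<forall>\<sigma>\<in>axs T. \<forall>xs\<in>tuples M (ctx \<sigma>). sat M (ante \<sigma>) xs \<longrightarrow> sat M (succ \<sigma>) xs)"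

definition struct_homs :: "'u signature \<Rightarrow> 'u struct \<Rightarrow> 'u struct \<Rightarrow> ('u \<Rightarrow> 'u \<Rightarrow> 'u) set" where
  "struct_homs \<Sigma> M N =
     {h \<in> (\<Pi>\<^sub>E A\<in>sorts \<Sigma>. carr M A \<rightarrow>\<^sub>E carr N A).
        (\<forall>f\<in>funs \<Sigma>. \<forall>xs\<in>tuples M (fdom \<Sigma> f).
           h (fcod \<Sigma> f) (fint M f xs) = fint N f (map2 h (fdom \<Sigma> f) xs)) \<and>
        (\<forall>r\<in>rels \<Sigma>. \<forall>xs\<in>rint M r. map2 h (rdom \<Sigma> r) xs \<in> rint N r)}"

type_synonym 'u struct_arr = "'u struct \<times> ('u \<Rightarrow> 'u \<Rightarrow> 'u) \<times> 'u struct"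

definition Mod :: "'u gtheory \<Rightarrow> ('u struct, 'u struct_arr) cat" where
  "Mod T =
     \<lparr>Obj = {M. is_model T M},
      Arr = {(M, h, N). is_model T M \<and> is_model T N \<and> h \<in> struct_homs (sig T) M N},
      Dom = (\<lambda>(M, h, N). M),
      Cod = (\<lambda>(M, h, N). N),
      Ident = (\<lambda>M. (M, \<lambda>A\<in>sorts (sig T). \<lambda>x\<in>carr M A. x, M)),
      Comp = (\<lambda>(N', k, R) (M, h, N).
                (M, \<lambda>A\<in>sorts (sig T). compose (carr M A) (k A) (h A), R))\<rparr>"

definition Mod_c :: "'u gtheory \<Rightarrow> ('u struct, 'u struct_arr) cat" where
  "Mod_c T = full_subcategory (Mod T) {M. compact_object TYPE('u) (Mod T) M}"


section \<open>Models in sheaf toposes\<close>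

text \<open>
  A structure in a topos of sheaves: function symbols are interpreted by their action on
  tuples of sections, relation symbols by subsheaves of products.
\<close>

record ('u, 'o, 'a, 'x) sheaf_struct =
  ssort :: "'u \<Rightarrow> ('o, 'a, 'x) presheaf"
  sfint :: "'u \<Rightarrow> 'o \<Rightarrow> 'x list \<Rightarrow> 'x"
  srint :: "'u \<Rightarrow> 'o \<Rightarrow> 'x list set"

definition stuples :: "('u, 'o, 'a, 'x) sheaf_struct \<Rightarrow> 'u list \<Rightarrow> 'o \<Rightarrow> 'x list set" where
  "stuples M \<Gamma> c = {xs. list_all2 (\<lambda>x A. x \<in> sec (ssort M A) c) xs \<Gamma>}"

definition sres :: "('u, 'o, 'a, 'x) sheaf_struct \<Rightarrow> 'u list \<Rightarrow> 'a \<Rightarrow> 'x list \<Rightarrow> 'x list" where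
  "sres M \<Gamma> g xs = map2 (\<lambda>A. res (ssort M A) g) \<Gamma> xs"

text \<open>The closure of a subpresheaf \<open>X\<close> of the product of the sorts in \<open>\<Gamma>\<close>.\<close>

definition sclosure ::
    "('o, 'a) cat \<Rightarrow> ('o \<Rightarrow> 'a set set) \<Rightarrow> ('u, 'o, 'a, 'x) sheaf_struct \<Rightarrow> 'u list
     \<Rightarrow> ('o \<Rightarrow> 'x list set) \<Rightarrow> 'o \<Rightarrow> 'x list set" where
  "sclosure C J M \<Gamma> X c =
     {xs \<in> stuples M \<Gamma> c. {g \<in> max_sieve C c. sres M \<Gamma> g xs \<in> X (Dom C g)} \<in> J c}"

definition is_sheaf_struct ::
    "'u signature \<Rightarrow> ('o, 'a) cat \<Rightarrow> ('o \<Rightarrow> 'a set set) \<Rightarrow> ('u, 'o, 'a, 'x) sheaf_struct \<Rightarrow> bool" where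
  "is_sheaf_struct \<Sigma> C J M \<longleftrightarrow>
     (\<forall>A\<in>sorts \<Sigma>. is_sheaf C J (ssort M A)) \<and>
     (\<forall>f\<in>funs \<Sigma>.
        (\<forall>c\<in>Obj C. sfint M f c \<in> stuples M (fdom \<Sigma> f) c \<rightarrow> sec (ssort M (fcod \<Sigma> f)) c) \<and>
        (\<forall>g\<in>Arr C. \<forall>xs\<in>stuples M (fdom \<Sigma> f) (Cod C g).
           sfint M f (Dom C g) (sres M (fdom \<Sigma> f) g xs) =
           res (ssort M (fcod \<Sigma> f)) g (sfint M f (Cod C g) xs))) \<and>
     (\<forall>r\<in>rels \<Sigma>.
        (\<forall>c\<in>Obj C. srint M r c \<subseteq> stuples M (rdom \<Sigma> r) c) \<and>
        (\<forall>g\<in>Arr C. \<forall>xs\<in>srint M r (Cod C g). sres M (rdom \<Sigma> r) g xs \<in> srint M r (Dom C g)) \<and>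
        (\<forall>c\<in>Obj C. sclosure C J M (rdom \<Sigma> r) (srint M r) c \<subseteq> srint M r c))"

primrec seval :: "('u, 'o, 'a, 'x) sheaf_struct \<Rightarrow> 'o \<Rightarrow> 'x list \<Rightarrow> 'u trm \<Rightarrow> 'x" where
  "seval M c xs (Var i) = xs ! i"
| "seval M c xs (App f ts) = sfint M f c (map (seval M c xs) ts)"

text \<open>
  The interpretation of a formula in context \<open>\<Gamma>\<close> as a subsheaf of the product of the sorts in
  \<open>\<Gamma>\<close>.  Unions of subsheaves and images along projections are the closures of the pointwise
  ones.
\<close>

primrec interp ::
    "('o, 'a) cat \<Rightarrow> ('o \<Rightarrow> 'a set set) \<Rightarrow> ('u, 'o, 'a, 'x) sheaf_struct \<Rightarrow> 'u form
     \<Rightarrow> 'u list \<Rightarrow> 'o \<Rightarrow> 'x list set" where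
  "interp C J M Tru \<Gamma> c = stuples M \<Gamma> c"
| "interp C J M (Eql t u) \<Gamma> c = {xs \<in> stuples M \<Gamma> c. seval M c xs t = seval M c xs u}"
| "interp C J M (Rel r ts) \<Gamma> c = {xs \<in> stuples M \<Gamma> c. map (seval M c xs) ts \<in> srint M r c}"
| "interp C J M (Conj \<phi> \<psi>) \<Gamma> c = interp C J M \<phi> \<Gamma> c \<inter> interp C J M \<psi> \<Gamma> c"
| "interp C J M (Disj I \<phi>) \<Gamma> c = sclosure C J M \<Gamma> (\<lambda>d. \<Union>i\<in>I. interp C J M (\<phi> i) \<Gamma> d) c"
| "interp C J M (Exi A \<phi>) \<Gamma> c = sclosure C J M \<Gamma> (\<lambda>d. tl ` interp C J M \<phi> (A # \<Gamma>) d) c"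

definition holds_in ::
    "('o, 'a) cat \<Rightarrow> ('o \<Rightarrow> 'a set set) \<Rightarrow> ('u, 'o, 'a, 'x) sheaf_struct \<Rightarrow> 'u sequent \<Rightarrow> bool" where
  "holds_in C J M \<sigma> \<longleftrightarrow>
     (\<forall>c\<in>Obj C. interp C J M (ante \<sigma>) (ctx \<sigma>) c \<subseteq> interp C J M (succ \<sigma>) (ctx \<sigma>) c)"

definition sheaf_struct_homs ::
    "'u signature \<Rightarrow> ('o, 'a) cat \<Rightarrow> ('o \<Rightarrow> 'a set set)
     \<Rightarrow> ('u, 'o, 'a, 'x) sheaf_struct \<Rightarrow> ('u, 'o, 'a, 'x) sheaf_struct
     \<Rightarrow> ('u \<Rightarrow> ('o, 'a, 'x) sheaf_arr) set" where
  "sheaf_struct_homs \<Sigma> C J M N =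
     {h \<in> (\<Pi>\<^sub>E A\<in>sorts \<Sigma>. hom (Sh C J) (ssort M A) (ssort N A)).
        \<forall>c\<in>Obj C.
          (\<forall>f\<in>funs \<Sigma>. \<forall>xs\<in>stuples M (fdom \<Sigma> f) c.
             component (h (fcod \<Sigma> f)) c (sfint M f c xs) =
             sfint N f c (map2 (\<lambda>A. component (h A) c) (fdom \<Sigma> f) xs)) \<and>
          (\<forall>r\<in>rels \<Sigma>. \<forall>xs\<in>srint M r c.
             map2 (\<lambda>A. component (h A) c) (rdom \<Sigma> r) xs \<in> srint N r c)}"

definition is_sheaf_model ::
    "'u gtheory \<Rightarrow> ('o, 'a) cat \<Rightarrow> ('o \<Rightarrow> 'a set set) \<Rightarrow> ('u, 'o, 'a, 'u) sheaf_struct \<Rightarrow> bool" where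
  "is_sheaf_model T C J M \<longleftrightarrow>
     is_sheaf_struct (sig T) C J M \<and>
     (\<forall>A\<in>sorts (sig T). \<forall>c\<in>Obj C. small (sec (ssort M A) c)) \<and>
     (\<forall>\<sigma>\<in>axs T. holds_in C J M \<sigma>)"

type_synonym ('u, 'o, 'a) model_arr =
  "('u, 'o, 'a, 'u) sheaf_struct \<times> ('u \<Rightarrow> ('o, 'a, 'u) sheaf_arr) \<times> ('u, 'o, 'a, 'u) sheaf_struct"

definition ModSh ::
    "'u gtheory \<Rightarrow> ('o, 'a) cat \<Rightarrow> ('o \<Rightarrow> 'a set set)
     \<Rightarrow> (('u, 'o, 'a, 'u) sheaf_struct, ('u, 'o, 'a) model_arr) cat" where
  "ModSh T C J =
     \<lparr>Obj = {M. is_sheaf_model T C J M},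
      Arr = {(M, h, N). is_sheaf_model T C J M \<and> is_sheaf_model T C J N \<and>
                        h \<in> sheaf_struct_homs (sig T) C J M N},
      Dom = (\<lambda>(M, h, N). M),
      Cod = (\<lambda>(M, h, N). N),
      Ident = (\<lambda>M. (M, \<lambda>A\<in>sorts (sig T). Ident (Sh C J) (ssort M A), M)),
      Comp = (\<lambda>(N', k, R) (M, h, N). (M, \<lambda>A\<in>sorts (sig T). Comp (Sh C J) (k A) (h A), R))\<rparr>"


section \<open>Classifying toposes and theories of presheaf type\<close>

text \<open>
  The object \<open>P\<close>, with the list \<open>ps\<close> of arrows to the sorts in \<open>\<Gamma>\<close>, represents the subobject
  \<open>R\<close> of the product of these sorts.  For \<open>R = stuples M \<Gamma>\<close> it is a product of the sorts.
\<close>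

definition represents_subobject ::
    "('o, 'a) cat \<Rightarrow> ('o \<Rightarrow> 'a set set) \<Rightarrow> ('u, 'o, 'a, 'u) sheaf_struct \<Rightarrow> 'u list
     \<Rightarrow> ('o \<Rightarrow> 'u list set) \<Rightarrow> ('o, 'a, 'u) presheaf \<Rightarrow> ('o, 'a, 'u) sheaf_arr list \<Rightarrow> bool" where
  "represents_subobject C J M \<Gamma> R P ps \<longleftrightarrow>
     P \<in> Obj (Sh C J) \<and>
     list_all2 (\<lambda>p A. p \<in> hom (Sh C J) P (ssort M A)) ps \<Gamma> \<and>
     (\<forall>c\<in>Obj C. bij_betw (\<lambda>x. map (\<lambda>p. component p c x) ps) (sec P c) (R c))"

text \<open>
  \<open>N\<close> is the image of the structure \<open>M\<close> in \<open>Sh C J\<close> under the inverse image functor \<open>f\<close> to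
  \<open>Sh D K\<close>: on sorts it is \<open>f\<close>, a function symbol is interpreted by the value of \<open>f\<close> on its
  interpretation in \<open>M\<close> (products being preserved by \<open>f\<close>), and a relation symbol by the
  subobject to which \<open>f\<close> takes its interpretation in \<open>M\<close>.
\<close>

definition is_inverse_image ::
    "'u signature \<Rightarrow> ('o, 'a) cat \<Rightarrow> ('o \<Rightarrow> 'a set set) \<Rightarrow> ('p, 'b) cat \<Rightarrow> ('p \<Rightarrow> 'b set set)
     \<Rightarrow> (('o, 'a, 'u) presheaf, ('o, 'a, 'u) sheaf_arr,
         ('p, 'b, 'u) presheaf, ('p, 'b, 'u) sheaf_arr) func
     \<Rightarrow> ('u, 'o, 'a, 'u) sheaf_struct \<Rightarrow> ('u, 'p, 'b, 'u) sheaf_struct \<Rightarrow> bool" where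
  "is_inverse_image \<Sigma> C J D K f M N \<longleftrightarrow>
     (\<forall>A\<in>sorts \<Sigma>. ssort N A = FO f (ssort M A)) \<and>
     (\<forall>s\<in>funs \<Sigma>. \<forall>P ps q.
        represents_subobject C J M (fdom \<Sigma> s) (stuples M (fdom \<Sigma> s)) P ps \<longrightarrow>
        q \<in> hom (Sh C J) P (ssort M (fcod \<Sigma> s)) \<longrightarrow>
        (\<forall>c\<in>Obj C. \<forall>x\<in>sec P c.
           component q c x = sfint M s c (map (\<lambda>p. component p c x) ps)) \<longrightarrow>
        (\<forall>d\<in>Obj D. \<forall>y\<in>sec (FO f P) d.
           component (FA f q) d y = sfint N s d (map (\<lambda>p. component (FA f p) d y) ps))) \<and>
     (\<forall>r\<in>rels \<Sigma>. \<forall>P ps.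
        represents_subobject C J M (rdom \<Sigma> r) (srint M r) P ps \<longrightarrow>
        represents_subobject D K N (rdom \<Sigma> r) (srint N r) (FO f P) (map (FA f) ps))"

text \<open>
  \<open>Sh C J\<close> is a classifying topos of \<open>T\<close> with universal model \<open>U\<close>: for each Grothendieck
  topos \<open>Sh D K\<close>, taking inverse images of \<open>U\<close> is an equivalence from the category of
  geometric morphisms \<open>Sh D K \<rightarrow> Sh C J\<close> to the category of models of \<open>T\<close> in \<open>Sh D K\<close>,
  that is, it is essentially surjective, full and faithful.
\<close>

definition classifies ::
    "'u gtheory \<Rightarrow> ('u, 'u) cat \<Rightarrow> ('u \<Rightarrow> 'u set set) \<Rightarrow> ('u, 'u, 'u, 'u) sheaf_struct \<Rightarrow> bool" where
  "classifies T C J U \<longleftrightarrow>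
     U \<in> Obj (ModSh T C J) \<and>
     (\<forall>(D :: ('u, 'u) cat) K. small_category D \<longrightarrow> grothendieck_topology D K \<longrightarrow>
        (\<forall>f\<in>inverse_image_functors (Sh D K) (Sh C J).
           \<exists>N\<in>Obj (ModSh T D K). is_inverse_image (sig T) C J D K f U N) \<and>
        (\<forall>N\<in>Obj (ModSh T D K).
           \<exists>f\<in>inverse_image_functors (Sh D K) (Sh C J). \<exists>N'\<in>Obj (ModSh T D K).
             is_inverse_image (sig T) C J D K f U N' \<and> isomorphic (ModSh T D K) N' N) \<and>
        (\<forall>f\<in>inverse_image_functors (Sh D K) (Sh C J).
           \<forall>g\<in>inverse_image_functors (Sh D K) (Sh C J).
           \<forall>N\<in>Obj (ModSh T D K). \<forall>N'\<in>Obj (ModSh T D K).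
             is_inverse_image (sig T) C J D K f U N \<longrightarrow>
             is_inverse_image (sig T) C J D K g U N' \<longrightarrow>
             bij_betw (\<lambda>\<alpha>. (N, \<lambda>A\<in>sorts (sig T). \<alpha> (ssort U A), N'))
               (nat_transfs (Sh C J) (Sh D K) f g) (hom (ModSh T D K) N N')))"

definition presheaf_type :: "'u gtheory \<Rightarrow> bool" where
  "presheaf_type T \<longleftrightarrow>
     (\<exists>(C :: ('u, 'u) cat) U. small_category C \<and> classifies T C (trivial_topology C) U)"


section \<open>Restricting a structure to a subtopos\<close>

text \<open>
  The associated sheaf of \<open>P\<close>, in one step.  A section \<open>s\<close> over \<open>c\<close> is encoded as the set of
  all \<open>(g, x)\<close> with \<open>g : d \<rightarrow> c\<close> and \<open>x \<in> sec P d\<close> such that \<open>s\<close> restricted along \<open>g\<close> is the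
  image of \<open>x\<close>.  The sets arising in this way are the closed subpresheaves of the product of
  \<open>P\<close> and the presheaf represented by \<open>c\<close> that are locally single-valued and locally total.
  That this is the associated sheaf is shown in the last section.
\<close>

definition lclosure ::
    "('o, 'a) cat \<Rightarrow> ('o \<Rightarrow> 'a set set) \<Rightarrow> ('o, 'a, 'x) presheaf \<Rightarrow> 'o
     \<Rightarrow> ('a \<times> 'x) set \<Rightarrow> ('a \<times> 'x) set" where
  "lclosure C J P c X =
     {(g, y). g \<in> max_sieve C c \<and> y \<in> sec P (Dom C g) \<and>
        {h \<in> max_sieve C (Dom C g). (Comp C g h, res P h y) \<in> X} \<in> J (Dom C g)}"

definition assoc_sheaf ::
    "('o, 'a) cat \<Rightarrow> ('o \<Rightarrow> 'a set set) \<Rightarrow> ('o, 'a, 'x) presheaf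
     \<Rightarrow> ('o, 'a, ('a \<times> 'x) set) presheaf" where
  "assoc_sheaf C J P =
     \<lparr>sec = (\<lambda>c. {s.
        (\<forall>(g, x)\<in>s. g \<in> max_sieve C c \<and> x \<in> sec P (Dom C g)) \<and>
        (\<forall>(g, x)\<in>s. \<forall>h\<in>max_sieve C (Dom C g). (Comp C g h, res P h x) \<in> s) \<and>
        lclosure C J P c s \<subseteq> s \<and>
        (\<forall>g x y. (g, x) \<in> s \<longrightarrow> (g, y) \<in> s \<longrightarrow>
           {h \<in> max_sieve C (Dom C g). res P h x = res P h y} \<in> J (Dom C g)) \<and>
        {g. \<exists>x. (g, x) \<in> s} \<in> J c}),
      res = (\<lambda>f s. {(g, x). g \<in> max_sieve C (Dom C f) \<and> (Comp C f g, x) \<in> s})\<rparr>"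

definition assoc_unit ::
    "('o, 'a) cat \<Rightarrow> ('o \<Rightarrow> 'a set set) \<Rightarrow> ('o, 'a, 'x) presheaf \<Rightarrow> 'o \<Rightarrow> 'x \<Rightarrow> ('a \<times> 'x) set" where
  "assoc_unit C J P = (\<lambda>c\<in>Obj C. \<lambda>x\<in>sec P c.
     lclosure C J P c {(g, res P g x) | g. g \<in> max_sieve C c})"

text \<open>
  The inverse image along the inclusion of \<open>Sh C J\<close> of a structure \<open>M\<close> in presheaves on \<open>C\<close>.
  Operations are computed locally on representatives; relations are the closures of the
  images of those of \<open>M\<close>.  That this is a structure in sheaves, and the units a homomorphism
  to it, is shown in the last section.
\<close>

definition restrict_struct ::
    "'u signature \<Rightarrow> ('o, 'a) cat \<Rightarrow> ('o \<Rightarrow> 'a set set) \<Rightarrow> ('u, 'o, 'a, 'x) sheaf_struct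
     \<Rightarrow> ('u, 'o, 'a, ('a \<times> 'x) set) sheaf_struct" where
  "restrict_struct \<Sigma> C J M =
     \<lparr>ssort = (\<lambda>A. assoc_sheaf C J (ssort M A)),
      sfint = (\<lambda>f c ss. lclosure C J (ssort M (fcod \<Sigma> f)) c
                 {(g, sfint M f (Dom C g) xs) | g xs.
                    g \<in> max_sieve C c \<and> xs \<in> stuples M (fdom \<Sigma> f) (Dom C g) \<and>
                    list_all2 (\<lambda>s x. (g, x) \<in> s) ss xs}),
      srint = (\<lambda>r c. {ss. list_all2 (\<lambda>s A. s \<in> sec (assoc_sheaf C J (ssort M A)) c) ss (rdom \<Sigma> r) \<and>
                 {g \<in> max_sieve C c. \<exists>xs\<in>srint M r (Dom C g).
                    list_all2 (\<lambda>s x. (g, x) \<in> s) ss xs} \<in> J c})\<rparr>"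


section \<open>The topology of a quotient\<close>

text \<open>
  The site \<open>(T-mod(Set)\<^sub>c)\<^sup>o\<^sup>p\<close> and the tautological structure on it.  A restriction along an
  arrow of the opposite category is the action of the corresponding homomorphism.
\<close>

definition model_site :: "'u gtheory \<Rightarrow> ('u struct, 'u struct_arr) cat" where
  "model_site T = op (Mod_c T)"

definition universal_model :: "('u, 'u struct, 'u struct_arr, 'u) sheaf_struct" where
  "universal_model =
     \<lparr>ssort = (\<lambda>A. \<lparr>sec = (\<lambda>N. carr N A), res = (\<lambda>(M, h, N). h A)\<rparr>),
      sfint = (\<lambda>f N. fint N f),
      srint = (\<lambda>r N. rint N r)\<rparr>"

text \<open>The axioms of \<open>Q\<close> hold for the universal model restricted to the subtopos given by \<open>J\<close>.\<close>

definition forces_quotient ::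
    "'u gtheory \<Rightarrow> 'u sequent set \<Rightarrow> ('u struct \<Rightarrow> 'u struct_arr set set) \<Rightarrow> bool" where
  "forces_quotient T Q J \<longleftrightarrow>
     (\<forall>\<sigma>\<in>Q. holds_in (model_site T) J
        (restrict_struct (sig T) (model_site T) J universal_model) \<sigma>)"

text \<open>
  The topology \<open>J\<^sub>Q\<close>: larger subtoposes correspond to smaller topologies, so the largest
  subtopos is given by the least topology.
\<close>

definition is_quotient_topology ::
    "'u gtheory \<Rightarrow> 'u sequent set \<Rightarrow> ('u struct \<Rightarrow> 'u struct_arr set set) \<Rightarrow> bool" where
  "is_quotient_topology T Q J \<longleftrightarrow>
     grothendieck_topology (model_site T) J \<and> forces_quotient T Q J \<and>
     (\<forall>J'. grothendieck_topology (model_site T) J' \<longrightarrow> forces_quotient T Q J' \<longrightarrow>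
        (\<forall>N\<in>Obj (model_site T). J N \<subseteq> J' N))"

definition rigid_topology_quotient :: "'u gtheory \<Rightarrow> 'u sequent set \<Rightarrow> bool" where
  "rigid_topology_quotient T Q \<longleftrightarrow>
     (\<exists>J. is_quotient_topology T Q J \<and> rigid_topology (model_site T) J)"


section \<open>The restriction is the associated sheaf\<close>

text \<open>
  The results justifying the encoding: \<open>assoc_sheaf_is_sheaf\<close>, \<open>assoc_unit_map\<close> and
  \<open>assoc_universal\<close> for a presheaf; \<open>restrict_is_sheaf_struct\<close>, \<open>units_fun\<close> and \<open>units_rel\<close> for
  a structure.  By the universal property, \<open>units_fun\<close> determines the operations.
\<close>

locale site =
  fixes C :: "('o, 'a) cat" and J :: "'o \<Rightarrow> 'a set set"
  assumes cat: "category C" and top: "grothendieck_topology C J"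
begin

lemma arr: "f \<in> Arr C \<Longrightarrow> Dom C f \<in> Obj C" "f \<in> Arr C \<Longrightarrow> Cod C f \<in> Obj C"
  using cat by (auto simp: category_def)

lemma comp_max:
  assumes "g \<in> max_sieve C c" "h \<in> max_sieve C (Dom C g)"
  shows "Comp C g h \<in> max_sieve C c" "Dom C (Comp C g h) = Dom C h"
  using assms cat by (auto simp: max_sieve_def category_def hom_def)

lemma comp_assoc:
  assumes "g \<in> max_sieve C c" "h \<in> max_sieve C (Dom C g)" "k \<in> max_sieve C (Dom C h)"
  shows "Comp C (Comp C g h) k = Comp C g (Comp C h k)"
  using assms cat by (auto simp: max_sieve_def category_def)

lemma ident_max:
  assumes "c \<in> Obj C"
  shows "Ident C c \<in> max_sieve C c" "Dom C (Ident C c) = c"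
  using assms cat by (auto simp: max_sieve_def category_def hom_def)

lemma comp_ident:
  assumes "g \<in> max_sieve C c"
  shows "Comp C g (Ident C (Dom C g)) = g" "Comp C (Ident C c) g = g"
  using assms cat by (auto simp: max_sieve_def category_def)

lemma max_arr: "g \<in> max_sieve C c \<Longrightarrow> g \<in> Arr C \<and> Cod C g = c \<and> Dom C g \<in> Obj C \<and> c \<in> Obj C"
  using arr by (auto simp: max_sieve_def)

lemma cov_sub: "c \<in> Obj C \<Longrightarrow> S \<in> J c \<Longrightarrow> g \<in> S \<Longrightarrow> g \<in> max_sieve C c"
  using top by (auto simp: grothendieck_topology_def is_sieve_def)

lemma cov_comp:
  "c \<in> Obj C \<Longrightarrow> S \<in> J c \<Longrightarrow> g \<in> S \<Longrightarrow> h \<in> max_sieve C (Dom C g) \<Longrightarrow> Comp C g h \<in> S"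
  using top by (auto simp: grothendieck_topology_def is_sieve_def max_sieve_def)

lemma cov_max: "c \<in> Obj C \<Longrightarrow> max_sieve C c \<in> J c"
  using top by (auto simp: grothendieck_topology_def)

lemma cov_pull:
  "g \<in> max_sieve C c \<Longrightarrow> S \<in> J c \<Longrightarrow> pullback_sieve C g S \<in> J (Dom C g)"
  using top by (auto simp: grothendieck_topology_def max_sieve_def)

lemma is_sieveI:
  assumes "\<And>g. g \<in> R \<Longrightarrow> g \<in> max_sieve C c"
    "\<And>g h. g \<in> R \<Longrightarrow> h \<in> max_sieve C (Dom C g) \<Longrightarrow> Comp C g h \<in> R"
  shows "is_sieve C c R"
  using assms by (auto simp: is_sieve_def max_sieve_def)

lemma cov_local:
  assumes "c \<in> Obj C" "S \<in> J c" "is_sieve C c R"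
    "\<And>g. g \<in> S \<Longrightarrow> g \<in> max_sieve C c \<Longrightarrow> pullback_sieve C g R \<in> J (Dom C g)"
  shows "R \<in> J c"
  using assms top cov_sub[OF assms(1,2)] unfolding grothendieck_topology_def by blast

lemma cov_mono:
  assumes c: "c \<in> Obj C" and S: "S \<in> J c" and R: "is_sieve C c R" and SR: "S \<subseteq> R"
  shows "R \<in> J c"
proof (rule cov_local[OF c S R])
  fix g assume g: "g \<in> S" "g \<in> max_sieve C c"
  have "pullback_sieve C g R = max_sieve C (Dom C g)"
    using cov_comp[OF c S g(1)] SR by (auto simp: pullback_sieve_def)
  then show "pullback_sieve C g R \<in> J (Dom C g)" using cov_max max_arr[OF g(2)] by auto
qed

lemma cov_Int:
  assumes c: "c \<in> Obj C" and S: "S \<in> J c" and R: "R \<in> J c"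
  shows "S \<inter> R \<in> J c"
proof (rule cov_local[OF c S])
  show "is_sieve C c (S \<inter> R)"
    by (rule is_sieveI) (auto intro: cov_sub[OF c S] cov_comp[OF c S] cov_comp[OF c R])
  fix g assume g: "g \<in> S" "g \<in> max_sieve C c"
  have "pullback_sieve C g (S \<inter> R) = pullback_sieve C g R"
    using cov_comp[OF c S g(1)] by (auto simp: pullback_sieve_def)
  then show "pullback_sieve C g (S \<inter> R) \<in> J (Dom C g)" using cov_pull[OF g(2) R] by simp
qed

end

lemma sheafD:
  assumes "is_sheaf C J F" "c \<in> Obj C" "S \<in> J c"
    and "\<forall>f\<in>S. x f \<in> sec F (Dom C f)"
    and "\<forall>f\<in>S. \<forall>g\<in>Arr C. Cod C g = Dom C f \<longrightarrow> x (Comp C f g) = res F g (x f)"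
  shows "\<exists>!s. s \<in> sec F c \<and> (\<forall>f\<in>S. res F f s = x f)"
  by (rule assms(1)[unfolded is_sheaf_def, THEN conjunct2, rule_format, OF assms(2,3)])
    (use assms(4,5) in auto)

locale site_presheaf = site C J for C :: "('o, 'a) cat" and J +
  fixes P :: "('o, 'a, 'x) presheaf"
  assumes psh: "is_presheaf C P"
begin

abbreviation "aP \<equiv> assoc_sheaf C J P"

lemma res_in: "g \<in> max_sieve C c \<Longrightarrow> x \<in> sec P c \<Longrightarrow> res P g x \<in> sec P (Dom C g)"
  using psh by (auto simp: is_presheaf_def max_sieve_def)

lemma res_comp:
  "g \<in> max_sieve C c \<Longrightarrow> h \<in> max_sieve C (Dom C g) \<Longrightarrow> x \<in> sec P c \<Longrightarrow>
   res P (Comp C g h) x = res P h (res P g x)"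
  using psh by (auto simp: is_presheaf_def max_sieve_def)

lemma res_ident: "c \<in> Obj C \<Longrightarrow> x \<in> sec P c \<Longrightarrow> res P (Ident C c) x = x"
  using psh by (auto simp: is_presheaf_def)

definition stable :: "'o \<Rightarrow> ('a \<times> 'x) set \<Rightarrow> bool" where
  "stable c X \<longleftrightarrow> (\<forall>(g, x)\<in>X. g \<in> max_sieve C c \<and> x \<in> sec P (Dom C g)) \<and>
     (\<forall>(g, x)\<in>X. \<forall>h\<in>max_sieve C (Dom C g). (Comp C g h, res P h x) \<in> X)"

definition single :: "('a \<times> 'x) set \<Rightarrow> bool" where
  "single X \<longleftrightarrow> (\<forall>g x y. (g, x) \<in> X \<longrightarrow> (g, y) \<in> X \<longrightarrow>
     {h \<in> max_sieve C (Dom C g). res P h x = res P h y} \<in> J (Dom C g))"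

lemma singleD:
  assumes "single X" "(g, x) \<in> X" "(g, y) \<in> X"
  shows "{h \<in> max_sieve C (Dom C g). res P h x = res P h y} \<in> J (Dom C g)"
  using assms by (simp add: single_def)

lemma sec_iff: "s \<in> sec aP c \<longleftrightarrow>
    stable c s \<and> lclosure C J P c s \<subseteq> s \<and> single s \<and> fst ` s \<in> J c"
proof -
  have "fst ` s = {g. \<exists>x. (g, x) \<in> s}" by force
  then show ?thesis unfolding assoc_sheaf_def stable_def single_def by auto
qed

lemma stableD:
  assumes "stable c X" "(g, x) \<in> X"
  shows "g \<in> max_sieve C c" "x \<in> sec P (Dom C g)"
    "h \<in> max_sieve C (Dom C g) \<Longrightarrow> (Comp C g h, res P h x) \<in> X"
  using assms by (auto simp: stable_def)

lemma lcl_sieve: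
  assumes X: "stable c X" and g: "g \<in> max_sieve C c" and y: "y \<in> sec P (Dom C g)"
  shows "is_sieve C (Dom C g) {h \<in> max_sieve C (Dom C g). (Comp C g h, res P h y) \<in> X}"
proof (rule is_sieveI, simp_all, elim conjE, intro conjI)
  fix h k assume h: "h \<in> max_sieve C (Dom C g)" "(Comp C g h, res P h y) \<in> X"
    and k: "k \<in> max_sieve C (Dom C h)"
  show "Comp C h k \<in> max_sieve C (Dom C g)" using comp_max[OF h(1) k] by simp
  show "(Comp C g (Comp C h k), res P (Comp C h k) y) \<in> X"
    using stableD(3)[OF X h(2), of k] k comp_max[OF g h(1)] comp_assoc[OF g h(1) k]
      res_comp[OF h(1) k y] by simp
qed

lemma lclI:
  assumes X: "stable c X" and g: "g \<in> max_sieve C c" and y: "y \<in> sec P (Dom C g)"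
    and S: "S \<in> J (Dom C g)"
    and l: "\<And>h. h \<in> S \<Longrightarrow> h \<in> max_sieve C (Dom C g) \<Longrightarrow> (Comp C g h, res P h y) \<in> X"
  shows "(g, y) \<in> lclosure C J P c X"
proof -
  have d: "Dom C g \<in> Obj C" using max_arr[OF g] by simp
  have "{h \<in> max_sieve C (Dom C g). (Comp C g h, res P h y) \<in> X} \<in> J (Dom C g)"
    by (rule cov_mono[OF d S lcl_sieve[OF X g y]]) (auto intro: cov_sub[OF d S] l)
  then show ?thesis using g y by (simp add: lclosure_def)
qed

lemma lclD:
  assumes "(g, y) \<in> lclosure C J P c X"
  shows "g \<in> max_sieve C c" "y \<in> sec P (Dom C g)"
    "{h \<in> max_sieve C (Dom C g). (Comp C g h, res P h y) \<in> X} \<in> J (Dom C g)"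
  using assms by (auto simp: lclosure_def)

lemma lcl_extensive:
  assumes X: "stable c X" shows "X \<subseteq> lclosure C J P c X"
proof clarify
  fix g x assume gx: "(g, x) \<in> X"
  note d = stableD[OF X gx]
  have "Dom C g \<in> Obj C" using max_arr[OF d(1)] by simp
  then show "(g, x) \<in> lclosure C J P c X" using lclI[OF X d(1,2) cov_max] d(3) by auto
qed

lemma lcl_stable:
  assumes X: "stable c X" shows "stable c (lclosure C J P c X)"
  unfolding stable_def
proof (intro conjI ballI, clarsimp simp: lclosure_def, clarify)
  fix g x h assume gx: "(g, x) \<in> lclosure C J P c X" and h: "h \<in> max_sieve C (Dom C g)"
  note d = lclD[OF gx]
  note gh = comp_max[OF d(1) h]
  show "(Comp C g h, res P h x) \<in> lclosure C J P c X"
  proof (rule lclI[OF X gh(1), unfolded gh(2), OF res_in[OF h d(2)] cov_pull[OF h d(3)]])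
    fix k assume k: "k \<in> max_sieve C (Dom C h)"
      "k \<in> pullback_sieve C h {h \<in> max_sieve C (Dom C g). (Comp C g h, res P h x) \<in> X}"
    then show "(Comp C (Comp C g h) k, res P k (res P h x)) \<in> X"
      using comp_assoc[OF d(1) h k(1)] res_comp[OF h k(1) d(2)]
      by (simp add: pullback_sieve_def)
  qed
qed

lemma lcl_idem:
  assumes X: "stable c X"
  shows "lclosure C J P c (lclosure C J P c X) \<subseteq> lclosure C J P c X"
proof clarify
  fix g y assume gy: "(g, y) \<in> lclosure C J P c (lclosure C J P c X)"
  note d = lclD[OF gy]
  have dg: "Dom C g \<in> Obj C" using max_arr[OF d(1)] by simp
  have "{h \<in> max_sieve C (Dom C g). (Comp C g h, res P h y) \<in> X} \<in> J (Dom C g)"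
  proof (rule cov_local[OF dg d(3) lcl_sieve[OF X d(1,2)]], clarify)
    fix h assume h: "h \<in> max_sieve C (Dom C g)" "(Comp C g h, res P h y) \<in> lclosure C J P c X"
    have "{k \<in> max_sieve C (Dom C h). (Comp C (Comp C g h) k, res P k (res P h y)) \<in> X} \<in> J (Dom C h)"
      using lclD(3)[OF h(2)] comp_max[OF d(1) h(1)] by simp
    moreover have "{k \<in> max_sieve C (Dom C h). (Comp C (Comp C g h) k, res P k (res P h y)) \<in> X} =
      pullback_sieve C h {h \<in> max_sieve C (Dom C g). (Comp C g h, res P h y) \<in> X}"
      using comp_max[OF h(1)] comp_assoc[OF d(1) h(1)] res_comp[OF h(1) _ d(2)]
      by (auto simp: pullback_sieve_def)
    ultimately show "pullback_sieve C h {h \<in> max_sieve C (Dom C g). (Comp C g h, res P h y) \<in> X} \<in> J (Dom C h)"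
      by simp
  qed
  then show "(g, y) \<in> lclosure C J P c X" using d by (simp add: lclosure_def)
qed

lemma eq_sieve:
  assumes "x \<in> sec P d" "y \<in> sec P d"
  shows "is_sieve C d {h \<in> max_sieve C d. res P h x = res P h y}"
  by (rule is_sieveI) (use assms comp_max res_comp in auto)

lemma eq_local:
  assumes d: "d \<in> Obj C" and xy: "x \<in> sec P d" "y \<in> sec P d" and S: "S \<in> J d"
    and l: "\<And>h. h \<in> S \<Longrightarrow> h \<in> max_sieve C d \<Longrightarrow>
      {k \<in> max_sieve C (Dom C h). res P k (res P h x) = res P k (res P h y)} \<in> J (Dom C h)"
  shows "{h \<in> max_sieve C d. res P h x = res P h y} \<in> J d"
proof (rule cov_local[OF d S eq_sieve[OF xy]])
  fix h assume h: "h \<in> S" "h \<in> max_sieve C d"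
  have "pullback_sieve C h {h \<in> max_sieve C d. res P h x = res P h y} =
    {k \<in> max_sieve C (Dom C h). res P k (res P h x) = res P k (res P h y)}"
    using comp_max[OF h(2)] res_comp[OF h(2)] xy by (auto simp: pullback_sieve_def)
  then show "pullback_sieve C h {h \<in> max_sieve C d. res P h x = res P h y} \<in> J (Dom C h)"
    using l[OF h] by simp
qed

lemma lcl_sec:
  assumes c: "c \<in> Obj C" and X: "stable c X" and s: "single X" and t: "S \<in> J c" "S \<subseteq> fst ` X"
  shows "lclosure C J P c X \<in> sec aP c"
  unfolding sec_iff
proof (intro conjI lcl_stable[OF X] lcl_idem[OF X])
  show "single (lclosure C J P c X)"
    unfolding single_def
  proof (intro allI impI)
    fix g x y assume gx: "(g, x) \<in> lclosure C J P c X" and gy: "(g, y) \<in> lclosure C J P c X"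
    note dx = lclD[OF gx] and dy = lclD[OF gy]
    have dg: "Dom C g \<in> Obj C" using max_arr[OF dx(1)] by simp
    show "{h \<in> max_sieve C (Dom C g). res P h x = res P h y} \<in> J (Dom C g)"
    proof (rule eq_local[OF dg dx(2) dy(2) cov_Int[OF dg dx(3) dy(3)]])
      fix h assume h: "h \<in> max_sieve C (Dom C g)"
        "h \<in> {h \<in> max_sieve C (Dom C g). (Comp C g h, res P h x) \<in> X} \<inter>
             {h \<in> max_sieve C (Dom C g). (Comp C g h, res P h y) \<in> X}"
      then have xy: "(Comp C g h, res P h x) \<in> X" "(Comp C g h, res P h y) \<in> X" by auto
      then show "{k \<in> max_sieve C (Dom C h). res P k (res P h x) = res P k (res P h y)} \<in> J (Dom C h)"
        using singleD[OF s xy] comp_max(2)[OF dx(1) h(1)] by simp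
    qed
  qed
  have "is_sieve C c (fst ` lclosure C J P c X)"
  proof (rule is_sieveI)
    show "g \<in> max_sieve C c" if "g \<in> fst ` lclosure C J P c X" for g
      using that lclD(1) by fastforce
    show "Comp C g h \<in> fst ` lclosure C J P c X"
      if "g \<in> fst ` lclosure C J P c X" "h \<in> max_sieve C (Dom C g)" for g h
      using that stableD(3)[OF lcl_stable[OF X]] by force
  qed
  then show "fst ` lclosure C J P c X \<in> J c"
    by (rule cov_mono[OF c t(1)]) (use t(2) lcl_extensive[OF X] in blast)
qed

lemma sec_closed:
  assumes s: "s \<in> sec aP c" and g: "g \<in> max_sieve C c" and y: "y \<in> sec P (Dom C g)"
    and S: "S \<in> J (Dom C g)"
    and l: "\<And>h. h \<in> S \<Longrightarrow> h \<in> max_sieve C (Dom C g) \<Longrightarrow> (Comp C g h, res P h y) \<in> s"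
  shows "(g, y) \<in> s"
  using lclI[OF _ g y S l] s by (auto simp: sec_iff)

lemma sec_leI:
  assumes c: "c \<in> Obj C" and s: "s \<in> sec aP c" and t: "t \<in> sec aP c" and S: "S \<in> J c"
    and m: "S \<subseteq> fst ` (s \<inter> t)"
  shows "s \<subseteq> t"
proof clarify
  fix g y assume gy: "(g, y) \<in> s"
  have ss: "stable c s" and st: "stable c t" using s t by (auto simp: sec_iff)
  note d = stableD[OF ss gy]
  show "(g, y) \<in> t"
  proof (rule sec_closed[OF t d(1,2) cov_pull[OF d(1) S]])
    fix h assume h: "h \<in> pullback_sieve C g S" "h \<in> max_sieve C (Dom C g)"
    note gh = comp_max[OF d(1) h(2)]
    from h have "Comp C g h \<in> S" by (simp add: pullback_sieve_def)
    then obtain x where x: "(Comp C g h, x) \<in> s" "(Comp C g h, x) \<in> t" using m by force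
    have y: "(Comp C g h, res P h y) \<in> s" using d(3) h by simp
    have cov: "{k \<in> max_sieve C (Dom C h). res P k (res P h y) = res P k x} \<in> J (Dom C h)"
      using singleD[OF _ y x(1)] s gh(2) by (simp add: sec_iff)
    show "(Comp C g h, res P h y) \<in> t"
    proof (rule sec_closed[OF t gh(1), unfolded gh(2), OF res_in[OF h(2) d(2)] cov])
      fix k assume "k \<in> {k \<in> max_sieve C (Dom C h). res P k (res P h y) = res P k x}"
        "k \<in> max_sieve C (Dom C h)"
      then show "(Comp C (Comp C g h) k, res P k (res P h y)) \<in> t"
        using stableD(3)[OF st x(2), of k] gh by simp
    qed
  qed
qed

lemma sec_eqI:
  assumes "c \<in> Obj C" "s \<in> sec aP c" "t \<in> sec aP c" "S \<in> J c" "S \<subseteq> fst ` (s \<inter> t)"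
  shows "s = t"
  using sec_leI[OF assms] sec_leI[of c t s S] assms by (auto simp: Int_commute)

lemma res_aP: "res aP f s = {(g, x). g \<in> max_sieve C (Dom C f) \<and> (Comp C f g, x) \<in> s}"
  by (simp add: assoc_sheaf_def)

lemma res_sec:
  assumes f: "f \<in> max_sieve C c" and s: "s \<in> sec aP c"
  shows "res aP f s \<in> sec aP (Dom C f)"
  unfolding sec_iff
proof (intro conjI)
  have st: "stable c s" and si: "single s" and tot: "fst ` s \<in> J c" using s by (auto simp: sec_iff)
  show st': "stable (Dom C f) (res aP f s)"
    unfolding stable_def
  proof (intro conjI ballI, clarsimp simp: res_aP)
    fix g x assume "g \<in> max_sieve C (Dom C f)" "(Comp C f g, x) \<in> s"
    then show "x \<in> sec P (Dom C g)" using stableD(2)[OF st, of "Comp C f g" x] comp_max(2)[OF f] by simp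
  next
    fix p assume "p \<in> res aP f s"
    then obtain g x where p: "p = (g, x)" "g \<in> max_sieve C (Dom C f)" "(Comp C f g, x) \<in> s"
      by (auto simp: res_aP)
    show "case p of (g, x) \<Rightarrow> \<forall>h\<in>max_sieve C (Dom C g). (Comp C g h, res P h x) \<in> res aP f s"
    proof (simp add: p(1), intro ballI)
      fix h assume h: "h \<in> max_sieve C (Dom C g)"
      show "(Comp C g h, res P h x) \<in> res aP f s"
        using stableD(3)[OF st p(3), of h] h comp_max[OF f p(2)] comp_max[OF p(2) h]
          comp_assoc[OF f p(2) h] by (simp add: res_aP)
    qed
  qed
  show "lclosure C J P (Dom C f) (res aP f s) \<subseteq> res aP f s"
  proof clarify
    fix g y assume gy: "(g, y) \<in> lclosure C J P (Dom C f) (res aP f s)"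
    note d = lclD[OF gy]
    note fg = comp_max[OF f d(1)]
    have "(Comp C f g, y) \<in> s"
    proof (rule sec_closed[OF s fg(1), unfolded fg(2), OF d(2,3)])
      fix h assume h: "h \<in> {h \<in> max_sieve C (Dom C g). (Comp C g h, res P h y) \<in> res aP f s}"
      then show "(Comp C (Comp C f g) h, res P h y) \<in> s"
        using comp_assoc[OF f d(1), of h] by (simp add: res_aP)
    qed
    then show "(g, y) \<in> res aP f s" using d by (simp add: res_aP)
  qed
  show "single (res aP f s)"
    unfolding single_def
  proof (intro allI impI)
    fix g x y assume "(g, x) \<in> res aP f s" "(g, y) \<in> res aP f s"
    then have g: "g \<in> max_sieve C (Dom C f)" and xy: "(Comp C f g, x) \<in> s" "(Comp C f g, y) \<in> s"
      by (auto simp: res_aP)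
    then show "{h \<in> max_sieve C (Dom C g). res P h x = res P h y} \<in> J (Dom C g)"
      using singleD[OF si xy] comp_max(2)[OF f g] by simp
  qed
  have "fst ` res aP f s = pullback_sieve C f (fst ` s)"
    by (force simp: res_aP pullback_sieve_def)
  then show "fst ` res aP f s \<in> J (Dom C f)" using cov_pull[OF f tot] by simp
qed

lemma assoc_presheaf: "is_presheaf C aP"
  unfolding is_presheaf_def
proof (intro conjI ballI impI)
  fix f assume f: "f \<in> Arr C"
  then show "res aP f \<in> sec aP (Cod C f) \<rightarrow> sec aP (Dom C f)"
    using res_sec by (auto simp: max_sieve_def)
next
  fix c s assume c: "c \<in> Obj C" and s: "s \<in> sec aP c"
  have "stable c s" using s by (simp add: sec_iff)
  then show "res aP (Ident C c) s = s"
    using ident_max[OF c] comp_ident(2)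
    by (auto simp: res_aP stable_def)
next
  fix f g s assume f: "f \<in> Arr C" and g: "g \<in> Arr C" and d: "Dom C f = Cod C g"
    and s: "s \<in> sec aP (Cod C f)"
  have f': "f \<in> max_sieve C (Cod C f)" and g': "g \<in> max_sieve C (Dom C f)"
    using f g d by (auto simp: max_sieve_def)
  show "res aP (Comp C f g) s = res aP g (res aP f s)"
    using comp_assoc[OF f' g'] comp_max[OF g'] comp_max[OF f' g'] by (auto simp: res_aP)
qed

theorem assoc_sheaf_is_sheaf: "is_sheaf C J aP"
  unfolding is_sheaf_def
proof (intro conjI assoc_presheaf ballI allI impI)
  fix c S x
  assume c: "c \<in> Obj C" and S: "S \<in> J c" and xs: "\<forall>f\<in>S. x f \<in> sec aP (Dom C f)"
    and m: "\<forall>f\<in>S. \<forall>g\<in>Arr C. Cod C g = Dom C f \<longrightarrow> x (Comp C f g) = res aP g (x f)"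
  define X where "X = {(f, y). f \<in> S \<and> (Ident C (Dom C f), y) \<in> x f}"
  have SM: "f \<in> max_sieve C c" "Dom C f \<in> Obj C" if "f \<in> S" for f
    using cov_sub[OF c S that] max_arr by auto
  have stx: "stable (Dom C f) (x f)" if "f \<in> S" for f using xs that by (simp add: sec_iff)
  have key: "(Comp C f g, y) \<in> X \<longleftrightarrow> (g, y) \<in> x f" if f: "f \<in> S" and g: "g \<in> max_sieve C (Dom C f)" for f g y
  proof -
    have "x (Comp C f g) = res aP g (x f)" using m f g by (auto simp: max_sieve_def)
    then show ?thesis
      using cov_comp[OF c S f g] comp_max[OF SM(1)[OF f] g] ident_max comp_ident[OF g] max_arr[OF g]
      by (auto simp: X_def res_aP)
  qed
  have X: "stable c X"
    unfolding stable_def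
  proof (intro conjI ballI, clarsimp simp: X_def)
    fix f y assume f: "f \<in> S" and y: "(Ident C (Dom C f), y) \<in> x f"
    show "f \<in> max_sieve C c \<and> y \<in> sec P (Dom C f)"
      using SM[OF f] stableD(2)[OF stx[OF f] y] ident_max(2) by simp
  next
    fix p assume "p \<in> X"
    then obtain f y where p: "p = (f, y)" "f \<in> S" "(Ident C (Dom C f), y) \<in> x f"
      by (auto simp: X_def)
    show "case p of (g, x) \<Rightarrow> \<forall>h\<in>max_sieve C (Dom C g). (Comp C g h, res P h x) \<in> X"
    proof (simp add: p(1), intro ballI)
      fix h assume h: "h \<in> max_sieve C (Dom C f)"
      have "(h, res P h y) \<in> x f"
        using stableD(3)[OF stx[OF p(2)] p(3), of h] h ident_max[OF SM(2)[OF p(2)]] comp_ident(2)[OF h]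
        by simp
      then show "(Comp C f h, res P h y) \<in> X" using key[OF p(2) h] by simp
    qed
  qed
  have si: "single X"
    unfolding single_def
  proof (intro allI impI)
    fix f y z assume "(f, y) \<in> X" "(f, z) \<in> X"
    then have f: "f \<in> S" and yz: "(Ident C (Dom C f), y) \<in> x f" "(Ident C (Dom C f), z) \<in> x f"
      by (auto simp: X_def)
    have "single (x f)" using xs f by (simp add: sec_iff)
    from singleD[OF this yz]
    show "{h \<in> max_sieve C (Dom C f). res P h y = res P h z} \<in> J (Dom C f)"
      using ident_max(2)[OF SM(2)[OF f]] by simp
  qed
  have fX: "fst ` X \<in> J c"
  proof (rule cov_local[OF c S])
    show "is_sieve C c (fst ` X)"
      by (rule is_sieveI) (use stableD[OF X] in \<open>force+\<close>)
    fix f assume f: "f \<in> S"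
    have "pullback_sieve C f (fst ` X) = fst ` x f"
      using key[OF f] stableD(1)[OF stx[OF f]] by (force simp: pullback_sieve_def)
    then show "pullback_sieve C f (fst ` X) \<in> J (Dom C f)" using xs f by (simp add: sec_iff)
  qed
  show "\<exists>!s. s \<in> sec aP c \<and> (\<forall>f\<in>S. res aP f s = x f)"
  proof (rule ex1I)
    let ?s = "lclosure C J P c X"
    have s: "?s \<in> sec aP c" by (rule lcl_sec[OF c X si fX order_refl])
    moreover have "res aP f ?s = x f" if f: "f \<in> S" for f
    proof (rule sym, rule sec_eqI[OF SM(2)[OF f]])
      show "x f \<in> sec aP (Dom C f)" using xs f by simp
      then show "fst ` x f \<in> J (Dom C f)" by (simp add: sec_iff)
      show "res aP f ?s \<in> sec aP (Dom C f)" using res_sec[OF SM(1)[OF f] s] .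
      have "x f \<subseteq> res aP f ?s"
        using key[OF f] stableD(1)[OF stx[OF f]] lcl_extensive[OF X] by (fastforce simp: res_aP)
      then show "fst ` x f \<subseteq> fst ` (x f \<inter> res aP f ?s)" by blast
    qed
    ultimately show "?s \<in> sec aP c \<and> (\<forall>f\<in>S. res aP f ?s = x f)" by blast
    fix t assume t: "t \<in> sec aP c \<and> (\<forall>f\<in>S. res aP f t = x f)"
    have "X \<subseteq> t"
    proof clarify
      fix f y assume fy: "(f, y) \<in> X"
      then have f: "f \<in> S" and y: "(Ident C (Dom C f), y) \<in> x f" by (auto simp: X_def)
      then have "(Ident C (Dom C f), y) \<in> res aP f t" using t by simp
      then show "(f, y) \<in> t" using comp_ident(1)[OF SM(1)[OF f]] by (simp add: res_aP)
    qed
    then show "t = ?s"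
      using lcl_extensive[OF X] t by (intro sec_eqI[OF c _ s fX]) auto
  qed
qed

lemma unit_aux:
  assumes c: "c \<in> Obj C" and x: "x \<in> sec P c"
  defines "X \<equiv> {(g, res P g x) | g. g \<in> max_sieve C c}"
  shows "stable c X" "assoc_unit C J P c x = lclosure C J P c X"
    "X \<subseteq> assoc_unit C J P c x" "assoc_unit C J P c x \<in> sec aP c"
proof -
  show X: "stable c X"
    unfolding stable_def X_def
    using res_in[OF _ x] comp_max res_comp[OF _ _ x] by fastforce
  show u: "assoc_unit C J P c x = lclosure C J P c X" using c x by (simp add: assoc_unit_def X_def)
  show "X \<subseteq> assoc_unit C J P c x" using lcl_extensive[OF X] u by simp
  have "single X"
    using cov_max max_arr by (auto simp: single_def X_def)
  moreover have "fst ` X = max_sieve C c" by (force simp: X_def)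
  ultimately show "assoc_unit C J P c x \<in> sec aP c"
    unfolding u using lcl_sec[OF c X _ cov_max[OF c]] by simp
qed

theorem assoc_unit_map: "assoc_unit C J P \<in> presheaf_maps C P aP"
proof -
  have "assoc_unit C J P (Dom C f) (res P f x) = res aP f (assoc_unit C J P (Cod C f) x)"
    if f: "f \<in> Arr C" and x: "x \<in> sec P (Cod C f)" for f x
  proof (rule sec_eqI[OF arr(1)[OF f] _ _ cov_max[OF arr(1)[OF f]]])
    have f': "f \<in> max_sieve C (Cod C f)" using f by (simp add: max_sieve_def)
    note a = unit_aux[OF arr(2)[OF f] x] and b = unit_aux[OF arr(1)[OF f] res_in[OF f' x]]
    show "assoc_unit C J P (Dom C f) (res P f x) \<in> sec aP (Dom C f)" by (rule b(4))
    show "res aP f (assoc_unit C J P (Cod C f) x) \<in> sec aP (Dom C f)" by (rule res_sec[OF f' a(4)])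
    show "max_sieve C (Dom C f) \<subseteq> fst ` (assoc_unit C J P (Dom C f) (res P f x) \<inter>
        res aP f (assoc_unit C J P (Cod C f) x))"
    proof
      fix g assume g: "g \<in> max_sieve C (Dom C f)"
      have "(g, res P g (res P f x)) \<in> assoc_unit C J P (Dom C f) (res P f x)" using b(3) g by blast
      moreover have "(Comp C f g, res P (Comp C f g) x) \<in> assoc_unit C J P (Cod C f) x"
        using a(3) comp_max[OF f' g] by blast
      then have "(g, res P g (res P f x)) \<in> res aP f (assoc_unit C J P (Cod C f) x)"
        using g res_comp[OF f' g x] by (simp add: res_aP)
      ultimately show "g \<in> fst ` (assoc_unit C J P (Dom C f) (res P f x) \<inter>
        res aP f (assoc_unit C J P (Cod C f) x))" by force
    qed
  qed
  moreover have "assoc_unit C J P \<in> (\<Pi>\<^sub>E c\<in>Obj C. sec P c \<rightarrow>\<^sub>E sec aP c)"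
    using unit_aux(4) by (auto simp: assoc_unit_def)
  ultimately show ?thesis by (simp add: presheaf_maps_def)
qed

lemma mem_iff_unit:
  assumes c: "c \<in> Obj C" and s: "s \<in> sec aP c" and g: "g \<in> max_sieve C c" and x: "x \<in> sec P (Dom C g)"
  shows "(g, x) \<in> s \<longleftrightarrow> res aP g s = assoc_unit C J P (Dom C g) x"
proof
  have d: "Dom C g \<in> Obj C" using max_arr[OF g] by simp
  note u = unit_aux[OF d x]
  have st: "stable c s" using s by (simp add: sec_iff)
  show "res aP g s = assoc_unit C J P (Dom C g) x" if "(g, x) \<in> s"
  proof (rule sec_eqI[OF d res_sec[OF g s] u(4) cov_max[OF d]])
    have "(h, res P h x) \<in> res aP g s \<inter> assoc_unit C J P (Dom C g) x"
      if "h \<in> max_sieve C (Dom C g)" for h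
      using stableD(3)[OF st \<open>(g, x) \<in> s\<close> that] u(3) that by (auto simp: res_aP)
    then show "max_sieve C (Dom C g) \<subseteq> fst ` (res aP g s \<inter> assoc_unit C J P (Dom C g) x)" by force
  qed
  assume e: "res aP g s = assoc_unit C J P (Dom C g) x"
  have "(Ident C (Dom C g), res P (Ident C (Dom C g)) x) \<in> assoc_unit C J P (Dom C g) x"
    using u(3) ident_max[OF d] by blast
  then have "(Ident C (Dom C g), x) \<in> res aP g s" using e res_ident[OF d x] by simp
  then show "(g, x) \<in> s" using comp_ident(1)[OF g] by (simp add: res_aP)
qed

theorem assoc_universal:
  fixes F :: "('o, 'a, 'y) presheaf"
  assumes F: "is_sheaf C J F" and \<eta>: "\<eta> \<in> presheaf_maps C P F"
  shows "\<exists>!\<theta>. \<theta> \<in> presheaf_maps C aP F \<and>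
    (\<forall>c\<in>Obj C. \<forall>x\<in>sec P c. \<theta> c (assoc_unit C J P c x) = \<eta> c x)"
proof -
  interpret F: site_presheaf C J F
    using F by unfold_locales (auto simp: is_sheaf_def)
  have sepF: "z = z'" if "c \<in> Obj C" "S \<in> J c" "z \<in> sec F c" "z' \<in> sec F c"
    "\<And>f. f \<in> S \<Longrightarrow> res F f z = res F f z'" for c S z z'
  proof -
    have m: "\<forall>f\<in>S. res F f z \<in> sec F (Dom C f)"
      using F.res_in cov_sub[OF that(1,2)] that(3) by blast
    have n: "\<forall>f\<in>S. \<forall>g\<in>Arr C. Cod C g = Dom C f \<longrightarrow> res F (Comp C f g) z = res F g (res F f z)"
      using F.res_comp[OF cov_sub[OF that(1,2)] _ that(3)] by (simp add: max_sieve_def)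
    have "\<exists>!s. s \<in> sec F c \<and> (\<forall>f\<in>S. res F f s = res F f z)"
      by (rule sheafD[OF F that(1,2) m n])
    moreover have "\<forall>f\<in>S. res F f z' = res F f z" using that(5) by simp
    ultimately show ?thesis using that(3,4) by blast
  qed
  have \<eta>in: "\<eta> c x \<in> sec F c" if "c \<in> Obj C" "x \<in> sec P c" for c x
    using \<eta> that by (auto simp: presheaf_maps_def PiE_def Pi_def)
  have \<eta>nat: "\<eta> (Dom C f) (res P f x) = res F f (\<eta> c x)"
    if "f \<in> max_sieve C c" "x \<in> sec P c" for f c x
    using \<eta> that by (auto simp: presheaf_maps_def max_sieve_def)
  define Q where "Q c s z \<longleftrightarrow> z \<in> sec F c \<and> (\<forall>(g, x)\<in>s. res F g z = \<eta> (Dom C g) x)" for c s z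
  have ex1: "\<exists>!z. Q c s z" if c: "c \<in> Obj C" and s: "s \<in> sec aP c" for c s
  proof -
    have st: "stable c s" and si: "single s" and tot: "fst ` s \<in> J c" using s by (auto simp: sec_iff)
    have indep: "\<eta> (Dom C g) x = \<eta> (Dom C g) y" if "(g, x) \<in> s" "(g, y) \<in> s" for g x y
    proof -
      note x = stableD[OF st that(1)] and y = stableD[OF st that(2)]
      have d: "Dom C g \<in> Obj C" using max_arr[OF x(1)] by simp
      have "{h \<in> max_sieve C (Dom C g). res P h x = res P h y} \<in> J (Dom C g)"
        using si that by (simp add: single_def)
      then show ?thesis
        by (rule sepF[OF d _ \<eta>in[OF d x(2)] \<eta>in[OF d y(2)]])
          (use \<eta>nat[OF _ x(2)] \<eta>nat[OF _ y(2)] in force)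
    qed
    define z where "z g = \<eta> (Dom C g) (SOME x. (g, x) \<in> s)" for g
    have z: "z g = \<eta> (Dom C g) x" if "(g, x) \<in> s" for g x
      unfolding z_def using indep someI[of "\<lambda>x. (g, x) \<in> s", OF that] that by blast
    have zin: "\<forall>g\<in>fst ` s. z g \<in> sec F (Dom C g)"
      using z stableD[OF st] \<eta>in max_arr by fastforce
    have zm: "\<forall>g\<in>fst ` s. \<forall>h\<in>Arr C. Cod C h = Dom C g \<longrightarrow> z (Comp C g h) = res F h (z g)"
    proof (intro ballI impI)
      fix g h assume "g \<in> fst ` s" and h: "h \<in> Arr C" "Cod C h = Dom C g"
      then obtain x where x: "(g, x) \<in> s" by force
      note d = stableD[OF st x]
      have h': "h \<in> max_sieve C (Dom C g)" using h by (simp add: max_sieve_def)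
      show "z (Comp C g h) = res F h (z g)"
        using z[OF x] z[OF d(3)[OF h']] \<eta>nat[OF h' d(2)] comp_max(2)[OF d(1) h'] by simp
    qed
    have "\<exists>!w. w \<in> sec F c \<and> (\<forall>g\<in>fst ` s. res F g w = z g)"
      by (rule sheafD[OF F c tot zin zm])
    moreover have "Q c s w \<longleftrightarrow> w \<in> sec F c \<and> (\<forall>g\<in>fst ` s. res F g w = z g)" for w
      unfolding Q_def using z by force
    ultimately show ?thesis by simp
  qed
  define \<theta> where "\<theta> = (\<lambda>c\<in>Obj C. \<lambda>s\<in>sec aP c. THE z. Q c s z)"
  have \<theta>Q: "Q c s (\<theta> c s)" if "c \<in> Obj C" "s \<in> sec aP c" for c s
    using theI'[OF ex1[OF that]] that by (simp add: \<theta>_def)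
  have \<theta>eq: "\<theta> c s = z" if "c \<in> Obj C" "s \<in> sec aP c" "Q c s z" for c s z
    using ex1[OF that(1,2)] \<theta>Q[OF that(1,2)] that(3) by blast
  show ?thesis
  proof (rule ex1I)
    have "\<theta> \<in> (\<Pi>\<^sub>E c\<in>Obj C. sec aP c \<rightarrow>\<^sub>E sec F c)"
    proof (intro PiE_I)
      show "\<theta> c s \<in> sec F c" if "c \<in> Obj C" "s \<in> sec aP c" for c s
        using \<theta>Q[OF that] by (simp add: Q_def)
    qed (auto simp: \<theta>_def)
    moreover have "\<theta> (Dom C f) (res aP f s) = res F f (\<theta> (Cod C f) s)"
      if f: "f \<in> Arr C" and s: "s \<in> sec aP (Cod C f)" for f s
    proof (rule \<theta>eq[OF arr(1)[OF f]])
      have f': "f \<in> max_sieve C (Cod C f)" using f by (simp add: max_sieve_def)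
      show "res aP f s \<in> sec aP (Dom C f)" by (rule res_sec[OF f' s])
      have q: "Q (Cod C f) s (\<theta> (Cod C f) s)" by (rule \<theta>Q[OF arr(2)[OF f] s])
      show "Q (Dom C f) (res aP f s) (res F f (\<theta> (Cod C f) s))"
        unfolding Q_def
      proof (intro conjI ballI, use q F.res_in[OF f'] in \<open>simp add: Q_def\<close>, clarify)
        fix g x assume gx: "(g, x) \<in> res aP f s"
        then have g: "g \<in> max_sieve C (Dom C f)" and m: "(Comp C f g, x) \<in> s" by (auto simp: res_aP)
        have "res F (Comp C f g) (\<theta> (Cod C f) s) = \<eta> (Dom C g) x"
          using q m comp_max[OF f' g] by (auto simp: Q_def)
        then show "res F g (res F f (\<theta> (Cod C f) s)) = \<eta> (Dom C g) x"
          using F.res_comp[OF f' g] q by (simp add: Q_def)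
      qed
    qed
    moreover have "\<theta> c (assoc_unit C J P c x) = \<eta> c x" if c: "c \<in> Obj C" and x: "x \<in> sec P c" for c x
    proof (rule sepF[OF c cov_max[OF c]])
      note u = unit_aux[OF c x]
      have q: "Q c (assoc_unit C J P c x) (\<theta> c (assoc_unit C J P c x))" by (rule \<theta>Q[OF c u(4)])
      then show "\<theta> c (assoc_unit C J P c x) \<in> sec F c" by (simp add: Q_def)
      show "\<eta> c x \<in> sec F c" by (rule \<eta>in[OF c x])
      fix f assume f: "f \<in> max_sieve C c"
      then have "(f, res P f x) \<in> assoc_unit C J P c x" using u(3) by blast
      then show "res F f (\<theta> c (assoc_unit C J P c x)) = res F f (\<eta> c x)"
        using q \<eta>nat[OF f x] by (auto simp: Q_def)
    qed
    ultimately show "\<theta> \<in> presheaf_maps C aP F \<and>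
      (\<forall>c\<in>Obj C. \<forall>x\<in>sec P c. \<theta> c (assoc_unit C J P c x) = \<eta> c x)"
      by (simp add: presheaf_maps_def)
    fix \<theta>' assume t: "\<theta>' \<in> presheaf_maps C aP F \<and>
      (\<forall>c\<in>Obj C. \<forall>x\<in>sec P c. \<theta>' c (assoc_unit C J P c x) = \<eta> c x)"
    have Q': "Q c s (\<theta>' c s)" if c: "c \<in> Obj C" and s: "s \<in> sec aP c" for c s
      unfolding Q_def
    proof (intro conjI ballI, use t c s in \<open>auto simp: presheaf_maps_def PiE_def Pi_def\<close>)
      fix g x assume gx: "(g, x) \<in> s"
      have "stable c s" using s by (simp add: sec_iff)
      note d = stableD[OF this gx]
      have "res aP g s = assoc_unit C J P (Dom C g) x" using mem_iff_unit[OF c s d(1,2)] gx by simp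
      moreover have "\<theta>' (Dom C g) (res aP g s) = res F g (\<theta>' c s)"
        using t d(1) s by (auto simp: presheaf_maps_def max_sieve_def)
      ultimately show "res F g (\<theta>' c s) = \<eta> (Dom C g) x" using t d max_arr by metis
    qed
    have "\<theta>' \<in> (\<Pi>\<^sub>E c\<in>Obj C. sec aP c \<rightarrow>\<^sub>E sec F c)" using t by (simp add: presheaf_maps_def)
    then have "\<theta>' c s = \<theta> c s" if "c \<in> Obj C" "s \<in> sec aP c" for c s
      using \<theta>eq[OF that Q'[OF that]] by simp
    moreover have "\<theta>' c s = \<theta> c s" if "c \<in> Obj C" "s \<notin> sec aP c" for c s
      using \<open>\<theta>' \<in> _\<close> that by (auto simp: \<theta>_def PiE_def Pi_def extensional_def)
    moreover have "\<theta>' c = \<theta> c" if "c \<notin> Obj C" for c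
      using \<open>\<theta>' \<in> _\<close> that by (auto simp: \<theta>_def PiE_def extensional_def)
    ultimately show "\<theta>' = \<theta>" by (metis ext)
  qed
qed

end

locale site_struct = site C J for C :: "('o, 'a) cat" and J +
  fixes \<Sigma> :: "'u signature" and M :: "('u, 'o, 'a, 'x) sheaf_struct"
  assumes sg: "wf_signature \<Sigma>" and str: "is_sheaf_struct \<Sigma> C (trivial_topology C) M"
begin

abbreviation "aM \<equiv> restrict_struct \<Sigma> C J M"

lemma site_psh: "A \<in> sorts \<Sigma> \<Longrightarrow> site_presheaf C J (ssort M A)"
  using str by unfold_locales (auto simp: is_sheaf_struct_def is_sheaf_def)

lemma ssort_aM [simp]: "ssort aM A = assoc_sheaf C J (ssort M A)"
  by (simp add: restrict_struct_def)

lemma stuples_aM_iff: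
  "ss \<in> stuples aM \<Gamma> c \<longleftrightarrow> list_all2 (\<lambda>s A. s \<in> sec (assoc_sheaf C J (ssort M A)) c) ss \<Gamma>"
  by (simp add: stuples_def)

lemma rep_stuples:
  assumes \<Gamma>: "set \<Gamma> \<subseteq> sorts \<Sigma>" and ss: "ss \<in> stuples aM \<Gamma> c"
    and xs: "list_all2 (\<lambda>s x. (g, x) \<in> s) ss xs"
  shows "xs \<in> stuples M \<Gamma> (Dom C g)"
  using ss xs \<Gamma> unfolding stuples_aM_iff unfolding stuples_def
proof (induction arbitrary: xs rule: list_all2_induct)
  case (Cons s ss A \<Gamma>)
  interpret A: site_presheaf C J "ssort M A" using site_psh Cons.prems by simp
  show ?case using Cons A.stableD(2)[of c s g] by (auto simp: list_all2_Cons1 A.sec_iff)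
qed simp

lemma rep_sres:
  assumes \<Gamma>: "set \<Gamma> \<subseteq> sorts \<Sigma>" and ss: "ss \<in> stuples aM \<Gamma> c"
    and xs: "list_all2 (\<lambda>s x. (g, x) \<in> s) ss xs" and h: "h \<in> max_sieve C (Dom C g)"
  shows "list_all2 (\<lambda>s x. (Comp C g h, x) \<in> s) ss (sres M \<Gamma> h xs)"
  using ss xs \<Gamma> unfolding stuples_aM_iff unfolding sres_def
proof (induction arbitrary: xs rule: list_all2_induct)
  case (Cons s ss A \<Gamma>)
  interpret A: site_presheaf C J "ssort M A" using site_psh Cons.prems by simp
  show ?case using Cons A.stableD(3)[of c s g] h by (auto simp: list_all2_Cons1 A.sec_iff)
qed simp

lemma rep_total:
  assumes c: "c \<in> Obj C" and \<Gamma>: "set \<Gamma> \<subseteq> sorts \<Sigma>" and ss: "ss \<in> stuples aM \<Gamma> c"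
  shows "{g \<in> max_sieve C c. \<exists>xs. list_all2 (\<lambda>s x. (g, x) \<in> s) ss xs} \<in> J c"
  using ss \<Gamma> unfolding stuples_aM_iff
proof (induction rule: list_all2_induct)
  case Nil
  then show ?case using cov_max[OF c] by simp
next
  case (Cons s ss A \<Gamma>)
  interpret A: site_presheaf C J "ssort M A" using site_psh Cons.prems by simp
  have "fst ` s \<in> J c" using Cons A.sec_iff by blast
  from cov_Int[OF c this Cons.IH] Cons.prems
  have "fst ` s \<inter> {g \<in> max_sieve C c. \<exists>xs. list_all2 (\<lambda>s x. (g, x) \<in> s) ss xs} \<in> J c" by simp
  moreover have "fst ` s \<inter> {g \<in> max_sieve C c. \<exists>xs. list_all2 (\<lambda>s x. (g, x) \<in> s) ss xs} =
    {g \<in> max_sieve C c. \<exists>xs. list_all2 (\<lambda>s x. (g, x) \<in> s) (s # ss) xs}"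
    by (force simp: list_all2_Cons1)
  ultimately show ?case by simp
qed

lemma rep_single:
  assumes g: "g \<in> max_sieve C c" and \<Gamma>: "set \<Gamma> \<subseteq> sorts \<Sigma>" and ss: "ss \<in> stuples aM \<Gamma> c"
    and xs: "list_all2 (\<lambda>s x. (g, x) \<in> s) ss xs" and ys: "list_all2 (\<lambda>s x. (g, x) \<in> s) ss ys"
  shows "{h \<in> max_sieve C (Dom C g). sres M \<Gamma> h xs = sres M \<Gamma> h ys} \<in> J (Dom C g)"
  using ss xs ys \<Gamma> unfolding stuples_aM_iff
proof (induction arbitrary: xs ys rule: list_all2_induct)
  case Nil
  then show ?case using cov_max max_arr[OF g] by simp
next
  case (Cons s ss A \<Gamma>)
  interpret A: site_presheaf C J "ssort M A" using site_psh Cons.prems by simp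
  obtain x xs' y ys' where e: "xs = x # xs'" "ys = y # ys'" "(g, x) \<in> s" "(g, y) \<in> s"
    "list_all2 (\<lambda>s x. (g, x) \<in> s) ss xs'" "list_all2 (\<lambda>s x. (g, x) \<in> s) ss ys'"
    using Cons.prems by (auto simp: list_all2_Cons1)
  have "A.single s" using Cons A.sec_iff by blast
  note 1 = A.singleD[OF this e(3,4)]
  have 2: "{h \<in> max_sieve C (Dom C g). sres M \<Gamma> h xs' = sres M \<Gamma> h ys'} \<in> J (Dom C g)"
    using Cons.IH[OF e(5,6)] Cons.prems by simp
  have "Dom C g \<in> Obj C" using max_arr[OF g] by simp
  from cov_Int[OF this 1 2]
  show ?case by (simp add: e(1,2) sres_def Int_def conj_ac cong: conj_cong)
qed

lemma fun_facts:
  assumes "f \<in> funs \<Sigma>"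
  shows "set (fdom \<Sigma> f) \<subseteq> sorts \<Sigma>" "fcod \<Sigma> f \<in> sorts \<Sigma>"
    "c \<in> Obj C \<Longrightarrow> xs \<in> stuples M (fdom \<Sigma> f) c \<Longrightarrow> sfint M f c xs \<in> sec (ssort M (fcod \<Sigma> f)) c"
    "g \<in> max_sieve C c \<Longrightarrow> xs \<in> stuples M (fdom \<Sigma> f) c \<Longrightarrow>
       sfint M f (Dom C g) (sres M (fdom \<Sigma> f) g xs) = res (ssort M (fcod \<Sigma> f)) g (sfint M f c xs)"
  using assms sg str by (auto simp: wf_signature_def is_sheaf_struct_def max_sieve_def)

definition graph :: "'u \<Rightarrow> 'o \<Rightarrow> ('a \<times> 'x) set list \<Rightarrow> ('a \<times> 'x) set" where
  "graph f c ss = {(g, sfint M f (Dom C g) xs) | g xs.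
     g \<in> max_sieve C c \<and> xs \<in> stuples M (fdom \<Sigma> f) (Dom C g) \<and> list_all2 (\<lambda>s x. (g, x) \<in> s) ss xs}"

lemma sfint_aM: "sfint aM f c ss = lclosure C J (ssort M (fcod \<Sigma> f)) c (graph f c ss)"
  by (simp add: restrict_struct_def graph_def)

lemma sfint_aM_sec:
  assumes c: "c \<in> Obj C" and f: "f \<in> funs \<Sigma>" and ss: "ss \<in> stuples aM (fdom \<Sigma> f) c"
  shows "sfint aM f c ss \<in> sec (assoc_sheaf C J (ssort M (fcod \<Sigma> f))) c"
    "graph f c ss \<subseteq> sfint aM f c ss" "fst ` graph f c ss \<in> J c"
proof -
  note ff = fun_facts[OF f]
  interpret B: site_presheaf C J "ssort M (fcod \<Sigma> f)" by (rule site_psh[OF ff(2)])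
  have st: "B.stable c (graph f c ss)"
    unfolding B.stable_def
  proof (intro conjI ballI, clarsimp simp: graph_def ff(3) max_arr)
    fix p assume "p \<in> graph f c ss"
    then obtain g xs where p: "p = (g, sfint M f (Dom C g) xs)" "g \<in> max_sieve C c"
        "xs \<in> stuples M (fdom \<Sigma> f) (Dom C g)" "list_all2 (\<lambda>s x. (g, x) \<in> s) ss xs"
      by (auto simp: graph_def)
    have "(Comp C g h, res (ssort M (fcod \<Sigma> f)) h (sfint M f (Dom C g) xs)) \<in> graph f c ss"
      if h: "h \<in> max_sieve C (Dom C g)" for h
    proof -
      have r: "list_all2 (\<lambda>s x. (Comp C g h, x) \<in> s) ss (sres M (fdom \<Sigma> f) h xs)"
        by (rule rep_sres[OF ff(1) ss p(4) h])
      from rep_stuples[OF ff(1) ss r] r show ?thesis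
        using ff(4)[OF h p(3)] comp_max[OF p(2) h]
        by (auto simp: graph_def intro!: exI[of _ "sres M (fdom \<Sigma> f) h xs"])
    qed
    then show "case p of (g, x) \<Rightarrow> \<forall>h\<in>max_sieve C (Dom C g).
        (Comp C g h, res (ssort M (fcod \<Sigma> f)) h x) \<in> graph f c ss"
      using p(1) by simp
  qed
  have si: "B.single (graph f c ss)"
    unfolding B.single_def
  proof (intro allI impI)
    fix g x y assume "(g, x) \<in> graph f c ss" "(g, y) \<in> graph f c ss"
    then obtain xs ys where g: "g \<in> max_sieve C c"
      and x: "x = sfint M f (Dom C g) xs" "xs \<in> stuples M (fdom \<Sigma> f) (Dom C g)"
        "list_all2 (\<lambda>s x. (g, x) \<in> s) ss xs"
      and y: "y = sfint M f (Dom C g) ys" "ys \<in> stuples M (fdom \<Sigma> f) (Dom C g)"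
        "list_all2 (\<lambda>s x. (g, x) \<in> s) ss ys"
      by (auto simp: graph_def)
    have d: "Dom C g \<in> Obj C" using max_arr[OF g] by simp
    have "x \<in> sec (ssort M (fcod \<Sigma> f)) (Dom C g)" "y \<in> sec (ssort M (fcod \<Sigma> f)) (Dom C g)"
      using ff(3)[OF d] x y by auto
    from B.eq_sieve[OF this] show "{h \<in> max_sieve C (Dom C g).
        res (ssort M (fcod \<Sigma> f)) h x = res (ssort M (fcod \<Sigma> f)) h y} \<in> J (Dom C g)"
    proof (rule cov_mono[OF d rep_single[OF g ff(1) ss x(3) y(3)]], clarify)
      fix h assume h: "h \<in> max_sieve C (Dom C g)"
        and e: "sres M (fdom \<Sigma> f) h xs = sres M (fdom \<Sigma> f) h ys"
      show "res (ssort M (fcod \<Sigma> f)) h x = res (ssort M (fcod \<Sigma> f)) h y"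
        using ff(4)[OF h x(2)] ff(4)[OF h y(2)] e x(1) y(1) by simp
    qed
  qed
  have "fst ` graph f c ss = {g \<in> max_sieve C c. \<exists>xs. list_all2 (\<lambda>s x. (g, x) \<in> s) ss xs}"
    using rep_stuples[OF ff(1) ss] by (force simp: graph_def)
  then show fst: "fst ` graph f c ss \<in> J c" using rep_total[OF c ff(1) ss] by simp
  show "sfint aM f c ss \<in> sec (assoc_sheaf C J (ssort M (fcod \<Sigma> f))) c"
    unfolding sfint_aM by (rule B.lcl_sec[OF c st si fst order_refl])
  show "graph f c ss \<subseteq> sfint aM f c ss" unfolding sfint_aM by (rule B.lcl_extensive[OF st])
qed

lemma sres_aM:
  assumes \<Gamma>: "set \<Gamma> \<subseteq> sorts \<Sigma>" and g: "g \<in> max_sieve C c" and ss: "ss \<in> stuples aM \<Gamma> c"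
  shows "sres aM \<Gamma> g ss \<in> stuples aM \<Gamma> (Dom C g)"
    "h \<in> max_sieve C (Dom C g) \<Longrightarrow> list_all2 (\<lambda>s x. (h, x) \<in> s) (sres aM \<Gamma> g ss) xs \<longleftrightarrow>
       list_all2 (\<lambda>s x. (Comp C g h, x) \<in> s) ss xs"
proof -
  show "sres aM \<Gamma> g ss \<in> stuples aM \<Gamma> (Dom C g)"
    using ss \<Gamma> unfolding stuples_aM_iff unfolding sres_def
  proof (induction rule: list_all2_induct)
    case (Cons s ss A \<Gamma>)
    interpret A: site_presheaf C J "ssort M A" using site_psh Cons.prems by simp
    show ?case using Cons A.res_sec[OF g] by simp
  qed simp
  assume h: "h \<in> max_sieve C (Dom C g)"
  show "list_all2 (\<lambda>s x. (h, x) \<in> s) (sres aM \<Gamma> g ss) xs \<longleftrightarrow>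
       list_all2 (\<lambda>s x. (Comp C g h, x) \<in> s) ss xs"
    using ss unfolding stuples_aM_iff unfolding sres_def
  proof (induction arbitrary: xs rule: list_all2_induct)
    case (Cons s ss A \<Gamma>)
    then show ?case using h by (auto simp: list_all2_Cons1 assoc_sheaf_def)
  qed simp
qed

lemma srint_aM: "srint aM r c = {ss \<in> stuples aM (rdom \<Sigma> r) c.
    {g \<in> max_sieve C c. \<exists>xs\<in>srint M r (Dom C g). list_all2 (\<lambda>s x. (g, x) \<in> s) ss xs} \<in> J c}"
  unfolding stuples_aM_iff by (auto simp: restrict_struct_def)

theorem restrict_is_sheaf_struct: "is_sheaf_struct \<Sigma> C J aM"
  unfolding is_sheaf_struct_def
proof (intro conjI ballI)
  fix A assume "A \<in> sorts \<Sigma>"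
  then interpret A: site_presheaf C J "ssort M A" by (rule site_psh)
  show "is_sheaf C J (ssort aM A)" using A.assoc_sheaf_is_sheaf by simp
next
  fix f c assume "f \<in> funs \<Sigma>" "c \<in> Obj C"
  then show "sfint aM f c \<in> stuples aM (fdom \<Sigma> f) c \<rightarrow> sec (ssort aM (fcod \<Sigma> f)) c"
    using sfint_aM_sec(1) by simp
next
  fix f g ss assume f: "f \<in> funs \<Sigma>" and g: "g \<in> Arr C" and ss: "ss \<in> stuples aM (fdom \<Sigma> f) (Cod C g)"
  note ff = fun_facts[OF f]
  interpret B: site_presheaf C J "ssort M (fcod \<Sigma> f)" by (rule site_psh[OF ff(2)])
  have g': "g \<in> max_sieve C (Cod C g)" using g by (simp add: max_sieve_def)
  note sr = sres_aM[OF ff(1) g' ss]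
  note a = sfint_aM_sec[OF arr(1)[OF g] f sr(1)] and b = sfint_aM_sec[OF arr(2)[OF g] f ss]
  have "graph f (Dom C g) (sres aM (fdom \<Sigma> f) g ss) \<subseteq> res B.aP g (sfint aM f (Cod C g) ss)"
  proof clarify
    fix h y assume hy: "(h, y) \<in> graph f (Dom C g) (sres aM (fdom \<Sigma> f) g ss)"
    then have h: "h \<in> max_sieve C (Dom C g)" by (auto simp: graph_def)
    have "(Comp C g h, y) \<in> graph f (Cod C g) ss"
      using hy sr(2)[OF h] comp_max[OF g' h] by (auto simp: graph_def)
    then show "(h, y) \<in> res B.aP g (sfint aM f (Cod C g) ss)" using b(2) h by (auto simp: B.res_aP)
  qed
  then have "sfint aM f (Dom C g) (sres aM (fdom \<Sigma> f) g ss) = res B.aP g (sfint aM f (Cod C g) ss)"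
    using a(2) by (intro B.sec_eqI[OF arr(1)[OF g] a(1) B.res_sec[OF g' b(1)] a(3)]) blast
  then show "sfint aM f (Dom C g) (sres aM (fdom \<Sigma> f) g ss) =
      res (ssort aM (fcod \<Sigma> f)) g (sfint aM f (Cod C g) ss)" by simp
next
  fix r c assume "r \<in> rels \<Sigma>" "c \<in> Obj C"
  show "srint aM r c \<subseteq> stuples aM (rdom \<Sigma> r) c" by (auto simp: srint_aM)
next
  fix r g ss assume r: "r \<in> rels \<Sigma>" and g: "g \<in> Arr C" and ss: "ss \<in> srint aM r (Cod C g)"
  have \<Gamma>: "set (rdom \<Sigma> r) \<subseteq> sorts \<Sigma>" using r sg by (auto simp: wf_signature_def)
  have g': "g \<in> max_sieve C (Cod C g)" using g by (simp add: max_sieve_def)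
  have ss': "ss \<in> stuples aM (rdom \<Sigma> r) (Cod C g)" using ss by (simp add: srint_aM)
  note sr = sres_aM[OF \<Gamma> g' ss']
  have "{h \<in> max_sieve C (Dom C g). \<exists>xs\<in>srint M r (Dom C h).
      list_all2 (\<lambda>s x. (h, x) \<in> s) (sres aM (rdom \<Sigma> r) g ss) xs} =
    pullback_sieve C g {h \<in> max_sieve C (Cod C g). \<exists>xs\<in>srint M r (Dom C h).
      list_all2 (\<lambda>s x. (h, x) \<in> s) ss xs}"
    using sr(2) comp_max[OF g'] by (auto simp: pullback_sieve_def)
  then show "sres aM (rdom \<Sigma> r) g ss \<in> srint aM r (Dom C g)"
    using ss sr(1) cov_pull[OF g'] by (simp add: srint_aM)
next
  fix r c assume r: "r \<in> rels \<Sigma>" and c: "c \<in> Obj C"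
  have \<Gamma>: "set (rdom \<Sigma> r) \<subseteq> sorts \<Sigma>" using r sg by (auto simp: wf_signature_def)
  have stab: "sres M (rdom \<Sigma> r) h xs \<in> srint M r (Dom C h)"
    if "h \<in> max_sieve C d" "xs \<in> srint M r d" for h d xs
    using str r that by (auto simp: is_sheaf_struct_def max_sieve_def)
  show "sclosure C J aM (rdom \<Sigma> r) (srint aM r) c \<subseteq> srint aM r c"
  proof
    fix ss assume "ss \<in> sclosure C J aM (rdom \<Sigma> r) (srint aM r) c"
    then have ss: "ss \<in> stuples aM (rdom \<Sigma> r) c"
      and cov: "{g \<in> max_sieve C c. sres aM (rdom \<Sigma> r) g ss \<in> srint aM r (Dom C g)} \<in> J c"
      by (auto simp: sclosure_def)
    let ?R = "{g \<in> max_sieve C c. \<exists>xs\<in>srint M r (Dom C g). list_all2 (\<lambda>s x. (g, x) \<in> s) ss xs}"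
    have "is_sieve C c ?R"
    proof (rule is_sieveI)
      fix g h assume g: "g \<in> ?R" and h: "h \<in> max_sieve C (Dom C g)"
      then obtain xs where xs: "xs \<in> srint M r (Dom C g)" "list_all2 (\<lambda>s x. (g, x) \<in> s) ss xs" by auto
      from g have g': "g \<in> max_sieve C c" by simp
      show "Comp C g h \<in> ?R"
        using rep_sres[OF \<Gamma> ss xs(2) h] stab[OF h xs(1)] comp_max[OF g' h] by auto
    qed auto
    then have "?R \<in> J c"
    proof (rule cov_local[OF c cov])
      fix g assume "g \<in> {g \<in> max_sieve C c. sres aM (rdom \<Sigma> r) g ss \<in> srint aM r (Dom C g)}"
        and g: "g \<in> max_sieve C c"
      then have "{h \<in> max_sieve C (Dom C g). \<exists>xs\<in>srint M r (Dom C h).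
          list_all2 (\<lambda>s x. (h, x) \<in> s) (sres aM (rdom \<Sigma> r) g ss) xs} \<in> J (Dom C g)"
        by (simp add: srint_aM)
      moreover have "{h \<in> max_sieve C (Dom C g). \<exists>xs\<in>srint M r (Dom C h).
          list_all2 (\<lambda>s x. (h, x) \<in> s) (sres aM (rdom \<Sigma> r) g ss) xs} = pullback_sieve C g ?R"
        using sres_aM(2)[OF \<Gamma> g ss] comp_max[OF g] by (auto simp: pullback_sieve_def)
      ultimately show "pullback_sieve C g ?R \<in> J (Dom C g)" by simp
    qed
    then show "ss \<in> srint aM r c" using ss by (simp add: srint_aM)
  qed
qed

text \<open>The units form a homomorphism of structures.\<close>

abbreviation "units c \<equiv> map2 (\<lambda>A. assoc_unit C J (ssort M A) c)"

lemma units_rep: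
  assumes c: "c \<in> Obj C" and \<Gamma>: "set \<Gamma> \<subseteq> sorts \<Sigma>" and xs: "xs \<in> stuples M \<Gamma> c"
  shows "units c \<Gamma> xs \<in> stuples aM \<Gamma> c"
    "g \<in> max_sieve C c \<Longrightarrow> list_all2 (\<lambda>s x. (g, x) \<in> s) (units c \<Gamma> xs) (sres M \<Gamma> g xs)"
proof -
  have "list_all2 (\<lambda>x A. x \<in> sec (ssort M A) c) xs \<Gamma>" using xs by (simp add: stuples_def)
  then have "units c \<Gamma> xs \<in> stuples aM \<Gamma> c \<and>
    (g \<in> max_sieve C c \<longrightarrow> list_all2 (\<lambda>s x. (g, x) \<in> s) (units c \<Gamma> xs) (sres M \<Gamma> g xs))"
    using \<Gamma> unfolding stuples_aM_iff unfolding sres_def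
  proof (induction rule: list_all2_induct)
    case (Cons x xs A \<Gamma>)
    interpret A: site_presheaf C J "ssort M A" using site_psh Cons.prems by simp
    show ?case using Cons A.unit_aux(3,4)[OF c, of x] by auto
  qed simp
  then show "units c \<Gamma> xs \<in> stuples aM \<Gamma> c"
    "g \<in> max_sieve C c \<Longrightarrow> list_all2 (\<lambda>s x. (g, x) \<in> s) (units c \<Gamma> xs) (sres M \<Gamma> g xs)" by auto
qed

theorem units_fun:
  assumes c: "c \<in> Obj C" and f: "f \<in> funs \<Sigma>" and xs: "xs \<in> stuples M (fdom \<Sigma> f) c"
  shows "assoc_unit C J (ssort M (fcod \<Sigma> f)) c (sfint M f c xs) =
    sfint aM f c (units c (fdom \<Sigma> f) xs)"
proof -
  note ff = fun_facts[OF f]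
  interpret B: site_presheaf C J "ssort M (fcod \<Sigma> f)" by (rule site_psh[OF ff(2)])
  note u = units_rep[OF c ff(1) xs] and v = B.unit_aux[OF c ff(3)[OF c xs]]
  note a = sfint_aM_sec[OF c f u(1)]
  have "(g, sfint M f (Dom C g) (sres M (fdom \<Sigma> f) g xs)) \<in>
      assoc_unit C J (ssort M (fcod \<Sigma> f)) c (sfint M f c xs) \<inter> sfint aM f c (units c (fdom \<Sigma> f) xs)"
    if g: "g \<in> max_sieve C c" for g
  proof
    show "(g, sfint M f (Dom C g) (sres M (fdom \<Sigma> f) g xs)) \<in>
        assoc_unit C J (ssort M (fcod \<Sigma> f)) c (sfint M f c xs)"
      using v(3) g ff(4)[OF g xs] by auto
    have "(g, sfint M f (Dom C g) (sres M (fdom \<Sigma> f) g xs)) \<in> graph f c (units c (fdom \<Sigma> f) xs)"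
      using u(2)[OF g] rep_stuples[OF ff(1) u(1) u(2)[OF g]] g by (auto simp: graph_def)
    then show "(g, sfint M f (Dom C g) (sres M (fdom \<Sigma> f) g xs)) \<in> sfint aM f c (units c (fdom \<Sigma> f) xs)"
      using a(2) by blast
  qed
  then show ?thesis by (intro B.sec_eqI[OF c v(4) a(1) cov_max[OF c]]) force
qed

theorem units_rel:
  assumes c: "c \<in> Obj C" and r: "r \<in> rels \<Sigma>" and xs: "xs \<in> srint M r c"
  shows "units c (rdom \<Sigma> r) xs \<in> srint aM r c"
proof -
  have \<Gamma>: "set (rdom \<Sigma> r) \<subseteq> sorts \<Sigma>" using r sg by (auto simp: wf_signature_def)
  have x: "xs \<in> stuples M (rdom \<Sigma> r) c" using str r c xs unfolding is_sheaf_struct_def by blast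
  have "sres M (rdom \<Sigma> r) g xs \<in> srint M r (Dom C g)" if "g \<in> max_sieve C c" for g
    using str r that xs by (auto simp: is_sheaf_struct_def max_sieve_def)
  then have "{g \<in> max_sieve C c. \<exists>ys\<in>srint M r (Dom C g).
      list_all2 (\<lambda>s x. (g, x) \<in> s) (units c (rdom \<Sigma> r) xs) ys} = max_sieve C c"
    using units_rep(2)[OF c \<Gamma> x] by blast
  then show ?thesis using units_rep(1)[OF c \<Gamma> x] cov_max[OF c] by (simp add: srint_aM)
qed

end

end

theory Submission
  imports Defs
begin

text \<open>
  Closed formulas are preserved along homomorphisms, so a closed axiom \<open>\<phi> \<turnstile> \<psi>\<close> forces each
  model \<open>N\<close> of \<open>\<phi>\<close> to be covered by its homomorphisms into models of \<open>\<psi>\<close>.  If \<open>N\<close> violates the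
  axiom, these codomains satisfy strictly more of the finitely many succedents than \<open>N\<close> does.
  Iterating, the homomorphisms from \<open>N\<close> into compact models of \<open>Q\<close> generate a covering sieve.
  Conversely, the sieves containing all these homomorphisms form a topology that forces the
  axioms.  It is therefore the topology of the quotient, and its irreducible objects are the
  compact models of \<open>Q\<close>.
\<close>

section \<open>Interpretation in a subtopos\<close>

text \<open>The interpretation for the trivial topology, where no closures are needed.\<close>

primrec holds_at :: "('u, 'o, 'a, 'x) sheaf_struct \<Rightarrow> 'o \<Rightarrow> 'u form \<Rightarrow> 'x list \<Rightarrow> bool" where
  "holds_at M c Tru xs \<longleftrightarrow> True"
| "holds_at M c (Eql t u) xs \<longleftrightarrow> seval M c xs t = seval M c xs u"
| "holds_at M c (Rel r ts) xs \<longleftrightarrow> map (seval M c xs) ts \<in> srint M r c"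
| "holds_at M c (Conj \<phi> \<psi>) xs \<longleftrightarrow> holds_at M c \<phi> xs \<and> holds_at M c \<psi> xs"
| "holds_at M c (Disj I \<phi>) xs \<longleftrightarrow> (\<exists>i\<in>I. holds_at M c (\<phi> i) xs)"
| "holds_at M c (Exi A \<phi>) xs \<longleftrightarrow> (\<exists>x\<in>sec (ssort M A) c. holds_at M c \<phi> (x # xs))"

lemma interp_subset_stuples: "interp C J M \<phi> \<Gamma> c \<subseteq> stuples M \<Gamma> c"
  by (induction \<phi>) (auto simp: sclosure_def)

section \<open>Pullbacks of sieves along arrows\<close>

lemma pullback_is_sieve:
  assumes "category C" "is_sieve C c R" "g \<in> max_sieve C c"
  shows "is_sieve C (Dom C g) (pullback_sieve C g R)"
  using assms by (auto simp: is_sieve_def pullback_sieve_def max_sieve_def category_def hom_def)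

context site
begin

lemmas pullback_sieve_is_sieve = pullback_is_sieve[OF cat]


lemma is_sieveD:
  assumes "is_sieve C c R" "g \<in> R"
  shows "g \<in> max_sieve C c" "h \<in> max_sieve C (Dom C g) \<Longrightarrow> Comp C g h \<in> R"
  using assms by (auto simp: is_sieve_def max_sieve_def)

lemma pullback_member:
  assumes R: "is_sieve C c R" and g: "g \<in> R"
  shows "pullback_sieve C g R = max_sieve C (Dom C g)"
  using is_sieveD[OF R g] by (auto simp: pullback_sieve_def)

lemma pullback_pullback:
  assumes g: "g \<in> max_sieve C c" and h: "h \<in> max_sieve C (Dom C g)"
  shows "pullback_sieve C (Comp C g h) R = pullback_sieve C h (pullback_sieve C g R)"
  using comp_max[OF g h] comp_max[OF h] comp_assoc[OF g h] by (auto simp: pullback_sieve_def)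

end

section \<open>Local representatives of tuples of sections of the associated sheaves\<close>

context site_struct
begin

abbreviation rep :: "'a \<Rightarrow> ('a \<times> 'x) set list \<Rightarrow> 'x list \<Rightarrow> bool" where
  "rep g ss xs \<equiv> list_all2 (\<lambda>s x. (g, x) \<in> s) ss xs"

text \<open>A pair \<open>(g, x)\<close> in a section of the associated sheaf says that the section
  restricted along \<open>g\<close> is the image of \<open>x\<close>. This sieve covers exactly when
  the tuple lies in the closure of the image of \<open>K\<close> in the product of the associated
  sheaves.\<close>

definition rep_sieve :: "('o \<Rightarrow> 'x list \<Rightarrow> bool) \<Rightarrow> 'o \<Rightarrow> ('a \<times> 'x) set list \<Rightarrow> 'a set" where
  "rep_sieve K c ss = {g \<in> max_sieve C c. \<exists>xs. rep g ss xs \<and> K (Dom C g) xs}"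

text \<open>On tuples of sections, such a \<open>K\<close> is a subpresheaf of the product of the
  sorts in the context.\<close>

definition stable_pred :: "'u list \<Rightarrow> ('o \<Rightarrow> 'x list \<Rightarrow> bool) \<Rightarrow> bool" where
  "stable_pred \<Gamma> K \<longleftrightarrow> (\<forall>c xs g. xs \<in> stuples M \<Gamma> c \<longrightarrow> g \<in> max_sieve C c \<longrightarrow> K c xs \<longrightarrow>
     K (Dom C g) (sres M \<Gamma> g xs))"

lemma sres_stuples:
  assumes \<Gamma>: "set \<Gamma> \<subseteq> sorts \<Sigma>" and g: "g \<in> max_sieve C c" and xs: "xs \<in> stuples M \<Gamma> c"
  shows "sres M \<Gamma> g xs \<in> stuples M \<Gamma> (Dom C g)"
    "h \<in> max_sieve C (Dom C g) \<Longrightarrow> sres M \<Gamma> (Comp C g h) xs = sres M \<Gamma> h (sres M \<Gamma> g xs)"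
proof -
  have "list_all2 (\<lambda>x A. x \<in> sec (ssort M A) c) xs \<Gamma>" using xs by (simp add: stuples_def)
  then have "sres M \<Gamma> g xs \<in> stuples M \<Gamma> (Dom C g) \<and>
    (h \<in> max_sieve C (Dom C g) \<longrightarrow> sres M \<Gamma> (Comp C g h) xs = sres M \<Gamma> h (sres M \<Gamma> g xs))"
    using \<Gamma> unfolding sres_def stuples_def
  proof (induction rule: list_all2_induct)
    case (Cons x xs A \<Gamma>)
    interpret A: site_presheaf C J "ssort M A" using site_psh Cons.prems by simp
    show ?case using Cons A.res_in[OF g] A.res_comp[OF g] by simp
  qed simp
  then show "sres M \<Gamma> g xs \<in> stuples M \<Gamma> (Dom C g)"
    "h \<in> max_sieve C (Dom C g) \<Longrightarrow> sres M \<Gamma> (Comp C g h) xs = sres M \<Gamma> h (sres M \<Gamma> g xs)" by auto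
qed

lemma local_sieve:
  assumes \<Gamma>: "set \<Gamma> \<subseteq> sorts \<Sigma>" and K: "stable_pred \<Gamma> K" and xs: "xs \<in> stuples M \<Gamma> c"
  shows "is_sieve C c {h \<in> max_sieve C c. K (Dom C h) (sres M \<Gamma> h xs)}"
proof (rule is_sieveI)
  fix g h assume g: "g \<in> {h \<in> max_sieve C c. K (Dom C h) (sres M \<Gamma> h xs)}"
    and h: "h \<in> max_sieve C (Dom C g)"
  from g have g': "g \<in> max_sieve C c" by simp
  show "Comp C g h \<in> {h \<in> max_sieve C c. K (Dom C h) (sres M \<Gamma> h xs)}"
    using g h K sres_stuples[OF \<Gamma> g' xs] comp_max[OF g' h] by (simp add: stable_pred_def)
qed simp

lemma rep_sieve_is_sieve:
  assumes \<Gamma>: "set \<Gamma> \<subseteq> sorts \<Sigma>" and K: "stable_pred \<Gamma> K" and ss: "ss \<in> stuples aM \<Gamma> c"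
  shows "is_sieve C c (rep_sieve K c ss)"
proof (rule is_sieveI)
  fix g h assume g: "g \<in> rep_sieve K c ss" and h: "h \<in> max_sieve C (Dom C g)"
  then obtain xs where xs: "g \<in> max_sieve C c" "rep g ss xs" "K (Dom C g) xs"
    by (auto simp: rep_sieve_def)
  have "K (Dom C h) (sres M \<Gamma> h xs)"
    using K xs(3) rep_stuples[OF \<Gamma> ss xs(2)] h by (auto simp: stable_pred_def)
  then show "Comp C g h \<in> rep_sieve K c ss"
    using comp_max[OF xs(1) h] rep_sres[OF \<Gamma> ss xs(2) h] by (auto simp: rep_sieve_def)
qed (simp add: rep_sieve_def)

lemma rep_sieve_sres:
  assumes "set \<Gamma> \<subseteq> sorts \<Sigma>" "g \<in> max_sieve C c" "ss \<in> stuples aM \<Gamma> c"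
  shows "rep_sieve K (Dom C g) (sres aM \<Gamma> g ss) = pullback_sieve C g (rep_sieve K c ss)"
  using sres_aM(2)[OF assms] comp_max[OF assms(2)]
  by (auto simp: rep_sieve_def pullback_sieve_def)

text \<open>Representatives are unique only locally. A tuple satisfying \<open>K\<close> found after
  further restriction agrees on a cover with the restriction of the given \<open>xs\<close>, so
  \<open>K\<close> passes to \<open>xs\<close> by transitivity of the topology.\<close>

lemma rep_sieve_local:
  assumes \<Gamma>: "set \<Gamma> \<subseteq> sorts \<Sigma>" and K: "stable_pred \<Gamma> K" and ss: "ss \<in> stuples aM \<Gamma> c"
    and cov: "rep_sieve K c ss \<in> J c" and g: "g \<in> max_sieve C c" and xs: "rep g ss xs"
  shows "{h \<in> max_sieve C (Dom C g). K (Dom C h) (sres M \<Gamma> h xs)} \<in> J (Dom C g)" (is "?R \<in> _")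
proof -
  have d: "Dom C g \<in> Obj C" using max_arr[OF g] by simp
  note t = rep_stuples[OF \<Gamma> ss xs]
  note sv = local_sieve[OF \<Gamma> K t]
  show ?thesis
  proof (rule cov_local[OF d cov_pull[OF g cov] sv])
    fix h assume h: "h \<in> pullback_sieve C g (rep_sieve K c ss)" and hm: "h \<in> max_sieve C (Dom C g)"
    note gh = comp_max[OF g hm]
    obtain ys where ys: "rep (Comp C g h) ss ys" "K (Dom C h) ys"
      using h gh by (auto simp: pullback_sieve_def rep_sieve_def)
    have yt: "ys \<in> stuples M \<Gamma> (Dom C h)" using rep_stuples[OF \<Gamma> ss ys(1)] gh by simp
    \<comment> \<open>Both \<open>ys\<close> and the restriction of \<open>xs\<close> represent
      \<open>ss\<close> at the composite arrow, so they become equal on a covering sieve.\<close>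
    note e = rep_single[OF gh(1) \<Gamma> ss ys(1) rep_sres[OF \<Gamma> ss xs hm], unfolded gh(2)]
    have dh: "Dom C h \<in> Obj C" using max_arr[OF hm] by simp
    show "pullback_sieve C h ?R \<in> J (Dom C h)"
    proof (rule cov_mono[OF dh e pullback_sieve_is_sieve[OF sv hm]], clarify)
      fix k assume k: "k \<in> max_sieve C (Dom C h)"
        and eq: "sres M \<Gamma> k ys = sres M \<Gamma> k (sres M \<Gamma> h xs)"
      have "K (Dom C k) (sres M \<Gamma> k ys)" using K ys(2) yt k by (auto simp: stable_pred_def)
      then show "k \<in> pullback_sieve C h ?R"
        using k eq comp_max[OF hm k] sres_stuples(2)[OF \<Gamma> hm t k] by (simp add: pullback_sieve_def)
    qed
  qed
qed

text \<open>Converse to the preceding lemma: the arrows at which the tuple has some representative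
  form a cover by \<open>rep_total\<close>, and transitivity reduces the claim to a local check at
  each of them.\<close>

lemma rep_sieve_coverI:
  assumes c: "c \<in> Obj C" and \<Gamma>: "set \<Gamma> \<subseteq> sorts \<Sigma>" and K: "stable_pred \<Gamma> K"
    and ss: "ss \<in> stuples aM \<Gamma> c"
    and l: "\<And>g xs. g \<in> max_sieve C c \<Longrightarrow> rep g ss xs \<Longrightarrow>
      {h \<in> max_sieve C (Dom C g). K (Dom C h) (sres M \<Gamma> h xs)} \<in> J (Dom C g)"
  shows "rep_sieve K c ss \<in> J c"
proof (rule cov_local[OF c rep_total[OF c \<Gamma> ss] rep_sieve_is_sieve[OF \<Gamma> K ss]], clarify)
  fix g xs assume g: "g \<in> max_sieve C c" and xs: "rep g ss xs"
  have d: "Dom C g \<in> Obj C" using max_arr[OF g] by simp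
  show "pullback_sieve C g (rep_sieve K c ss) \<in> J (Dom C g)"
    by (rule cov_mono[OF d l[OF g xs] pullback_sieve_is_sieve[OF rep_sieve_is_sieve[OF \<Gamma> K ss] g]])
      (use rep_sres[OF \<Gamma> ss xs] comp_max[OF g] in
        \<open>auto simp: pullback_sieve_def rep_sieve_def intro!: exI[of _ "sres M \<Gamma> _ xs"]\<close>)
qed

section \<open>Values of terms in a structure and in its restriction to a subtopos\<close>

lemma seval_sec:
  assumes "has_sort \<Sigma> \<Gamma> t A" and xs: "xs \<in> stuples M \<Gamma> c" and c: "c \<in> Obj C"
  shows "seval M c xs t \<in> sec (ssort M A) c \<and> (\<forall>g\<in>max_sieve C c.
    seval M (Dom C g) (sres M \<Gamma> g xs) t = res (ssort M A) g (seval M c xs t))"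
  using assms(1)
proof (induction rule: has_sort.induct)
  case (1 i)
  then show ?case using xs by (auto simp: stuples_def sres_def list_all2_conv_all_nth)
next
  case (2 f ts)
  \<comment> \<open>Naturality of an operation applies only to tuples of the right sorts. This is
    why sorts and naturality are established in one induction.\<close>
  have t: "map (seval M c xs) ts \<in> stuples M (fdom \<Sigma> f) c"
    using 2(2) by (auto simp: stuples_def list_all2_conv_all_nth)
  have "map (seval M (Dom C g) (sres M \<Gamma> g xs)) ts = sres M (fdom \<Sigma> f) g (map (seval M c xs) ts)"
    if "g \<in> max_sieve C c" for g
    using 2(2) that by (auto simp: sres_def list_all2_conv_all_nth intro!: nth_equalityI)
  then show ?case using fun_facts(3)[OF 2(1) c t] fun_facts(4)[OF 2(1) _ t] by simp
qed

lemma seval_sres: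
  assumes "has_sort \<Sigma> \<Gamma> t A" and "xs \<in> stuples M \<Gamma> c" and "g \<in> max_sieve C c"
  shows "seval M (Dom C g) (sres M \<Gamma> g xs) t = res (ssort M A) g (seval M c xs t)"
  using seval_sec[OF assms(1,2)] assms(3) max_arr by blast

lemma map_seval:
  assumes "list_all2 (has_sort \<Sigma> \<Gamma>) ts \<Delta>" and xs: "xs \<in> stuples M \<Gamma> c" and c: "c \<in> Obj C"
  shows "map (seval M c xs) ts \<in> stuples M \<Delta> c"
    "g \<in> max_sieve C c \<Longrightarrow>
      map (seval M (Dom C g) (sres M \<Gamma> g xs)) ts = sres M \<Delta> g (map (seval M c xs) ts)"
proof -
  have s: "length ts = length \<Delta>" "\<forall>i<length \<Delta>. has_sort \<Sigma> \<Gamma> (ts ! i) (\<Delta> ! i)"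
    using assms(1) by (auto simp: list_all2_conv_all_nth)
  show "map (seval M c xs) ts \<in> stuples M \<Delta> c"
    using s seval_sec[OF _ xs c] by (auto simp: stuples_def list_all2_conv_all_nth)
  show "map (seval M (Dom C g) (sres M \<Gamma> g xs)) ts = sres M \<Delta> g (map (seval M c xs) ts)"
    if "g \<in> max_sieve C c"
    using s seval_sres[OF _ xs that] by (auto simp: sres_def intro!: nth_equalityI)
qed

text \<open>Operations on the associated sheaves act on representatives: the value at
  representatives lies in \<open>graph\<close>, whose local closure is the operation of
  \<open>aM\<close>.\<close>

lemma seval_aM:
  assumes "has_sort \<Sigma> \<Gamma> t A" and ss: "ss \<in> stuples aM \<Gamma> c" and \<Gamma>: "set \<Gamma> \<subseteq> sorts \<Sigma>"
    and c: "c \<in> Obj C"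
  shows "seval aM c ss t \<in> sec (assoc_sheaf C J (ssort M A)) c \<and> (\<forall>g xs. g \<in> max_sieve C c \<longrightarrow>
    rep g ss xs \<longrightarrow> (g, seval M (Dom C g) xs t) \<in> seval aM c ss t)"
  using assms(1)
proof (induction rule: has_sort.induct)
  case (1 i)
  then show ?case using ss by (auto simp: stuples_aM_iff list_all2_conv_all_nth)
next
  case (2 f ts)
  have t: "map (seval aM c ss) ts \<in> stuples aM (fdom \<Sigma> f) c"
    using 2(2) by (auto simp: stuples_aM_iff list_all2_conv_all_nth)
  note f = sfint_aM_sec[OF c 2(1) t]
  have "(g, seval M (Dom C g) xs (App f ts)) \<in> graph f c (map (seval aM c ss) ts)"
    if g: "g \<in> max_sieve C c" and xs: "rep g ss xs" for g xs
  proof -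
    have r: "rep g (map (seval aM c ss) ts) (map (seval M (Dom C g) xs) ts)"
      using 2(2) g xs by (auto simp: list_all2_conv_all_nth)
    from rep_stuples[OF fun_facts(1)[OF 2(1)] t r] r g show ?thesis by (auto simp: graph_def)
  qed
  then show ?case using f by auto
qed

lemma map_seval_aM:
  assumes "list_all2 (has_sort \<Sigma> \<Gamma>) ts \<Delta>" and ss: "ss \<in> stuples aM \<Gamma> c" and \<Gamma>: "set \<Gamma> \<subseteq> sorts \<Sigma>"
    and c: "c \<in> Obj C"
  shows "map (seval aM c ss) ts \<in> stuples aM \<Delta> c"
    "g \<in> max_sieve C c \<Longrightarrow> rep g ss xs \<Longrightarrow>
      rep g (map (seval aM c ss) ts) (map (seval M (Dom C g) xs) ts)"
  using assms(1) seval_aM[OF _ ss \<Gamma> c]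
  by (auto simp: stuples_aM_iff list_all2_conv_all_nth)

section \<open>Truth of geometric formulas and its passage to a subtopos\<close>

lemma srint_sres:
  assumes "r \<in> rels \<Sigma>" "g \<in> max_sieve C c" "xs \<in> srint M r c"
  shows "sres M (rdom \<Sigma> r) g xs \<in> srint M r (Dom C g)"
  using assms str by (auto simp: is_sheaf_struct_def max_sieve_def)

text \<open>Geometric formulas have no implication, negation or universal quantifier. Terms are
  natural, relations are subpresheaves, and an existential witness can itself be restricted. For the
  universal model this becomes preservation along homomorphisms.\<close>

lemma holds_at_stable:
  assumes "wf_form \<Sigma> \<phi> \<Gamma>" and "set \<Gamma> \<subseteq> sorts \<Sigma>"
  shows "stable_pred \<Gamma> (\<lambda>c. holds_at M c \<phi>)"
  unfolding stable_pred_def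
proof (intro allI impI)
  fix c xs g assume "xs \<in> stuples M \<Gamma> c" and g: "g \<in> max_sieve C c" and "holds_at M c \<phi> xs"
  then show "holds_at M (Dom C g) \<phi> (sres M \<Gamma> g xs)"
    using assms
  proof (induction \<phi> arbitrary: \<Gamma> xs)
    case (Eql t u)
    then show ?case using seval_sres[OF _ Eql(1) g] by auto
  next
    case (Rel r ts)
    have c: "c \<in> Obj C" using max_arr[OF g] by simp
    show ?case
      using Rel map_seval(2)[OF _ Rel(1) c g] srint_sres[OF _ g] by auto
  next
    case (Disj I \<phi>)
    then obtain i where "i \<in> I" "holds_at M c (\<phi> i) xs" "wf_form \<Sigma> (\<phi> i) \<Gamma>" by auto
    then show ?case using Disj.IH[of "\<phi> i" xs \<Gamma>] Disj.prems by auto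
  next
    case (Exi A \<phi>)
    then interpret A: site_presheaf C J "ssort M A" using site_psh by simp
    obtain x where x: "x \<in> sec (ssort M A) c" "holds_at M c \<phi> (x # xs)" using Exi.prems by auto
    have "holds_at M (Dom C g) \<phi> (sres M (A # \<Gamma>) g (x # xs))"
      using Exi.prems x by (intro Exi.IH) (auto simp: stuples_def)
    then show ?case using A.res_in[OF g x(1)] by (auto simp: sres_def)
  qed auto
qed

text \<open>Sheafification preserves finite limits, unions and images, so the interpretation in the
  restricted structure is the closure of the pointwise one. The existential case enlarges the
  context, which is why the induction runs over all contexts.\<close>

theorem interp_restrict:
  assumes "wf_form \<Sigma> \<phi> \<Gamma>" and "set \<Gamma> \<subseteq> sorts \<Sigma>" and "c \<in> Obj C" and "ss \<in> stuples aM \<Gamma> c"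
  shows "ss \<in> interp C J aM \<phi> \<Gamma> c \<longleftrightarrow> rep_sieve (\<lambda>d. holds_at M d \<phi>) c ss \<in> J c"
  using assms
proof (induction \<phi> arbitrary: \<Gamma> c ss)
  case Tru
  then show ?case using rep_total[of c \<Gamma> ss] by (simp add: rep_sieve_def)
next
  case (Eql t u)
  note \<Gamma> = Eql.prems(2) and c = Eql.prems(3) and ss = Eql.prems(4)
  note K = holds_at_stable[OF Eql.prems(1,2)]
  from Eql obtain A where t: "has_sort \<Sigma> \<Gamma> t A" and u: "has_sort \<Sigma> \<Gamma> u A" by auto
  have A: "A \<in> sorts \<Sigma>" using t \<Gamma> sg by cases (auto simp: wf_signature_def)
  interpret A: site_presheaf C J "ssort M A" by (rule site_psh[OF A])
  note st = seval_aM[OF t ss \<Gamma> c] and su = seval_aM[OF u ss \<Gamma> c]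
  show ?case
  proof
    assume "ss \<in> interp C J aM (Eql t u) \<Gamma> c"
    then have e: "seval aM c ss t = seval aM c ss u" by simp
    have si: "A.single (seval aM c ss t)" using st by (simp add: A.sec_iff)
    show "rep_sieve (\<lambda>d. holds_at M d (Eql t u)) c ss \<in> J c"
    proof (rule rep_sieve_coverI[OF c \<Gamma> K ss])
      fix g xs assume g: "g \<in> max_sieve C c" and xs: "rep g ss xs"
      have x: "xs \<in> stuples M \<Gamma> (Dom C g)" by (rule rep_stuples[OF \<Gamma> ss xs])
      \<comment> \<open>The values of both terms at \<open>xs\<close> represent the same section,
        and a section is locally single-valued.\<close>
      have "{h \<in> max_sieve C (Dom C g). res (ssort M A) h (seval M (Dom C g) xs t) =
          res (ssort M A) h (seval M (Dom C g) xs u)} \<in> J (Dom C g)"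
        using st su e g xs by (intro A.singleD[OF si]) auto
      then show "{h \<in> max_sieve C (Dom C g). holds_at M (Dom C h) (Eql t u) (sres M \<Gamma> h xs)} \<in> J (Dom C g)"
        using seval_sres[OF t x] seval_sres[OF u x] by (simp cong: conj_cong)
    qed
  next
    assume cov: "rep_sieve (\<lambda>d. holds_at M d (Eql t u)) c ss \<in> J c"
    \<comment> \<open>Two sections of the associated sheaf with common representatives on a cover
      are equal.\<close>
    have "seval aM c ss t = seval aM c ss u"
    proof (rule A.sec_eqI[OF c _ _ cov])
      show "rep_sieve (\<lambda>d. holds_at M d (Eql t u)) c ss \<subseteq> fst ` (seval aM c ss t \<inter> seval aM c ss u)"
      proof
        fix g assume "g \<in> rep_sieve (\<lambda>d. holds_at M d (Eql t u)) c ss"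
        then obtain xs where x: "g \<in> max_sieve C c" "rep g ss xs"
            "seval M (Dom C g) xs t = seval M (Dom C g) xs u"
          by (auto simp: rep_sieve_def)
        then have "(g, seval M (Dom C g) xs t) \<in> seval aM c ss t \<inter> seval aM c ss u"
          using st su x by (metis IntI)
        then show "g \<in> fst ` (seval aM c ss t \<inter> seval aM c ss u)" by force
      qed
    qed (use st su in auto)
    then show "ss \<in> interp C J aM (Eql t u) \<Gamma> c" using ss by simp
  qed
next
  case (Rel r ts)
  note \<Gamma> = Rel.prems(2) and c = Rel.prems(3) and ss = Rel.prems(4)
  note K = holds_at_stable[OF Rel.prems(1,2)]
  from Rel have r: "r \<in> rels \<Sigma>" and ts: "list_all2 (has_sort \<Sigma> \<Gamma>) ts (rdom \<Sigma> r)" by auto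
  have \<Delta>: "set (rdom \<Sigma> r) \<subseteq> sorts \<Sigma>" using r sg by (auto simp: wf_signature_def)
  let ?L = "\<lambda>d ys. ys \<in> srint M r d"
  have L: "stable_pred (rdom \<Sigma> r) ?L" using srint_sres[OF r] by (simp add: stable_pred_def)
  note m = map_seval_aM[OF ts ss \<Gamma> c]
  \<comment> \<open>Relations of \<open>aM\<close> are defined by covering conditions on
    representatives, so what remains is to compare representatives of \<open>ss\<close> with those
    of the tuple of term values.\<close>
  have i: "ss \<in> interp C J aM (Rel r ts) \<Gamma> c \<longleftrightarrow> rep_sieve ?L c (map (seval aM c ss) ts) \<in> J c"
    using ss m(1) by (auto simp: srint_aM rep_sieve_def Bex_def conj_commute)
  show ?case
    unfolding i
  proof
    assume cov: "rep_sieve ?L c (map (seval aM c ss) ts) \<in> J c"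
    show "rep_sieve (\<lambda>d. holds_at M d (Rel r ts)) c ss \<in> J c"
    proof (rule rep_sieve_coverI[OF c \<Gamma> K ss])
      fix g xs assume g: "g \<in> max_sieve C c" and xs: "rep g ss xs"
      have x: "xs \<in> stuples M \<Gamma> (Dom C g)" by (rule rep_stuples[OF \<Gamma> ss xs])
      have d: "Dom C g \<in> Obj C" using max_arr[OF g] by simp
      \<comment> \<open>A representative of the term values that lies in the relation need not come
        from a representative of \<open>ss\<close>; \<open>rep_sieve_local\<close> replaces it by
        the values at \<open>xs\<close>.\<close>
      show "{h \<in> max_sieve C (Dom C g). holds_at M (Dom C h) (Rel r ts) (sres M \<Gamma> h xs)} \<in> J (Dom C g)"
        using rep_sieve_local[OF \<Delta> L m(1) cov g m(2)[OF g xs]] map_seval(2)[OF ts x d]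
        by (simp cong: conj_cong)
    qed
  next
    assume "rep_sieve (\<lambda>d. holds_at M d (Rel r ts)) c ss \<in> J c"
    then show "rep_sieve ?L c (map (seval aM c ss) ts) \<in> J c"
      by (rule cov_mono[OF c _ rep_sieve_is_sieve[OF \<Delta> L m(1)]])
        (use m(2) in \<open>force simp: rep_sieve_def\<close>)
  qed
next
  case (Conj \<phi> \<psi>)
  note \<Gamma> = Conj.prems(2) and c = Conj.prems(3) and ss = Conj.prems(4)
  have w: "wf_form \<Sigma> \<phi> \<Gamma>" "wf_form \<Sigma> \<psi> \<Gamma>" using Conj.prems by auto
  note K = holds_at_stable[OF Conj.prems(1,2)]
  note K1 = holds_at_stable[OF w(1) \<Gamma>] and K2 = holds_at_stable[OF w(2) \<Gamma>]
  let ?R = "\<lambda>\<phi>. rep_sieve (\<lambda>d. holds_at M d \<phi>) c ss"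
  have "?R \<phi> \<in> J c \<and> ?R \<psi> \<in> J c \<longleftrightarrow> ?R (Conj \<phi> \<psi>) \<in> J c"
  proof
    assume a: "?R \<phi> \<in> J c \<and> ?R \<psi> \<in> J c"
    show "?R (Conj \<phi> \<psi>) \<in> J c"
    \<comment> \<open>At a given arrow the two conjuncts may hold for different representatives, so
      intersecting the two sieves does not suffice. Both are first localised at the same
      \<open>xs\<close>.\<close>
    proof (rule rep_sieve_coverI[OF c \<Gamma> K ss])
      fix g xs assume g: "g \<in> max_sieve C c" and xs: "rep g ss xs"
      have d: "Dom C g \<in> Obj C" using max_arr[OF g] by simp
      from cov_Int[OF d rep_sieve_local[OF \<Gamma> K1 ss _ g xs] rep_sieve_local[OF \<Gamma> K2 ss _ g xs]] a
      show "{h \<in> max_sieve C (Dom C g). holds_at M (Dom C h) (Conj \<phi> \<psi>) (sres M \<Gamma> h xs)} \<in> J (Dom C g)"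
        by (simp add: Int_def conj_ac cong: conj_cong)
    qed
  next
    assume a: "?R (Conj \<phi> \<psi>) \<in> J c"
    show "?R \<phi> \<in> J c \<and> ?R \<psi> \<in> J c"
      by (intro conjI cov_mono[OF c a rep_sieve_is_sieve[OF \<Gamma> K1 ss]]
          cov_mono[OF c a rep_sieve_is_sieve[OF \<Gamma> K2 ss]]) (auto simp: rep_sieve_def)
  qed
  then show ?case
    by (simp only: interp.simps Int_iff Conj.IH(1)[OF w(1) \<Gamma> c ss] Conj.IH(2)[OF w(2) \<Gamma> c ss])
next
  case (Disj I \<phi>)
  note \<Gamma> = Disj.prems(2) and c = Disj.prems(3) and ss = Disj.prems(4)
  have w: "wf_form \<Sigma> (\<phi> i) \<Gamma>" if "i \<in> I" for i using Disj.prems that by auto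
  note R = rep_sieve_is_sieve[OF \<Gamma> holds_at_stable[OF Disj.prems(1,2)] ss]
  let ?R = "\<lambda>\<phi>. rep_sieve (\<lambda>d. holds_at M d \<phi>) c ss"
  have Ri: "is_sieve C c (?R (\<phi> i))" if "i \<in> I" for i
    by (rule rep_sieve_is_sieve[OF \<Gamma> holds_at_stable[OF w[OF that] \<Gamma>] ss])
  \<comment> \<open>The arrows along which one of the disjuncts becomes true in the subtopos. The
    index may change from arrow to arrow, and the closure in \<open>interp\<close> asks that these
    arrows cover.\<close>
  let ?X = "{g \<in> max_sieve C c. \<exists>i\<in>I. pullback_sieve C g (?R (\<phi> i)) \<in> J (Dom C g)}"
  have "sres aM \<Gamma> g ss \<in> interp C J aM (\<phi> i) \<Gamma> (Dom C g) \<longleftrightarrow>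
      pullback_sieve C g (?R (\<phi> i)) \<in> J (Dom C g)" if "g \<in> max_sieve C c" "i \<in> I" for g i
    using Disj.IH[OF _ w[OF that(2)] \<Gamma> _ sres_aM(1)[OF \<Gamma> that(1) ss]] max_arr[OF that(1)]
      rep_sieve_sres[OF \<Gamma> that(1) ss] by auto
  then have "{g \<in> max_sieve C c. sres aM \<Gamma> g ss \<in> (\<Union>i\<in>I. interp C J aM (\<phi> i) \<Gamma> (Dom C g))} = ?X"
    by auto
  then have i: "ss \<in> interp C J aM (Disj I \<phi>) \<Gamma> c \<longleftrightarrow> ?X \<in> J c"
    using ss by (simp add: sclosure_def)
  show ?case
    unfolding i
  proof
    assume "?X \<in> J c"
    then show "?R (Disj I \<phi>) \<in> J c"
    proof (rule cov_local[OF c _ R], clarify)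
      fix g i assume g: "g \<in> max_sieve C c" and i: "i \<in> I"
        and p: "pullback_sieve C g (?R (\<phi> i)) \<in> J (Dom C g)"
      have "Dom C g \<in> Obj C" using max_arr[OF g] by simp
      then show "pullback_sieve C g (?R (Disj I \<phi>)) \<in> J (Dom C g)"
        by (rule cov_mono[OF _ p pullback_sieve_is_sieve[OF R g]])
          (use i in \<open>auto simp: rep_sieve_def pullback_sieve_def\<close>)
    qed
  next
    assume "?R (Disj I \<phi>) \<in> J c"
    then show "?X \<in> J c"
    proof (rule cov_mono[OF c])
      show "is_sieve C c ?X"
      proof (rule is_sieveI)
        fix g h assume g: "g \<in> ?X" and h: "h \<in> max_sieve C (Dom C g)"
        then have g': "g \<in> max_sieve C c" by simp
        show "Comp C g h \<in> ?X"
          using g h comp_max[OF g' h] pullback_pullback[OF g' h] cov_pull[OF h] by auto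
      qed auto
      show "?R (Disj I \<phi>) \<subseteq> ?X"
      proof
        fix g assume "g \<in> ?R (Disj I \<phi>)"
        then obtain i where i: "i \<in> I" "g \<in> ?R (\<phi> i)" and g: "g \<in> max_sieve C c"
          by (auto simp: rep_sieve_def)
        have "pullback_sieve C g (?R (\<phi> i)) \<in> J (Dom C g)"
          using pullback_member[OF Ri[OF i(1)] i(2)] cov_max max_arr[OF g] by simp
        then show "g \<in> ?X" using g i(1) by blast
      qed
    qed
  qed
next
  case (Exi A \<phi>)
  note \<Gamma> = Exi.prems(2) and c = Exi.prems(3) and ss = Exi.prems(4)
  have w: "wf_form \<Sigma> \<phi> (A # \<Gamma>)" and A: "A \<in> sorts \<Sigma>" using Exi.prems by auto
  have A\<Gamma>: "set (A # \<Gamma>) \<subseteq> sorts \<Sigma>" using A \<Gamma> by simp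
  interpret A: site_presheaf C J "ssort M A" by (rule site_psh[OF A])
  note R = rep_sieve_is_sieve[OF \<Gamma> holds_at_stable[OF Exi.prems(1,2)] ss]
  let ?K = "\<lambda>d. holds_at M d \<phi>"
  let ?R = "rep_sieve (\<lambda>d. holds_at M d (Exi A \<phi>)) c ss"
  \<comment> \<open>Here the witness is any section of the associated sheaf, whereas
    \<open>?R\<close> takes witnesses from the presheaf. \<open>RX\<close> and \<open>XR\<close>
    compare the two kinds.\<close>
  let ?X = "{g \<in> max_sieve C c. \<exists>s\<in>sec A.aP (Dom C g).
    rep_sieve ?K (Dom C g) (s # sres aM \<Gamma> g ss) \<in> J (Dom C g)}"
  have st: "s # sres aM \<Gamma> g ss \<in> stuples aM (A # \<Gamma>) (Dom C g)"
    if "g \<in> max_sieve C c" "s \<in> sec A.aP (Dom C g)" for g s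
    using sres_aM(1)[OF \<Gamma> that(1) ss] that(2) by (simp add: stuples_aM_iff)
  have IH: "s # sres aM \<Gamma> g ss \<in> interp C J aM \<phi> (A # \<Gamma>) (Dom C g) \<longleftrightarrow>
      rep_sieve ?K (Dom C g) (s # sres aM \<Gamma> g ss) \<in> J (Dom C g)"
    if "g \<in> max_sieve C c" "s \<in> sec A.aP (Dom C g)" for g s
    using Exi.IH[OF w A\<Gamma> _ st[OF that]] max_arr[OF that(1)] by simp
  have "sres aM \<Gamma> g ss \<in> tl ` interp C J aM \<phi> (A # \<Gamma>) (Dom C g) \<longleftrightarrow>
      (\<exists>s\<in>sec A.aP (Dom C g). s # sres aM \<Gamma> g ss \<in> interp C J aM \<phi> (A # \<Gamma>) (Dom C g))" for g
  proof
    assume "sres aM \<Gamma> g ss \<in> tl ` interp C J aM \<phi> (A # \<Gamma>) (Dom C g)"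
    then obtain us where us: "us \<in> interp C J aM \<phi> (A # \<Gamma>) (Dom C g)" "sres aM \<Gamma> g ss = tl us" by auto
    have "us \<in> stuples aM (A # \<Gamma>) (Dom C g)" by (rule subsetD[OF interp_subset_stuples us(1)])
    then show "\<exists>s\<in>sec A.aP (Dom C g). s # sres aM \<Gamma> g ss \<in> interp C J aM \<phi> (A # \<Gamma>) (Dom C g)"
      using us by (auto simp: stuples_aM_iff list_all2_Cons2)
  qed force
  then have "{g \<in> max_sieve C c. sres aM \<Gamma> g ss \<in> tl ` interp C J aM \<phi> (A # \<Gamma>) (Dom C g)} = ?X"
    using IH by auto
  then have i: "ss \<in> interp C J aM (Exi A \<phi>) \<Gamma> c \<longleftrightarrow> ?X \<in> J c"
    using ss by (simp add: sclosure_def)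
  have RX: "?R \<subseteq> ?X"
  proof
    fix g assume "g \<in> ?R"
    then obtain x xs where g: "g \<in> max_sieve C c" and xs: "rep g ss xs"
      and x: "x \<in> sec (ssort M A) (Dom C g)" "holds_at M (Dom C g) \<phi> (x # xs)"
      by (auto simp: rep_sieve_def)
    have d: "Dom C g \<in> Obj C" using max_arr[OF g] by simp
    \<comment> \<open>The unit turns a pointwise witness into a section, represented along every
      arrow by the restrictions of \<open>x\<close>.\<close>
    let ?s = "assoc_unit C J (ssort M A) (Dom C g) x"
    note u = A.unit_aux[OF d x(1)]
    have t: "x # xs \<in> stuples M (A # \<Gamma>) (Dom C g)"
      using x(1) rep_stuples[OF \<Gamma> ss xs] by (simp add: stuples_def)
    have "rep_sieve ?K (Dom C g) (?s # sres aM \<Gamma> g ss) = max_sieve C (Dom C g)"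
    proof (intro equalityI subsetI)
      fix h assume h: "h \<in> max_sieve C (Dom C g)"
      have "holds_at M (Dom C h) \<phi> (sres M (A # \<Gamma>) h (x # xs))"
        using holds_at_stable[OF w A\<Gamma>] t h x(2) by (auto simp: stable_pred_def)
      moreover have "rep h (?s # sres aM \<Gamma> g ss) (sres M (A # \<Gamma>) h (x # xs))"
        using u(3) h rep_sres[OF \<Gamma> ss xs h] sres_aM(2)[OF \<Gamma> g ss h] by (auto simp: sres_def)
      ultimately show "h \<in> rep_sieve ?K (Dom C g) (?s # sres aM \<Gamma> g ss)"
        using h by (auto simp: rep_sieve_def)
    qed (simp add: rep_sieve_def)
    then show "g \<in> ?X" using g u(4) cov_max[OF d] by (auto intro!: bexI[of _ ?s])
  qed
  \<comment> \<open>A section need not come from the presheaf, but each of its representatives is a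
    pointwise witness over the domain of its arrow.\<close>
  have XR: "rep_sieve ?K (Dom C g) (s # sres aM \<Gamma> g ss) \<subseteq> pullback_sieve C g ?R"
    if g: "g \<in> max_sieve C c" and s: "s \<in> sec A.aP (Dom C g)" for g s
  proof
    fix h assume "h \<in> rep_sieve ?K (Dom C g) (s # sres aM \<Gamma> g ss)"
    then obtain x xs where h: "h \<in> max_sieve C (Dom C g)" and x: "(h, x) \<in> s"
      and xs: "rep h (sres aM \<Gamma> g ss) xs" "holds_at M (Dom C h) \<phi> (x # xs)"
      by (auto simp: rep_sieve_def list_all2_Cons1)
    have "x \<in> sec (ssort M A) (Dom C h)" using s x A.stableD(2) by (auto simp: A.sec_iff)
    then show "h \<in> pullback_sieve C g ?R"
      using h xs comp_max[OF g h] sres_aM(2)[OF \<Gamma> g ss h] by (auto simp: rep_sieve_def pullback_sieve_def)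
  qed
  show ?case
    unfolding i
  proof
    assume "?X \<in> J c"
    then show "?R \<in> J c"
    proof (rule cov_local[OF c _ R], clarify)
      fix g s assume g: "g \<in> max_sieve C c" and s: "s \<in> sec A.aP (Dom C g)"
        and p: "rep_sieve ?K (Dom C g) (s # sres aM \<Gamma> g ss) \<in> J (Dom C g)"
      have "Dom C g \<in> Obj C" using max_arr[OF g] by simp
      then show "pullback_sieve C g ?R \<in> J (Dom C g)"
        by (rule cov_mono[OF _ p pullback_sieve_is_sieve[OF R g] XR[OF g s]])
    qed
  next
    assume "?R \<in> J c"
    then show "?X \<in> J c"
    proof (rule cov_mono[OF c _ _ RX])
      show "is_sieve C c ?X"
      proof (rule is_sieveI)
        fix g h assume g: "g \<in> ?X" and h: "h \<in> max_sieve C (Dom C g)"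
        then have g': "g \<in> max_sieve C c" by simp
        obtain s where s: "s \<in> sec A.aP (Dom C g)"
          "rep_sieve ?K (Dom C g) (s # sres aM \<Gamma> g ss) \<in> J (Dom C g)" using g by auto
        note gh = comp_max[OF g' h]
        have "rep_sieve ?K (Dom C h) (sres aM (A # \<Gamma>) h (s # sres aM \<Gamma> g ss)) \<in> J (Dom C h)"
          using rep_sieve_sres[OF A\<Gamma> h st[OF g' s(1)]] cov_pull[OF h s(2)] by simp
        \<comment> \<open>Restriction in two steps and along the composite are compared only through
          their representatives, since \<open>rep_sieve\<close> depends on nothing else.\<close>
        moreover have "rep k (sres aM (A # \<Gamma>) h (s # sres aM \<Gamma> g ss)) xs \<longleftrightarrow>
          rep k (res A.aP h s # sres aM \<Gamma> (Comp C g h) ss) xs"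
          if k: "k \<in> max_sieve C (Dom C h)" for k xs
          using sres_aM(2)[OF \<Gamma> h sres_aM(1)[OF \<Gamma> g' ss] k] sres_aM(2)[OF \<Gamma> gh(1) ss]
            sres_aM(2)[OF \<Gamma> g' ss] comp_max[OF h k] comp_assoc[OF g' h k] gh k
          by (cases xs) (auto simp: sres_def)
        ultimately have "rep_sieve ?K (Dom C h) (res A.aP h s # sres aM \<Gamma> (Comp C g h) ss) \<in> J (Dom C h)"
          by (simp add: rep_sieve_def cong: conj_cong)
        then show "Comp C g h \<in> ?X" using gh A.res_sec[OF h s(1)] by (auto intro!: bexI[of _ "res A.aP h s"])
      qed auto
    qed
  qed
qed

end

section \<open>Rigid topologies given by classes of objects\<close>

lemma category_op: "category C \<Longrightarrow> category (op C)"
  by (auto simp: category_def op_def hom_def)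

lemma category_full_subcategory: "category C \<Longrightarrow> category (full_subcategory C X)"
  by (auto simp: category_def full_subcategory_def hom_def)

text \<open>The maximal sieve contains the identity, and the value of a matching family there is its
  unique amalgamation.\<close>

lemma presheaf_is_trivial_sheaf:
  assumes C: "category C" and P: "is_presheaf C P"
  shows "is_sheaf C (trivial_topology C) P"
  unfolding is_sheaf_def trivial_topology_def
proof (intro conjI P ballI allI impI)
  fix c S x
  assume c: "c \<in> Obj C" and S: "S \<in> {max_sieve C c}" and xs: "\<forall>f\<in>S. x f \<in> sec P (Dom C f)"
    and m: "\<forall>f\<in>S. \<forall>g\<in>Arr C. Cod C g = Dom C f \<longrightarrow> x (Comp C f g) = res P g (x f)"
  have i: "Ident C c \<in> max_sieve C c" "Dom C (Ident C c) = c"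
    using C c by (auto simp: category_def hom_def max_sieve_def)
  have comp: "Comp C (Ident C c) f = f" if "f \<in> max_sieve C c" for f
    using C that by (auto simp: category_def max_sieve_def)
  show "\<exists>!s. s \<in> sec P c \<and> (\<forall>f\<in>S. res P f s = x f)"
  proof (rule ex1I[of _ "x (Ident C c)"])
    have "x (Ident C c) \<in> sec P c" using S xs i by force
    moreover have "res P f (x (Ident C c)) = x f" if f: "f \<in> S" for f
    proof -
      have "x (Comp C (Ident C c) f) = res P f (x (Ident C c))"
        using m i f S by (auto simp: max_sieve_def)
      then show ?thesis using comp f S by simp
    qed
    ultimately show "x (Ident C c) \<in> sec P c \<and> (\<forall>f\<in>S. res P f (x (Ident C c)) = x f)" by blast
    show "s = x (Ident C c)" if "s \<in> sec P c \<and> (\<forall>f\<in>S. res P f s = x f)" for s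
    proof -
      have "res P (Ident C c) s = s" using P c that by (auto simp: is_presheaf_def)
      then show ?thesis using that S i(1) by auto
    qed
  qed
qed

text \<open>The largest topology for which every object satisfying \<open>P\<close> is irreducible:
  pulling a covering sieve back along an arrow from such an object must give the maximal
  sieve.\<close>

definition object_topology :: "('o, 'a) cat \<Rightarrow> ('o \<Rightarrow> bool) \<Rightarrow> 'o \<Rightarrow> 'a set set" where
  "object_topology C P c =
     {S. is_sieve C c S \<and> (\<forall>f\<in>max_sieve C c. P (Dom C f) \<longrightarrow> f \<in> S)}"

lemma object_topology:
  assumes C: "category C"
  shows "grothendieck_topology C (object_topology C P)"
  unfolding grothendieck_topology_def
proof (intro conjI ballI allI impI)
  fix c S assume "c \<in> Obj C" and S: "S \<in> object_topology C P c"
  then show "is_sieve C c S" by (simp add: object_topology_def)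
next
  fix c show "max_sieve C c \<in> object_topology C P c"
    using C by (auto simp: object_topology_def is_sieve_def max_sieve_def category_def hom_def)
next
  fix f S assume f: "f \<in> Arr C" and S: "S \<in> object_topology C P (Cod C f)"
  have "Comp C f g \<in> S" if "g \<in> max_sieve C (Dom C f)" "P (Dom C g)" for g
    using C f S that by (auto simp: object_topology_def category_def hom_def max_sieve_def)
  then show "pullback_sieve C f S \<in> object_topology C P (Dom C f)"
    using pullback_is_sieve[OF C, of "Cod C f" S f] f S
    by (auto simp: object_topology_def pullback_sieve_def max_sieve_def)
next
  fix c S R assume S: "S \<in> object_topology C P c" and R: "is_sieve C c R"
    and l: "\<forall>f\<in>S. pullback_sieve C f R \<in> object_topology C P (Dom C f)"
  \<comment> \<open>Transitivity: \<open>S\<close> contains \<open>f\<close>, and the covering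
    pullback of \<open>R\<close> along \<open>f\<close> contains the identity of the domain of
    \<open>f\<close>, which is itself an arrow from an object satisfying \<open>P\<close>.\<close>
  have "f \<in> R" if f: "f \<in> max_sieve C c" and p: "P (Dom C f)" for f
  proof -
    have i: "Ident C (Dom C f) \<in> max_sieve C (Dom C f)" "Dom C (Ident C (Dom C f)) = Dom C f"
      "Comp C f (Ident C (Dom C f)) = f"
      using C f by (auto simp: category_def hom_def max_sieve_def)
    have "f \<in> S" using S f p by (simp add: object_topology_def)
    then show "f \<in> R" using l i p by (force simp: object_topology_def pullback_sieve_def)
  qed
  then show "R \<in> object_topology C P c" using R by (simp add: object_topology_def)
qed

text \<open>The identity of such an object is one of the arrows that a covering sieve must
  contain.\<close>

lemma object_topology_max:
  assumes C: "category C" and c: "c \<in> Obj C" and p: "P c" and S: "S \<in> object_topology C P c"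
  shows "S = max_sieve C c"
proof -
  have "Ident C c \<in> max_sieve C c" "Dom C (Ident C c) = c"
    using C c by (auto simp: category_def hom_def max_sieve_def)
  then have i: "Ident C c \<in> S" "Dom C (Ident C c) = c" using S p by (auto simp: object_topology_def)
  have "f \<in> S" if f: "f \<in> max_sieve C c" for f
  proof -
    have "Comp C (Ident C c) f = f" using C f by (auto simp: category_def max_sieve_def)
    then show ?thesis using S f i by (force simp: object_topology_def is_sieve_def max_sieve_def)
  qed
  then show ?thesis using S by (auto simp: object_topology_def is_sieve_def)
qed

text \<open>All arrows into \<open>c\<close> from objects satisfying \<open>P\<close> serve as
  generators. If there are none, the empty sieve covers \<open>c\<close>.\<close>

lemma object_topology_rigid:
  assumes C: "category C"
  shows "rigid_topology C (object_topology C P)"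
  unfolding rigid_topology_def
proof
  fix c assume "c \<in> Obj C"
  let ?X = "{f \<in> max_sieve C c. P (Dom C f)}"
  have "irreducible_object C (object_topology C P) (Dom C f)" if "f \<in> ?X" for f
    using object_topology_max[OF C, of "Dom C f" P] that C
    by (auto simp: irreducible_object_def max_sieve_def category_def)
  then have 1: "?X \<subseteq> {f \<in> Arr C. Cod C f = c \<and> irreducible_object C (object_topology C P) (Dom C f)}"
    by (auto simp: max_sieve_def)
  have 2: "is_sieve C c (generated_sieve C ?X)"
    unfolding is_sieve_def
  proof (intro conjI ballI impI)
    show "generated_sieve C ?X \<subseteq> max_sieve C c"
      using C by (auto simp: generated_sieve_def max_sieve_def category_def hom_def)
    fix f g assume "f \<in> generated_sieve C ?X" and g: "g \<in> Arr C" "Cod C g = Dom C f"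
    then obtain h k where h: "f = Comp C h k" "h \<in> ?X" "k \<in> Arr C" "Cod C k = Dom C h"
      by (auto simp: generated_sieve_def)
    have "Dom C f = Dom C k" using C h by (auto simp: category_def hom_def max_sieve_def)
    then have "Comp C f g = Comp C h (Comp C k g)" "Comp C k g \<in> Arr C" "Cod C (Comp C k g) = Dom C h"
      using C h g by (auto simp: category_def hom_def max_sieve_def)
    then show "Comp C f g \<in> generated_sieve C ?X" using h(2) unfolding generated_sieve_def by blast
  qed
  have "f \<in> generated_sieve C ?X" if "f \<in> ?X" for f
  proof -
    have "f = Comp C f (Ident C (Dom C f))" "Ident C (Dom C f) \<in> Arr C" "Cod C (Ident C (Dom C f)) = Dom C f"
      using C that by (auto simp: category_def hom_def max_sieve_def)
    then show ?thesis using that unfolding generated_sieve_def by blast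
  qed
  then have "generated_sieve C ?X \<in> object_topology C P c"
    using 2 by (simp add: object_topology_def)
  with 1 show "\<exists>X. X \<subseteq> {f \<in> Arr C. Cod C f = c \<and> irreducible_object C (object_topology C P) (Dom C f)} \<and>
      generated_sieve C X \<in> object_topology C P c" by blast
qed

section \<open>The site of compact models\<close>

lemma struct_hom_apply:
  "h \<in> struct_homs \<Sigma> M N \<Longrightarrow> A \<in> sorts \<Sigma> \<Longrightarrow> x \<in> carr M A \<Longrightarrow> h A x \<in> carr N A"
  by (auto simp: struct_homs_def PiE_def Pi_def)

lemma struct_hom_tuples:
  assumes "h \<in> struct_homs \<Sigma> M N" "set \<Gamma> \<subseteq> sorts \<Sigma>" "xs \<in> tuples M \<Gamma>"
  shows "map2 h \<Gamma> xs \<in> tuples N \<Gamma>"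
  using assms struct_hom_apply[OF assms(1)]
  by (auto simp: tuples_def list_all2_conv_all_nth subset_iff)

lemma map2_ident_hom:
  assumes "set \<Gamma> \<subseteq> sorts \<Sigma>" "xs \<in> tuples M \<Gamma>"
  shows "map2 (\<lambda>A\<in>sorts \<Sigma>. \<lambda>x\<in>carr M A. x) \<Gamma> xs = xs"
  using assms by (auto simp: tuples_def list_all2_conv_all_nth subset_iff intro!: nth_equalityI)

lemma map2_comp_hom:
  assumes "set \<Gamma> \<subseteq> sorts \<Sigma>" "xs \<in> tuples M \<Gamma>"
  shows "map2 (\<lambda>A\<in>sorts \<Sigma>. compose (carr M A) (k A) (h A)) \<Gamma> xs = map2 k \<Gamma> (map2 h \<Gamma> xs)"
  using assms
  by (auto simp: tuples_def list_all2_conv_all_nth subset_iff compose_def intro!: nth_equalityI)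

lemma ident_struct_hom:
  assumes \<Sigma>: "wf_signature \<Sigma>" and M: "is_struct \<Sigma> M"
  shows "(\<lambda>A\<in>sorts \<Sigma>. \<lambda>x\<in>carr M A. x) \<in> struct_homs \<Sigma> M M" (is "?i \<in> _")
proof -
  have "?i (fcod \<Sigma> f) (fint M f xs) = fint M f (map2 ?i (fdom \<Sigma> f) xs)"
    if f: "f \<in> funs \<Sigma>" and xs: "xs \<in> tuples M (fdom \<Sigma> f)" for f xs
  proof -
    have s: "set (fdom \<Sigma> f) \<subseteq> sorts \<Sigma>" "fcod \<Sigma> f \<in> sorts \<Sigma>" using \<Sigma> f by (auto simp: wf_signature_def)
    have "?i (fcod \<Sigma> f) (fint M f xs) = fint M f xs" using M f xs s by (auto simp: is_struct_def)
    then show ?thesis by (simp only: map2_ident_hom[OF s(1) xs])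
  qed
  moreover have "map2 ?i (rdom \<Sigma> r) xs \<in> rint M r" if r: "r \<in> rels \<Sigma>" and xs: "xs \<in> rint M r" for r xs
  proof -
    have "set (rdom \<Sigma> r) \<subseteq> sorts \<Sigma>" "xs \<in> tuples M (rdom \<Sigma> r)"
      using \<Sigma> M r xs by (auto simp: wf_signature_def is_struct_def)
    then show ?thesis using xs by (simp only: map2_ident_hom)
  qed
  moreover have "?i \<in> (\<Pi>\<^sub>E A\<in>sorts \<Sigma>. carr M A \<rightarrow>\<^sub>E carr M A)" by auto
  ultimately show ?thesis unfolding struct_homs_def by blast
qed

lemma comp_struct_hom:
  assumes \<Sigma>: "wf_signature \<Sigma>" and M: "is_struct \<Sigma> M"
    and h: "h \<in> struct_homs \<Sigma> M N" and k: "k \<in> struct_homs \<Sigma> N R"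
  shows "(\<lambda>A\<in>sorts \<Sigma>. compose (carr M A) (k A) (h A)) \<in> struct_homs \<Sigma> M R" (is "?c \<in> _")
proof -
  have "?c (fcod \<Sigma> f) (fint M f xs) = fint R f (map2 ?c (fdom \<Sigma> f) xs)"
    if f: "f \<in> funs \<Sigma>" and xs: "xs \<in> tuples M (fdom \<Sigma> f)" for f xs
  proof -
    have s: "set (fdom \<Sigma> f) \<subseteq> sorts \<Sigma>" "fcod \<Sigma> f \<in> sorts \<Sigma>" using \<Sigma> f by (auto simp: wf_signature_def)
    have "fint M f xs \<in> carr M (fcod \<Sigma> f)" using M f xs by (auto simp: is_struct_def)
    then have "?c (fcod \<Sigma> f) (fint M f xs) = k (fcod \<Sigma> f) (fint N f (map2 h (fdom \<Sigma> f) xs))"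
      using h f xs s by (simp add: compose_def struct_homs_def)
    also have "\<dots> = fint R f (map2 k (fdom \<Sigma> f) (map2 h (fdom \<Sigma> f) xs))"
      using k f struct_hom_tuples[OF h s(1) xs] by (simp add: struct_homs_def)
    finally show ?thesis by (simp only: map2_comp_hom[OF s(1) xs])
  qed
  moreover have "map2 ?c (rdom \<Sigma> r) xs \<in> rint R r" if r: "r \<in> rels \<Sigma>" and xs: "xs \<in> rint M r" for r xs
  proof -
    have s: "set (rdom \<Sigma> r) \<subseteq> sorts \<Sigma>" "xs \<in> tuples M (rdom \<Sigma> r)"
      using \<Sigma> M r xs by (auto simp: wf_signature_def is_struct_def)
    have "map2 k (rdom \<Sigma> r) (map2 h (rdom \<Sigma> r) xs) \<in> rint R r"
      using h k r xs by (simp add: struct_homs_def)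
    then show ?thesis by (simp only: map2_comp_hom[OF s])
  qed
  moreover have "?c \<in> (\<Pi>\<^sub>E A\<in>sorts \<Sigma>. carr M A \<rightarrow>\<^sub>E carr R A)"
    using struct_hom_apply[OF h] struct_hom_apply[OF k] by (auto simp: compose_def)
  ultimately show ?thesis unfolding struct_homs_def by blast
qed

text \<open>Homomorphisms are extensional families, so the category laws can be checked on elements
  of the carriers.\<close>

lemma struct_hom_ext:
  assumes "h \<in> struct_homs \<Sigma> M N" "k \<in> struct_homs \<Sigma> M N"
    and "\<And>A x. A \<in> sorts \<Sigma> \<Longrightarrow> x \<in> carr M A \<Longrightarrow> h A x = k A x"
  shows "h = k"
proof (rule PiE_ext)
  show "h \<in> (\<Pi>\<^sub>E A\<in>sorts \<Sigma>. carr M A \<rightarrow>\<^sub>E carr N A)" "k \<in> (\<Pi>\<^sub>E A\<in>sorts \<Sigma>. carr M A \<rightarrow>\<^sub>E carr N A)"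
    using assms by (auto simp: struct_homs_def)
  then show "h A = k A" if "A \<in> sorts \<Sigma>" for A
    using assms(3)[OF that] that by (intro PiE_ext[of "h A" "carr M A" "\<lambda>_. carr N A" "k A"]) (auto simp: PiE_iff)
qed

lemma category_Mod:
  assumes \<Sigma>: "wf_signature (sig T)"
  shows "category (Mod T)"
proof -
  let ?C = "\<lambda>M k h. \<lambda>A\<in>sorts (sig T). compose (carr M A) (k A) (h A)"
  let ?I = "\<lambda>M. \<lambda>A\<in>sorts (sig T). \<lambda>x\<in>carr M A. x"
  have st: "is_struct (sig T) M" if "is_model T M" for M using that by (simp add: is_model_def)
  note c = comp_struct_hom[OF \<Sigma> st] and i = ident_struct_hom[OF \<Sigma> st]
  have 1: "?C M h (?I M) = h" "?C M (?I N) h = h"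
    if "is_model T M" "is_model T N" "h \<in> struct_homs (sig T) M N" for M N h
    by (rule struct_hom_ext[OF c[OF that(1) i[OF that(1)] that(3)] that(3)],
        simp add: compose_def)
      (rule struct_hom_ext[OF c[OF that(1) that(3) i[OF that(2)]] that(3)],
        simp add: compose_def struct_hom_apply[OF that(3)])
  have 2: "?C M l (?C M k h) = ?C M (?C N l k) h"
    if m: "is_model T M" "is_model T N" "is_model T R" "h \<in> struct_homs (sig T) M N" "k \<in> struct_homs (sig T) N R"
      "l \<in> struct_homs (sig T) R S" for M N R S h k l
    by (rule struct_hom_ext[OF c[OF m(1) c[OF m(1,4,5)] m(6)] c[OF m(1,4) c[OF m(2,5,6)]]])
      (simp add: compose_def struct_hom_apply[OF m(4)])
  show ?thesis
    unfolding category_def hom_def Mod_def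
    using 1 2 c i by auto
qed

section \<open>The opposite site and the tautological structure on it\<close>

lemma category_model_site: "wf_signature (sig T) \<Longrightarrow> category (model_site T)"
  unfolding model_site_def Mod_c_def
  by (intro category_op category_full_subcategory category_Mod)

lemma Obj_model_site: "N \<in> Obj (model_site T) \<Longrightarrow> is_struct (sig T) N"
  by (auto simp: model_site_def op_def Mod_c_def full_subcategory_def Mod_def is_model_def)

text \<open>Domain and codomain are exchanged: a sieve on \<open>M\<close> consists of homomorphisms
  out of \<open>M\<close>, and restriction along one of them moves to its target.\<close>

lemma model_site_simps:
  "Dom (model_site T) (M, h, N) = N" "Cod (model_site T) (M, h, N) = M"
  "Ident (model_site T) M = (M, \<lambda>A\<in>sorts (sig T). \<lambda>x\<in>carr M A. x, M)"
  "Comp (model_site T) (M, h, N) (N', k, R) = (M, \<lambda>A\<in>sorts (sig T). compose (carr M A) (k A) (h A), R)"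
  by (auto simp: model_site_def op_def Mod_c_def full_subcategory_def Mod_def)

lemma universal_simps:
  "sec (ssort universal_model A) N = carr N A"
  "res (ssort universal_model A) (M, h, N) = h A"
  "sfint universal_model f N = fint N f"
  "srint universal_model r N = rint N r"
  "stuples universal_model \<Gamma> N = tuples N \<Gamma>"
  "sres universal_model \<Gamma> (M, h, N) xs = map2 h \<Gamma> xs"
  by (auto simp: universal_model_def stuples_def tuples_def sres_def)

lemma Arr_model_site:
  "g \<in> Arr (model_site T) \<longleftrightarrow>
     (\<exists>N h M. g = (N, h, M) \<and> N \<in> Obj (model_site T) \<and> M \<in> Obj (model_site T) \<and>
        h \<in> struct_homs (sig T) N M)"
  by (auto simp: model_site_def op_def Mod_c_def full_subcategory_def Mod_def)

lemma universal_model_struct: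
  assumes \<Sigma>: "wf_signature (sig T)"
  shows "is_sheaf_struct (sig T) (model_site T) (trivial_topology (model_site T)) universal_model"
proof -
  note cat = category_model_site[OF \<Sigma>]
  have psh: "is_presheaf (model_site T) (ssort universal_model A)" if A: "A \<in> sorts (sig T)" for A
    unfolding is_presheaf_def
  proof (intro conjI ballI impI)
    fix f assume "f \<in> Arr (model_site T)"
    then show "res (ssort universal_model A) f \<in> sec (ssort universal_model A) (Cod (model_site T) f) \<rightarrow>
        sec (ssort universal_model A) (Dom (model_site T) f)"
      using struct_hom_apply[OF _ A]
      by (auto simp: Arr_model_site model_site_simps universal_simps)
  next
    fix f g x assume f: "f \<in> Arr (model_site T)" "g \<in> Arr (model_site T)"
      "Dom (model_site T) f = Cod (model_site T) g" "x \<in> sec (ssort universal_model A) (Cod (model_site T) f)"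
    then show "res (ssort universal_model A) (Comp (model_site T) f g) x =
        res (ssort universal_model A) g (res (ssort universal_model A) f x)"
      using A by (auto simp: Arr_model_site model_site_simps universal_simps compose_def)
  qed (use A in \<open>simp add: model_site_simps universal_simps\<close>)
  have f: "set (fdom (sig T) f) \<subseteq> sorts (sig T) \<and> fcod (sig T) f \<in> sorts (sig T)"
    if "f \<in> funs (sig T)" for f using \<Sigma> that by (auto simp: wf_signature_def)
  have r: "set (rdom (sig T) r) \<subseteq> sorts (sig T)" if "r \<in> rels (sig T)" for r
    using \<Sigma> that by (auto simp: wf_signature_def)
  show ?thesis
    unfolding is_sheaf_struct_def
  proof (intro conjI ballI)
    fix A assume "A \<in> sorts (sig T)"
    then show "is_sheaf (model_site T) (trivial_topology (model_site T)) (ssort universal_model A)"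
      by (intro presheaf_is_trivial_sheaf cat psh)
  next
    fix f N assume "f \<in> funs (sig T)" "N \<in> Obj (model_site T)"
    then show "sfint universal_model f N \<in>
        stuples universal_model (fdom (sig T) f) N \<rightarrow> sec (ssort universal_model (fcod (sig T) f)) N"
      using Obj_model_site by (auto simp: universal_simps is_struct_def)
  next
    fix f g xs assume "f \<in> funs (sig T)" "g \<in> Arr (model_site T)"
      "xs \<in> stuples universal_model (fdom (sig T) f) (Cod (model_site T) g)"
    then show "sfint universal_model f (Dom (model_site T) g) (sres universal_model (fdom (sig T) f) g xs) =
        res (ssort universal_model (fcod (sig T) f)) g (sfint universal_model f (Cod (model_site T) g) xs)"
      by (auto simp: Arr_model_site model_site_simps universal_simps struct_homs_def)
  next
    fix r N assume "r \<in> rels (sig T)" "N \<in> Obj (model_site T)"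
    then show "srint universal_model r N \<subseteq> stuples universal_model (rdom (sig T) r) N"
      using Obj_model_site[of N T] by (auto simp: universal_simps is_struct_def)
  next
    fix r g xs assume "r \<in> rels (sig T)" "g \<in> Arr (model_site T)"
      "xs \<in> srint universal_model r (Cod (model_site T) g)"
    then show "sres universal_model (rdom (sig T) r) g xs \<in> srint universal_model r (Dom (model_site T) g)"
      by (auto simp: Arr_model_site model_site_simps universal_simps struct_homs_def)
  next
    fix r N assume rr: "r \<in> rels (sig T)" and N: "N \<in> Obj (model_site T)"
    show "sclosure (model_site T) (trivial_topology (model_site T)) universal_model (rdom (sig T) r)
        (srint universal_model r) N \<subseteq> srint universal_model r N"
    proof
      \<comment> \<open>In the trivial topology only the maximal sieve covers. It contains the
        identity, along which restriction changes nothing, so every relation is already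
        closed.\<close>
      let ?i = "Ident (model_site T) N"
      fix xs assume "xs \<in> sclosure (model_site T) (trivial_topology (model_site T)) universal_model
        (rdom (sig T) r) (srint universal_model r) N"
      then have xs: "xs \<in> tuples N (rdom (sig T) r)" and
        a: "\<forall>g\<in>max_sieve (model_site T) N. sres universal_model (rdom (sig T) r) g xs
          \<in> rint (Dom (model_site T) g) r"
        by (auto simp: sclosure_def trivial_topology_def universal_simps)
      have "?i \<in> max_sieve (model_site T) N"
        using cat N by (auto simp: category_def hom_def max_sieve_def)
      with a have "sres universal_model (rdom (sig T) r) ?i xs \<in> rint (Dom (model_site T) ?i) r" by blast
      then show "xs \<in> srint universal_model r N"
        by (simp only: model_site_simps universal_simps map2_ident_hom[OF r[OF rr] xs])
    qed
  qed
qed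

lemma seval_universal: "seval universal_model N xs t = eval N xs t"
  by (induction t) (simp_all add: universal_simps cong: map_cong)

text \<open>Turns covering conditions on the site into conditions on satisfaction in set
  models.\<close>

lemma holds_at_universal: "holds_at universal_model N \<phi> xs \<longleftrightarrow> sat N \<phi> xs"
proof (induction \<phi> arbitrary: xs)
  case (Rel r ts)
  have "seval universal_model N xs = eval N xs" by (rule ext) (rule seval_universal)
  then show ?case by (simp add: universal_simps)
qed (simp_all add: universal_simps seval_universal)

section \<open>Quotients by closed axioms\<close>

text \<open>The homomorphisms from \<open>N\<close> into compact models of the closed formula; it is
  the representing sieve of the empty tuple.\<close>

definition sat_sieve :: "'u gtheory \<Rightarrow> 'u form \<Rightarrow> 'u struct \<Rightarrow> 'u struct_arr set" where
  "sat_sieve T \<phi> N = {g \<in> max_sieve (model_site T) N. sat (Dom (model_site T) g) \<phi> []}"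

locale model_topology = site "model_site T" J for T :: "'u gtheory" and J +
  assumes wf: "wf_signature (sig T)"
begin

sublocale universal: site_struct "model_site T" J "sig T" universal_model
  by unfold_locales (intro wf universal_model_struct)+

lemma rep_sieve_Nil:
  "universal.rep_sieve (\<lambda>d. holds_at universal_model d \<phi>) N [] = sat_sieve T \<phi> N"
  by (simp add: universal.rep_sieve_def sat_sieve_def holds_at_universal)

lemma Nil_stuples: "[] \<in> stuples M [] N"
  by (simp add: stuples_def)

lemma sat_sieve_is_sieve:
  assumes "wf_form (sig T) \<phi> []"
  shows "is_sieve (model_site T) N (sat_sieve T \<phi> N)"
  using universal.rep_sieve_is_sieve[OF _ universal.holds_at_stable[OF assms] Nil_stuples]
  by (simp add: rep_sieve_Nil)

lemma sat_stable:
  assumes "wf_form (sig T) \<phi> []" "sat N \<phi> []" "g \<in> max_sieve (model_site T) N"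
  shows "sat (Dom (model_site T) g) \<phi> []"
proof -
  have "universal.stable_pred [] (\<lambda>N. holds_at universal_model N \<phi>)"
    using universal.holds_at_stable[OF assms(1)] by simp
  moreover have "holds_at universal_model N \<phi> []" using assms(2) by (simp add: holds_at_universal)
  ultimately have "holds_at universal_model (Dom (model_site T) g) \<phi> (sres universal_model [] g [])"
    using assms(3) Nil_stuples by (metis universal.stable_pred_def)
  then show ?thesis by (simp add: holds_at_universal sres_def)
qed

text \<open>In the empty context the only tuple is \<open>[]\<close>, so an interpretation over
  \<open>N\<close> is a truth value, true exactly when the corresponding sieve covers. Inclusion of
  interpretations becomes an implication.\<close>

lemma holds_in_closed:
  assumes "wf_sequent (sig T) \<sigma>" "ctx \<sigma> = []"
  shows "holds_in (model_site T) J universal.aM \<sigma> \<longleftrightarrow>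
    (\<forall>N\<in>Obj (model_site T). sat_sieve T (ante \<sigma>) N \<in> J N \<longrightarrow> sat_sieve T (succ \<sigma>) N \<in> J N)"
proof -
  have "interp (model_site T) J universal.aM \<phi> [] N =
      (if sat_sieve T \<phi> N \<in> J N then {[]} else {})"
    if "wf_form (sig T) \<phi> []" "N \<in> Obj (model_site T)" for \<phi> N
  proof -
    have "[] \<in> interp (model_site T) J universal.aM \<phi> [] N \<longleftrightarrow> sat_sieve T \<phi> N \<in> J N"
      using universal.interp_restrict[OF that(1) _ that(2) Nil_stuples] by (simp add: rep_sieve_Nil)
    moreover have "interp (model_site T) J universal.aM \<phi> [] N \<subseteq> {[]}"
      using interp_subset_stuples by (fastforce simp: stuples_def)
    ultimately show ?thesis by auto
  qed
  then show ?thesis using assms by (auto simp: holds_in_def wf_sequent_def)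
qed

text \<open>Gives leastness of the object topology. Each of its covering sieves is obtained in
  \<open>J\<close> by finitely many uses of transitivity, passing to pullbacks of the sieve at
  models satisfying more succedents.\<close>

lemma object_topology_le:
  assumes Q: "finite Q" "\<forall>\<sigma>\<in>Q. wf_sequent (sig T) \<sigma> \<and> ctx \<sigma> = []"
    and J: "forces_quotient T Q J" and N: "N \<in> Obj (model_site T)"
    and S: "S \<in> object_topology (model_site T) (\<lambda>N. \<forall>\<sigma>\<in>Q. sat N (ante \<sigma>) [] \<longrightarrow> sat N (succ \<sigma>) []) N"
  shows "S \<in> J N"
  using N S
\<comment> \<open>The measure counts failing succedents, not violated axioms: a homomorphism can
  make an antecedent true and so create violations, but it never makes a true succedent
  fail.\<close>
proof (induction "card {\<sigma>\<in>Q. \<not> sat N (succ \<sigma>) []}" arbitrary: N S rule: less_induct)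
  case less
  let ?P = "\<lambda>N. \<forall>\<sigma>\<in>Q. sat N (ante \<sigma>) [] \<longrightarrow> sat N (succ \<sigma>) []"
  let ?C = "model_site T"
  show ?case
  proof (cases "?P N")
    case True
    show ?thesis using object_topology_max[OF cat less.prems(1) True less.prems(2)] cov_max less.prems(1) by simp
  next
    case False
    then obtain \<sigma> where \<sigma>: "\<sigma> \<in> Q" "sat N (ante \<sigma>) []" "\<not> sat N (succ \<sigma>) []" by auto
    have w: "wf_form (sig T) (ante \<tau>) []" "wf_form (sig T) (succ \<tau>) []" if "\<tau> \<in> Q" for \<tau>
      using Q(2) that by (auto simp: wf_sequent_def)
    \<comment> \<open>The violated axiom has a true antecedent, which persists along all
      homomorphisms. Its sieve is therefore maximal, and forcing makes the sieve of the succedent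
      cover.\<close>
    have "sat_sieve T (ante \<sigma>) N = max_sieve ?C N"
      using sat_stable[OF w(1)[OF \<sigma>(1)] \<sigma>(2)] by (auto simp: sat_sieve_def)
    then have "sat_sieve T (succ \<sigma>) N \<in> J N"
      using J \<sigma>(1) Q(2) holds_in_closed[of \<sigma>] cov_max[OF less.prems(1)] less.prems(1)
      by (auto simp: forces_quotient_def)
    then show ?thesis
    proof (rule cov_local[OF less.prems(1)])
      show "is_sieve ?C N S" using less.prems(2) by (simp add: object_topology_def)
      fix g assume gs: "g \<in> sat_sieve T (succ \<sigma>) N" and g: "g \<in> max_sieve ?C N"
      \<comment> \<open>No failing succedent is added by preservation, and that of
        \<open>\<sigma>\<close> is removed by the choice of \<open>g\<close>.\<close>
      have "{\<tau>\<in>Q. \<not> sat (Dom ?C g) (succ \<tau>) []} \<subset> {\<tau>\<in>Q. \<not> sat N (succ \<tau>) []}"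
        using sat_stable[OF w(2) _ g] \<sigma> gs by (auto simp: sat_sieve_def)
      then have "card {\<tau>\<in>Q. \<not> sat (Dom ?C g) (succ \<tau>) []} < card {\<tau>\<in>Q. \<not> sat N (succ \<tau>) []}"
        using Q(1) by (intro psubset_card_mono) auto
      moreover have "pullback_sieve ?C g S \<in> object_topology ?C ?P (Dom ?C g)"
        using object_topology[OF cat, of ?P] less.prems(2) g
        by (auto simp: grothendieck_topology_def max_sieve_def)
      ultimately show "pullback_sieve ?C g S \<in> J (Dom ?C g)"
        using less.hyps max_arr[OF g] by blast
    qed
  qed
qed

end

theorem corollary4p4p2:
  fixes T :: "'u gtheory" and Q :: "'u sequent set"
  assumes "universe TYPE('u)"
    and "geometric_theory T"
    and "presheaf_type T"
    and "quotient_extension T Q"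
    and "finite Q"
    and "\<forall>\<sigma>\<in>Q. ctx \<sigma> = []"
  shows "rigid_topology_quotient T Q"
proof -
  let ?C = "model_site T"
  \<comment> \<open>As all contexts are empty, this says that \<open>N\<close> satisfies the axioms
    of \<open>Q\<close>.\<close>
  let ?P = "\<lambda>N. \<forall>\<sigma>\<in>Q. sat N (ante \<sigma>) [] \<longrightarrow> sat N (succ \<sigma>) []"
  let ?J = "object_topology ?C ?P"
  have wf: "wf_signature (sig T)" using assms(2) by (simp add: geometric_theory_def)
  have Q: "\<forall>\<sigma>\<in>Q. wf_sequent (sig T) \<sigma> \<and> ctx \<sigma> = []"
    using assms(4,6) by (simp add: quotient_extension_def)
  note cat = category_model_site[OF wf]
  note top = object_topology[OF cat, of ?P]
  interpret J: model_topology T ?J by unfold_locales (intro cat top wf)+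
  have "forces_quotient T Q ?J"
    unfolding forces_quotient_def
  proof
    fix \<sigma> assume \<sigma>: "\<sigma> \<in> Q"
    then have w: "wf_form (sig T) (succ \<sigma>) []" using Q by (auto simp: wf_sequent_def)
    \<comment> \<open>If the sieve of the antecedent covers, it contains every homomorphism into a
      compact model of \<open>Q\<close>. Such a target satisfies the antecedent, hence the
      succedent, so the sieve of the succedent contains the same homomorphisms.\<close>
    show "holds_in ?C ?J (restrict_struct (sig T) ?C ?J universal_model) \<sigma>"
      using Q \<sigma> J.holds_in_closed[of \<sigma>] J.sat_sieve_is_sieve[OF w]
      by (auto simp: object_topology_def sat_sieve_def)
  qed
  moreover have "?J N \<subseteq> J' N"
    if "grothendieck_topology ?C J'" "forces_quotient T Q J'" "N \<in> Obj ?C" for J' N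
  proof -
    interpret J': model_topology T J' by unfold_locales (intro cat that(1) wf)+
    show ?thesis using J'.object_topology_le[OF assms(5) Q that(2,3)] by blast
  qed
  ultimately have "is_quotient_topology T Q ?J"
    using top by (auto simp: is_quotient_topology_def)
  then show ?thesis
    using object_topology_rigid[OF cat] by (auto simp: rigid_topology_quotient_def)
qed

end
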